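(* Let $\mathcal{U}\subseteq\mathcal{B}(H_1,H_2)$ be a reflexive masa-bimodule and $\mathcal{V}\subseteq\mathcal{B}(H_1,H_2)$ be a masa-bimodule of finite width. Then $\overline{\mathcal{U}+\mathcal{V}}^{w^*}$ is reflexive. In particular, if $\mathcal{W}$ is a nest algebra bimodule then $\overline{\mathcal{U}+\mathcal{W}}^{w^*}$ is reflexive.
   Context: $(X,m)$ and $(Y,n)$ are standard measure spaces ($\sigma$-finite regular Borel measures for Borel structures arising from complete separable metrizable topologies), $H_1=L^2(X,m)$, $H_2=L^2(Y,n)$; $\mathcal{D}_1\subseteq\mathcal{B}(H_1)$ and $\mathcal{D}_2\subseteq\mathcal{B}(H_2)$ are the maximal abelian selfadjoint algebras (masas) of multiplication operators by functions in $L^\infty(X,m)$ and $L^\infty(Y,n)$. $\mathcal{B}(H_1,H_2)$ carries the weak* topology as the dual of the trace class operators from $H_2$ to $H_1$. A masa-bimodule is a subspace $\mathcal{U}\subseteq\mathcal{B}(H_1,H_2)$ with $BTA\in\mathcal{U}$ for all $A\in\mathcal{D}_1$, $B\in\mathcal{D}_2$, $T\in\mathcal{U}$. The reflexive hull of a subspace $\mathcal{S}$ is $\mathrm{Ref}\,\mathcal{S}=\{T\in\mathcal{B}(H_1,H_2):Tx\in\overline{\mathcal{S}x}\ \forall x\in H_1\}$; $\mathcal{S}$ is reflexive if $\mathrm{Ref}\,\mathcal{S}=\mathcal{S}$. A nest is a totally ordered strongly closed set of (orthogonal) projections on a Hilbert space; the corresponding nest algebra is the algebra of all operators leaving each member of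 the nest invariant. A nest algebra bimodule is a weak* closed subspace $\mathcal{V}\subseteq\mathcal{B}(H_1,H_2)$ for which there exist nest algebras $\mathcal{A}\subseteq\mathcal{B}(H_1)$ and $\mathcal{B}\subseteq\mathcal{B}(H_2)$, with nests consisting of projections in $\mathcal{D}_1$ and $\mathcal{D}_2$ respectively, such that $\mathcal{B}\mathcal{V}\mathcal{A}\subseteq\mathcal{V}$ (so $\mathcal{V}$ is a masa-bimodule). A masa-bimodule of finite width is the intersection of finitely many nest algebra bimodules. *)

theory Defs
  imports "HOL-Analysis.Analysis"
begin

section \<open>Standard measure spaces\<close>

text \<open>The topology is a witness on the set \<^term>\<open>space M\<close>, not the topology of a type class, so that
  the underlying space may be any subset of the type. Regularity is meant in the usual sense: inner
  regular by compact sets and outer regular by open sets, on all Borel sets.\<close>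

definition standard_measure :: "'a measure \<Rightarrow> bool" where
  "standard_measure M \<longleftrightarrow> sigma_finite_measure M \<and>
    (\<exists>X. topspace X = space M \<and> completely_metrizable_space X \<and>
      separable_space X \<and>
      sets M = sigma_sets (space M) {G. openin X G} \<and>
      (\<forall>B\<in>sets M. emeasure M B = (SUP K\<in>{K. compactin X K \<and> K \<subseteq> B}. emeasure M K)) \<and>
      (\<forall>B\<in>sets M. emeasure M B = (INF G\<in>{G. openin X G \<and> B \<subseteq> G}. emeasure M G)))"


section \<open>The Hilbert space of square integrable functions\<close>

text \<open>Vectors are genuine classes modulo equality almost everywhere. Since measurability and the
  almost-everywhere quantifier only look at \<^term>\<open>space M\<close>, a class does not constrain the values of
  its members outside \<^term>\<open>space M\<close>.\<close>

type_synonym 'a vec = "('a \<Rightarrow> complex) set"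

definition square_integrable :: "'a measure \<Rightarrow> ('a \<Rightarrow> complex) set" where
  "square_integrable M =
    {f. f \<in> borel_measurable M \<and> integrable M (\<lambda>x. (cmod (f x))\<^sup>2)}"

definition l2_class :: "'a measure \<Rightarrow> ('a \<Rightarrow> complex) \<Rightarrow> 'a vec" where
  "l2_class M f = {g \<in> square_integrable M. AE x in M. g x = f x}"

definition L2 :: "'a measure \<Rightarrow> 'a vec set" where
  "L2 M = l2_class M ` square_integrable M"

definition l2_rep :: "'a vec \<Rightarrow> 'a \<Rightarrow> complex" where
  "l2_rep u = (SOME f. f \<in> u)"

definition l2_zero :: "'a measure \<Rightarrow> 'a vec" where
  "l2_zero M = l2_class M (\<lambda>_. 0)"

definition l2_add :: "'a measure \<Rightarrow> 'a vec \<Rightarrow> 'a vec \<Rightarrow> 'a vec" where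
  "l2_add M u v = l2_class M (\<lambda>x. l2_rep u x + l2_rep v x)"

definition l2_scale :: "'a measure \<Rightarrow> complex \<Rightarrow> 'a vec \<Rightarrow> 'a vec" where
  "l2_scale M c u = l2_class M (\<lambda>x. c * l2_rep u x)"

definition l2_inner :: "'a measure \<Rightarrow> 'a vec \<Rightarrow> 'a vec \<Rightarrow> complex" where
  "l2_inner M u v = (\<integral>x. l2_rep u x * cnj (l2_rep v x) \<partial>M)"

definition l2_dist :: "'a measure \<Rightarrow> 'a vec \<Rightarrow> 'a vec \<Rightarrow> real" where
  "l2_dist M u v = sqrt (\<integral>x. (cmod (l2_rep u x - l2_rep v x))\<^sup>2 \<partial>M)"

definition l2_norm :: "'a measure \<Rightarrow> 'a vec \<Rightarrow> real" where
  "l2_norm M u = sqrt (\<integral>x. (cmod (l2_rep u x))\<^sup>2 \<partial>M)"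

lemma square_integrable_diff: assumes "f \<in> square_integrable M" "g \<in> square_integrable M"
  shows "integrable M (\<lambda>x. (cmod (f x - g x))\<^sup>2)"
proof -
  have m: "f \<in> borel_measurable M" "g \<in> borel_measurable M"
    using assms by (auto simp: square_integrable_def)
  have i: "integrable M (\<lambda>x. 2 * (cmod (f x))\<^sup>2 + 2 * (cmod (g x))\<^sup>2)"
    using assms by (auto simp: square_integrable_def)
  show ?thesis
  proof (rule Bochner_Integration.integrable_bound[OF i])
    show "(\<lambda>x. (cmod (f x - g x))\<^sup>2) \<in> borel_measurable M" using m by measurable
    have "(cmod (a - b))\<^sup>2 \<le> 2 * (cmod a)\<^sup>2 + 2 * (cmod b)\<^sup>2" for a b
    proof -
      have "(cmod (a-b))\<^sup>2 \<le> (cmod a + cmod b)\<^sup>2" by (simp add: norm_triangle_ineq4 power_mono)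
      also have "\<dots> \<le> 2 * (cmod a)\<^sup>2 + 2 * (cmod b)\<^sup>2"
        using sum_squares_bound[of "cmod a" "cmod b"] by (simp add: power2_sum)
      finally show ?thesis .
    qed
    then show "AE x in M. norm ((cmod (f x - g x))\<^sup>2) \<le> norm (2 * (cmod (f x))\<^sup>2 + 2 * (cmod (g x))\<^sup>2)"
      by (smt (verit) AE_I2 norm_of_real real_norm_def zero_le_power2)
  qed
qed

lemma l2_class_cong: assumes "AE x in M. f x = g x" shows "l2_class M f = l2_class M g"
proof -
  have "(AE x in M. h x = f x) \<longleftrightarrow> (AE x in M. h x = g x)" for h
    proof
      assume "AE x in M. h x = f x" with assms show "AE x in M. h x = g x" by eventually_elim simp
    next
      assume "AE x in M. h x = g x" with assms show "AE x in M. h x = f x" by eventually_elim simp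
    qed
  then show ?thesis by (simp add: l2_class_def)
qed

lemma l2_rep_in: assumes "u \<in> L2 M" shows "l2_rep u \<in> u" "l2_rep u \<in> square_integrable M" "u = l2_class M (l2_rep u)"
proof -
  obtain f where f: "f \<in> square_integrable M" "u = l2_class M f" using assms by (auto simp: L2_def)
  then have "f \<in> u" by (auto simp: l2_class_def)
  then show 1: "l2_rep u \<in> u" unfolding l2_rep_def by (metis (mono_tags) someI_ex)
  then show "l2_rep u \<in> square_integrable M" using f by (auto simp: l2_class_def)
  have "AE x in M. l2_rep u x = f x" using 1 f by (auto simp: l2_class_def)
  then show "u = l2_class M (l2_rep u)" using f l2_class_cong by metis
qed

lemma Metric_space_L2: "Metric_space (L2 M) (l2_dist M)"
proof
  show "0 \<le> l2_dist M u v" for u v by (simp add: l2_dist_def)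
  show "l2_dist M u v = l2_dist M v u" for u v by (simp add: l2_dist_def norm_minus_commute)
next
  fix u v assume uv: "u \<in> L2 M" "v \<in> L2 M"
  have "l2_dist M u v = 0 \<longleftrightarrow> (AE x in M. (cmod (l2_rep u x - l2_rep v x))\<^sup>2 = 0)"
    unfolding l2_dist_def real_sqrt_eq_0_iff
    by (rule integral_nonneg_eq_0_iff_AE[OF square_integrable_diff]) (use l2_rep_in uv in auto)
  also have "\<dots> \<longleftrightarrow> (AE x in M. l2_rep u x = l2_rep v x)" by simp
  also have "\<dots> \<longleftrightarrow> u = v"
  proof
    assume a: "AE x in M. l2_rep u x = l2_rep v x"
    have "l2_class M (l2_rep u) = l2_class M (l2_rep v)" 
      by (rule l2_class_cong[OF a])
    then show "u = v" using l2_rep_in(3) uv by metis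
  qed auto
  finally show "l2_dist M u v = 0 \<longleftrightarrow> u = v" .
next
  fix u v w assume *: "u \<in> L2 M" "v \<in> L2 M" "w \<in> L2 M"
  let ?a = "\<lambda>x. cmod (l2_rep u x - l2_rep v x)" and ?b = "\<lambda>x. cmod (l2_rep v x - l2_rep w x)"
  let ?c = "\<lambda>x. cmod (l2_rep u x - l2_rep w x)"
  note i = square_integrable_diff[OF l2_rep_in(2) l2_rep_in(2)]
  have ia: "integrable M (\<lambda>x. (?a x)\<^sup>2)" and ib: "integrable M (\<lambda>x. (?b x)\<^sup>2)" and ic: "integrable M (\<lambda>x. (?c x)\<^sup>2)"
    using i * by auto
  let ?A = "l2_dist M u v" and ?B = "l2_dist M v w"
  have A: "(\<integral>x. (?a x)\<^sup>2 \<partial>M) = ?A\<^sup>2" "(\<integral>x. (?b x)\<^sup>2 \<partial>M) = ?B\<^sup>2" by (auto simp: l2_dist_def)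
  have key: "(\<integral>x. (?c x)\<^sup>2 \<partial>M) \<le> (1+t) * ?A\<^sup>2 + (1+1/t) * ?B\<^sup>2" if "t > 0" for t
  proof -
    have "(\<integral>x. (?c x)\<^sup>2 \<partial>M) \<le> (\<integral>x. (1+t) * (?a x)\<^sup>2 + (1+1/t) * (?b x)\<^sup>2 \<partial>M)"
    proof (rule integral_mono)
      fix x
      have "(?c x)\<^sup>2 \<le> (?a x + ?b x)\<^sup>2"
        by (metis (no_types, lifting) diff_add_cancel add_diff_eq norm_ge_zero norm_triangle_ineq power_mono)
      also have "\<dots> \<le> (1+t) * (?a x)\<^sup>2 + (1+1/t) * (?b x)\<^sup>2"
      proof -
        have "0 \<le> (t * ?a x - ?b x)\<^sup>2 / t" using that by simp
        also have "\<dots> = t * (?a x)\<^sup>2 + 1/t * (?b x)\<^sup>2 - 2 * ?a x * ?b x"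
          using that by (simp add: power2_eq_square field_simps)
        finally show ?thesis by (simp add: power2_sum algebra_simps)
      qed
      finally show "(?c x)\<^sup>2 \<le> (1+t) * (?a x)\<^sup>2 + (1+1/t) * (?b x)\<^sup>2" .
    qed (use ia ib ic in auto)
    also have "\<dots> = (1+t) * ?A\<^sup>2 + (1+1/t) * ?B\<^sup>2"
      using ia ib A by simp
    finally show ?thesis .
  qed
  have nn: "?A \<ge> 0" "?B \<ge> 0" by (auto simp: l2_dist_def)
  have "(l2_dist M u w)\<^sup>2 \<le> (?A + ?B)\<^sup>2"
  proof (rule field_le_epsilon)
    fix e :: real assume e: "e > 0"
    define r where "r = e / (2 * (?A + ?B) + e + 1)"
    define d where "d = min 1 r"
    have "r > 0" unfolding r_def using e nn by (intro divide_pos_pos) auto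
    then have d: "d > 0" "d \<le> r" by (auto simp: d_def)
    let ?t = "(?B + d) / (?A + d)"
    have p: "?A + d > 0" "?B + d > 0" using nn d by auto
    have "(l2_dist M u w)\<^sup>2 \<le> (1+?t) * ?A\<^sup>2 + (1+1/?t) * ?B\<^sup>2"
      using key[of ?t] p by (simp add: l2_dist_def)
    also have "\<dots> \<le> (1+?t) * (?A * (?A+d)) + (1+1/?t) * (?B * (?B + d))"
      using p nn d by (intro add_mono mult_left_mono) (auto simp: power2_eq_square intro!: mult_left_mono add_nonneg_nonneg divide_nonneg_nonneg)
    also have "\<dots> = (?A + ?B + 2*d) * (?A + ?B)"
    proof -
      have 1: "(1+?t) * (?A+d) = ?A + ?B + 2*d" using p by (simp add: field_simps)
      have 2: "(1+1/?t) * (?B+d) = ?A + ?B + 2*d" using p by (simp add: field_simps)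
      have "X * (a * y) + Z * (b * z) = (s::real) * (a + b)" if "X * y = s" "Z * z = s" for X y Z z a b s
        using that by (metis distrib_left mult.commute mult.left_commute)
      from this[OF 1 2] show ?thesis .
    qed
    also have "\<dots> = (?A + ?B)\<^sup>2 + d * (2 * (?A + ?B))" by (simp add: power2_eq_square algebra_simps)
    also have "d * (2 * (?A + ?B)) \<le> r * (2 * (?A + ?B) + e + 1)"
      using d nn e by (intro mult_mono) auto
    also have "\<dots> = e" unfolding r_def using nn e by (simp add: field_simps)
    finally show "(l2_dist M u w)\<^sup>2 \<le> (?A + ?B)\<^sup>2 + e" by simp
  qed
  then show "l2_dist M u w \<le> ?A + ?B" using nn by (meson add_nonneg_nonneg power2_le_imp_le)
qed

definition l2_topology :: "'a measure \<Rightarrow> 'a vec topology" where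
  "l2_topology M = Metric_space.mtopology (L2 M) (l2_dist M)"

definition orthonormal_basis :: "'a measure \<Rightarrow> 'a vec set \<Rightarrow> bool" where
  "orthonormal_basis M E \<longleftrightarrow> E \<subseteq> L2 M \<and>
    (\<forall>e\<in>E. \<forall>f\<in>E. l2_inner M e f = (if e = f then 1 else 0)) \<and>
    (\<forall>u\<in>L2 M. (\<forall>e\<in>E. l2_inner M u e = 0) \<longrightarrow> u = l2_zero M)"


section \<open>Bounded operators\<close>

text \<open>Operators are extensional functions (\<^const>\<open>undefined\<close> outside the carrier \<^term>\<open>L2 M\<close>), so
  that equality of operators is equality of functions. Composition is \<^const>\<open>compose\<close>.\<close>

type_synonym ('a, 'b) oper = "'a vec \<Rightarrow> 'b vec"

definition bounded_ops :: "'a measure \<Rightarrow> 'b measure \<Rightarrow> ('a, 'b) oper set" where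
  "bounded_ops M N = {T \<in> L2 M \<rightarrow>\<^sub>E L2 N.
    (\<forall>u\<in>L2 M. \<forall>v\<in>L2 M. T (l2_add M u v) = l2_add N (T u) (T v)) \<and>
    (\<forall>c. \<forall>u\<in>L2 M. T (l2_scale M c u) = l2_scale N c (T u)) \<and>
    (\<exists>C. \<forall>u\<in>L2 M. l2_norm N (T u) \<le> C * l2_norm M u)}"

definition op_zero :: "'a measure \<Rightarrow> 'b measure \<Rightarrow> ('a, 'b) oper" where
  "op_zero M N = (\<lambda>u\<in>L2 M. l2_zero N)"

definition op_add :: "'a measure \<Rightarrow> 'b measure \<Rightarrow> ('a, 'b) oper \<Rightarrow> ('a, 'b) oper \<Rightarrow> ('a, 'b) oper" where
  "op_add M N S T = (\<lambda>u\<in>L2 M. l2_add N (S u) (T u))"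

definition op_scale :: "'a measure \<Rightarrow> 'b measure \<Rightarrow> complex \<Rightarrow> ('a, 'b) oper \<Rightarrow> ('a, 'b) oper" where
  "op_scale M N c T = (\<lambda>u\<in>L2 M. l2_scale N c (T u))"

definition op_subspace :: "'a measure \<Rightarrow> 'b measure \<Rightarrow> ('a, 'b) oper set \<Rightarrow> bool" where
  "op_subspace M N \<U> \<longleftrightarrow> \<U> \<subseteq> bounded_ops M N \<and> op_zero M N \<in> \<U> \<and>
    (\<forall>S\<in>\<U>. \<forall>T\<in>\<U>. op_add M N S T \<in> \<U>) \<and>
    (\<forall>c. \<forall>T\<in>\<U>. op_scale M N c T \<in> \<U>)"

definition op_sum :: "'a measure \<Rightarrow> 'b measure \<Rightarrow>
    ('a, 'b) oper set \<Rightarrow> ('a, 'b) oper set \<Rightarrow> ('a, 'b) oper set" where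
  "op_sum M N \<U> \<V> = {op_add M N S T | S T. S \<in> \<U> \<and> T \<in> \<V>}"


section \<open>Operator topologies\<close>

definition strong_topology :: "'a measure \<Rightarrow> 'b measure \<Rightarrow> ('a, 'b) oper topology" where
  "strong_topology M N = topology_generated_by
    {{T \<in> bounded_ops M N. T u \<in> G} | u G. u \<in> L2 M \<and> openin (l2_topology N) G}"

definition positive_op :: "'a measure \<Rightarrow> ('a, 'a) oper \<Rightarrow> bool" where
  "positive_op M P \<longleftrightarrow> P \<in> bounded_ops M M \<and> (\<forall>u\<in>L2 M. l2_inner M (P u) u \<in> \<real>\<^sub>\<ge>\<^sub>0)"

text \<open>\<open>P\<close> is the absolute value of \<open>A\<close>: it is positive and its square is \<open>A\<^sup>* A\<close>, the latter being
  written out through the matrix elements of \<open>A\<^sup>* A\<close>.\<close>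

definition is_abs_op :: "'a measure \<Rightarrow> 'b measure \<Rightarrow> ('a, 'b) oper \<Rightarrow> ('a, 'a) oper \<Rightarrow> bool" where
  "is_abs_op M N A P \<longleftrightarrow> positive_op M P \<and>
    (\<forall>u\<in>L2 M. \<forall>v\<in>L2 M. l2_inner M (P (P u)) v = l2_inner N (A u) (A v))"

definition trace_class :: "'a measure \<Rightarrow> 'b measure \<Rightarrow> ('a, 'b) oper \<Rightarrow> bool" where
  "trace_class M N A \<longleftrightarrow> A \<in> bounded_ops M N \<and>
    (\<exists>P E. is_abs_op M N A P \<and> orthonormal_basis M E \<and>
      (\<lambda>e. l2_inner M (P e) e) summable_on E)"

text \<open>The trace of a trace class operator does not depend on the basis chosen here.\<close>

definition op_trace :: "'a measure \<Rightarrow> ('a, 'a) oper \<Rightarrow> complex" where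
  "op_trace M C = (\<Sum>\<^sub>\<infinity>e\<in>(SOME E. orthonormal_basis M E). l2_inner M (C e) e)"

text \<open>The trace class operators \<open>A\<close> from the second space to the first one act on the bounded operators
  \<open>T\<close> from the first to the second by sending \<open>T\<close> to the trace of \<open>T A\<close>.\<close>

definition weak_star_topology :: "'a measure \<Rightarrow> 'b measure \<Rightarrow> ('a, 'b) oper topology" where
  "weak_star_topology M N = topology_generated_by
    {{T \<in> bounded_ops M N. op_trace N (compose (L2 N) T A) \<in> G} | A G.
      trace_class N M A \<and> open G}"


section \<open>Masa-bimodules and reflexivity\<close>

definition ess_bounded :: "'a measure \<Rightarrow> ('a \<Rightarrow> complex) set" where
  "ess_bounded M = {f. f \<in> borel_measurable M \<and> (\<exists>C. AE x in M. cmod (f x) \<le> C)}"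

definition mult_op :: "'a measure \<Rightarrow> ('a \<Rightarrow> complex) \<Rightarrow> ('a, 'a) oper" where
  "mult_op M f = (\<lambda>u\<in>L2 M. l2_class M (\<lambda>x. f x * l2_rep u x))"

definition masa :: "'a measure \<Rightarrow> ('a, 'a) oper set" where
  "masa M = mult_op M ` ess_bounded M"

definition masa_bimodule :: "'a measure \<Rightarrow> 'b measure \<Rightarrow> ('a, 'b) oper set \<Rightarrow> bool" where
  "masa_bimodule M N \<U> \<longleftrightarrow> op_subspace M N \<U> \<and>
    (\<forall>A\<in>masa M. \<forall>B\<in>masa N. \<forall>T\<in>\<U>. compose (L2 M) B (compose (L2 M) T A) \<in> \<U>)"

definition reflexive_hull :: "'a measure \<Rightarrow> 'b measure \<Rightarrow> ('a, 'b) oper set \<Rightarrow> ('a, 'b) oper set" where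
  "reflexive_hull M N \<S> = {T \<in> bounded_ops M N.
    \<forall>u\<in>L2 M. T u \<in> l2_topology N closure_of ((\<lambda>S. S u) ` \<S>)}"

definition reflexive :: "'a measure \<Rightarrow> 'b measure \<Rightarrow> ('a, 'b) oper set \<Rightarrow> bool" where
  "reflexive M N \<S> \<longleftrightarrow> reflexive_hull M N \<S> = \<S>"


section \<open>Nests, nest algebra bimodules and finite width\<close>

definition projection_op :: "'a measure \<Rightarrow> ('a, 'a) oper \<Rightarrow> bool" where
  "projection_op M P \<longleftrightarrow> P \<in> bounded_ops M M \<and> compose (L2 M) P P = P \<and>
    (\<forall>u\<in>L2 M. \<forall>v\<in>L2 M. l2_inner M (P u) v = l2_inner M u (P v))"

definition op_range :: "'a measure \<Rightarrow> ('a, 'b) oper \<Rightarrow> 'b vec set" where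
  "op_range M P = P ` L2 M"

definition nest :: "'a measure \<Rightarrow> ('a, 'a) oper set \<Rightarrow> bool" where
  "nest M \<N> \<longleftrightarrow> (\<forall>P\<in>\<N>. projection_op M P) \<and>
    (\<forall>P\<in>\<N>. \<forall>Q\<in>\<N>. op_range M P \<subseteq> op_range M Q \<or> op_range M Q \<subseteq> op_range M P) \<and>
    closedin (strong_topology M M) \<N>"

definition nest_algebra :: "'a measure \<Rightarrow> ('a, 'a) oper set \<Rightarrow> ('a, 'a) oper set" where
  "nest_algebra M \<N> = {T \<in> bounded_ops M M. \<forall>P\<in>\<N>. T ` op_range M P \<subseteq> op_range M P}"

definition nest_algebra_bimodule :: "'a measure \<Rightarrow> 'b measure \<Rightarrow> ('a, 'b) oper set \<Rightarrow> bool" where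
  "nest_algebra_bimodule M N \<V> \<longleftrightarrow>
    op_subspace M N \<V> \<and> closedin (weak_star_topology M N) \<V> \<and>
    (\<exists>\<N>\<^sub>1 \<N>\<^sub>2. nest M \<N>\<^sub>1 \<and> \<N>\<^sub>1 \<subseteq> masa M \<and> nest N \<N>\<^sub>2 \<and> \<N>\<^sub>2 \<subseteq> masa N \<and>
      (\<forall>A\<in>nest_algebra M \<N>\<^sub>1. \<forall>B\<in>nest_algebra N \<N>\<^sub>2. \<forall>T\<in>\<V>.
        compose (L2 M) B (compose (L2 M) T A) \<in> \<V>))"

text \<open>The nests may differ from one member of the finite family to the next.\<close>

definition finite_width :: "'a measure \<Rightarrow> 'b measure \<Rightarrow> ('a, 'b) oper set \<Rightarrow> bool" where
  "finite_width M N \<V> \<longleftrightarrow> (\<exists>\<F>. finite \<F> \<and> \<F> \<noteq> {} \<and>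
    (\<forall>\<W>\<in>\<F>. nest_algebra_bimodule M N \<W>) \<and> \<V> = \<Inter>\<F>)"

end

theory Submission
  imports Defs
begin

text \<open>
  Let \<open>Z\<close> be the reflexive hull of \<open>\<U> + \<V>\<close>, where \<open>\<V>\<close> is the intersection of the nest algebra bimodules
  \<open>W\<^sub>1, \<dots>, W\<^sub>m\<close>. It suffices that \<open>Z'\<close> lies in the weak* closure of \<open>\<U> + Z' \<inter> W\<close> for every weak* closed
  masa-bimodule \<open>Z' \<subseteq> Z\<close> and every \<open>W = W\<^sub>i\<close>, since this can be applied with \<open>W\<^sub>1, \<dots>, W\<^sub>m\<close> in turn.

  Let \<open>P\<close> run through the nest of \<open>W\<close> on the first space and let \<open>\<phi>(P)\<close> be the projection onto the closed range of
  \<open>W P\<close>. Given \<open>T\<close> in \<open>Z'\<close> and finitely many \<open>P\<close>, cut \<open>T\<close> into blocks. The blocks below the diagonal are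
  annihilated by \<open>W\<close>, so they lie in \<open>\<U>\<close> because \<open>\<U>\<close> is reflexive; the blocks above the diagonal lie in
  \<open>W\<close>; the diagonal part has norm at most that of \<open>T\<close>. A cluster point \<open>E\<close> of the diagonal parts
  satisfies \<open>(1 - \<phi>(P)) E P = 0\<close> for all \<open>P\<close>, and this implies \<open>E \<in> W\<close>.

  For the last implication let the functional \<open>T \<mapsto> \<Sum>\<^sub>i \<langle>T x\<^sub>i, y\<^sub>i\<rangle>\<close> kill \<open>W\<close>. Its value at \<open>E\<close> is the integral of
  \<open>s \<mapsto> \<langle>x(s), v(s)\<rangle>\<close> with \<open>x(s) = (x\<^sub>i(s))\<^sub>i\<close> and \<open>v(s) = ((E\<^sup>* y\<^sub>i)(s))\<^sub>i\<close> in \<open>\<ell>\<^sup>2\<close>. The nest induces an increasing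
  family of projections in \<open>\<ell>\<^sup>2\<close> for which \<open>x(s)\<close> lives to the right and \<open>v(s)\<close> to the left of the level of \<open>s\<close>;
  as such a family has only countably many jumps, the integrand vanishes almost everywhere.
\<close>

section \<open>Square integrable functions\<close>

text \<open>Reflexivity speaks about rank one functionals \<open>form M N T f g\<close>, weak*
  closure about all trace class functionals. The projection theorem turns reflexive hulls into
  vanishing conditions on rank one functionals, so the two kinds of functional have to be compared
  only for a single nest algebra bimodule; there the problem becomes one of measure theory. The
  parts of \<open>T\<close> below and above the diagonal need not stay bounded when more and more
  \<open>P\<close> are used, as is familiar from triangular truncation, so no limits of them are
  taken. What converges boundedly to \<open>T\<close> is \<open>T - D + E\<close>, with
  \<open>D\<close> the diagonal part and \<open>E\<close> its cluster point: \<open>T - D\<close> is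
  the sum of the two triangular parts and \<open>E\<close> lies in Z' \<inter> W. This is why Z' has
  to be weak* closed, and keeping Z' in the second summand is what allows the next bimodule to cut
  that summand again.\<close>

abbreviation sq :: "'a measure \<Rightarrow> ('a \<Rightarrow> complex) set" where
  "sq \<equiv> square_integrable"

text \<open>Inner product and norm live on functions rather than classes, so that linearity holds
  without choosing representatives; null functions are dealt with by
  \<open>ip_cong_AE\<close>.\<close>

definition ip :: "'a measure \<Rightarrow> ('a \<Rightarrow> complex) \<Rightarrow> ('a \<Rightarrow> complex) \<Rightarrow> complex" where
  "ip M f g = (\<integral>x. f x * cnj (g x) \<partial>M)"

definition nrm :: "'a measure \<Rightarrow> ('a \<Rightarrow> complex) \<Rightarrow> real" where
  "nrm M f = sqrt (\<integral>x. (cmod (f x))\<^sup>2 \<partial>M)"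

lemma borel_measurable_cnj' [measurable]: "cnj \<in> borel_measurable borel"
  by (intro borel_measurable_continuous_onI continuous_intros)

lemma sq_measurable [measurable_dest]: "f \<in> sq M \<Longrightarrow> f \<in> borel_measurable M"
  by (simp add: square_integrable_def)

lemma sq_integrable: "f \<in> sq M \<Longrightarrow> integrable M (\<lambda>x. (cmod (f x))\<^sup>2)"
  by (simp add: square_integrable_def)

lemma sq_bound:
  assumes "f \<in> borel_measurable M" "g \<in> sq M" "AE x in M. cmod (f x) \<le> C * cmod (g x)"
  shows "f \<in> sq M"
proof -
  have "integrable M (\<lambda>x. C\<^sup>2 * (cmod (g x))\<^sup>2)" using assms(2) by (simp add: sq_integrable)
  then have "integrable M (\<lambda>x. (cmod (f x))\<^sup>2)"
  proof (rule Bochner_Integration.integrable_bound)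
    show "(\<lambda>x. (cmod (f x))\<^sup>2) \<in> borel_measurable M" using assms(1) by measurable
    show "AE x in M. norm ((cmod (f x))\<^sup>2) \<le> norm (C\<^sup>2 * (cmod (g x))\<^sup>2)"
      using assms(3)
    proof eventually_elim
      case (elim x)
      then have "(cmod (f x))\<^sup>2 \<le> (C * cmod (g x))\<^sup>2" by (intro power_mono) auto
      then show ?case by (simp add: power_mult_distrib)
    qed
  qed
  then show ?thesis using assms(1) by (simp add: square_integrable_def)
qed

lemma sq_zero [simp, intro]: "(\<lambda>x. 0) \<in> sq M"
  by (simp add: square_integrable_def)

lemma sq_scale [simp, intro]: "f \<in> sq M \<Longrightarrow> (\<lambda>x. c * f x) \<in> sq M"
  by (rule sq_bound[where g = f and C = "cmod c"]) (auto simp: norm_mult sq_measurable)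

lemma sq_diff [simp, intro]: "f \<in> sq M \<Longrightarrow> g \<in> sq M \<Longrightarrow> (\<lambda>x. f x - g x) \<in> sq M"
  using square_integrable_diff[of f M g] by (auto simp: square_integrable_def)

lemma sq_minus [simp, intro]: "f \<in> sq M \<Longrightarrow> (\<lambda>x. - f x) \<in> sq M"
  using sq_scale[of f M "-1"] by simp

lemma sq_add [simp, intro]: "f \<in> sq M \<Longrightarrow> g \<in> sq M \<Longrightarrow> (\<lambda>x. f x + g x) \<in> sq M"
  using sq_diff[of f M "\<lambda>x. - g x"] by simp

lemma sq_sum [simp, intro]: "(\<And>i. i \<in> I \<Longrightarrow> f i \<in> sq M) \<Longrightarrow> (\<lambda>x. \<Sum>i\<in>I. f i x) \<in> sq M"
  by (induction I rule: infinite_finite_induct) auto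

lemma integrable_sq_mult:
  assumes "f \<in> sq M" "g \<in> sq M" shows "integrable M (\<lambda>x. cmod (f x) * cmod (g x))"
proof (rule Bochner_Integration.integrable_bound)
  note [measurable] = assms[THEN sq_measurable]
  show "integrable M (\<lambda>x. (cmod (f x))\<^sup>2 + (cmod (g x))\<^sup>2)" using assms by (simp add: sq_integrable)
  show "(\<lambda>x. cmod (f x) * cmod (g x)) \<in> borel_measurable M" by measurable
  have "a * b \<le> a\<^sup>2 + b\<^sup>2" if "a \<ge> 0" "b \<ge> 0" for a b :: real
    using sum_squares_bound[of a b] mult_nonneg_nonneg[OF that] by linarith
  then show "AE x in M. norm (cmod (f x) * cmod (g x)) \<le> norm ((cmod (f x))\<^sup>2 + (cmod (g x))\<^sup>2)"
    by (simp add: abs_mult)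
qed

lemma integrable_ip:
  assumes "f \<in> sq M" "g \<in> sq M" shows "integrable M (\<lambda>x. f x * cnj (g x))"
proof (rule Bochner_Integration.integrable_bound[OF integrable_sq_mult[OF assms]])
  note [measurable] = assms[THEN sq_measurable]
  show "(\<lambda>x. f x * cnj (g x)) \<in> borel_measurable M" by measurable
qed (auto simp: norm_mult)

lemma ip_add_left: "f \<in> sq M \<Longrightarrow> g \<in> sq M \<Longrightarrow> h \<in> sq M \<Longrightarrow> ip M (\<lambda>x. f x + g x) h = ip M f h + ip M g h"
  unfolding ip_def distrib_right by (simp add: integrable_ip)

lemma ip_diff_left: "f \<in> sq M \<Longrightarrow> g \<in> sq M \<Longrightarrow> h \<in> sq M \<Longrightarrow> ip M (\<lambda>x. f x - g x) h = ip M f h - ip M g h"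
  unfolding ip_def left_diff_distrib by (simp add: integrable_ip)

lemma ip_scale_left: "ip M (\<lambda>x. c * f x) h = c * ip M f h"
  unfolding ip_def by (simp add: mult.assoc)

lemma cnj_ip: "cnj (ip M f g) = ip M g f"
  unfolding ip_def by (simp add: mult.commute flip: Bochner_Integration.integral_cnj)

lemma ip_add_right: "f \<in> sq M \<Longrightarrow> g \<in> sq M \<Longrightarrow> h \<in> sq M \<Longrightarrow> ip M h (\<lambda>x. f x + g x) = ip M h f + ip M h g"
  using arg_cong[OF ip_add_left[of f M g h], of cnj] by (simp add: cnj_ip)

lemma ip_diff_right: "f \<in> sq M \<Longrightarrow> g \<in> sq M \<Longrightarrow> h \<in> sq M \<Longrightarrow> ip M h (\<lambda>x. f x - g x) = ip M h f - ip M h g"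
  using arg_cong[OF ip_diff_left[of f M g h], of cnj] by (simp add: cnj_ip)

lemma ip_scale_right: "ip M h (\<lambda>x. c * f x) = cnj c * ip M h f"
  using arg_cong[OF ip_scale_left[of M c f h], of cnj] by (simp add: cnj_ip)

lemma ip_zero [simp]: "ip M (\<lambda>x. 0) h = 0" "ip M h (\<lambda>x. 0) = 0"
  by (simp_all add: ip_def)

lemma ip_sum_left: "(\<And>i. i \<in> I \<Longrightarrow> f i \<in> sq M) \<Longrightarrow> h \<in> sq M \<Longrightarrow>
    ip M (\<lambda>x. \<Sum>i\<in>I. f i x) h = (\<Sum>i\<in>I. ip M (f i) h)"
  by (induction I rule: infinite_finite_induct) (auto simp: ip_add_left)

lemma ip_sum_right: "(\<And>i. i \<in> I \<Longrightarrow> f i \<in> sq M) \<Longrightarrow> h \<in> sq M \<Longrightarrow>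
    ip M h (\<lambda>x. \<Sum>i\<in>I. f i x) = (\<Sum>i\<in>I. ip M h (f i))"
  by (induction I rule: infinite_finite_induct) (auto simp: ip_add_right)

lemma ip_cong_AE:
  assumes "f \<in> sq M" "g \<in> sq M" "f' \<in> sq M" "g' \<in> sq M"
    and "AE x in M. f x = f' x" "AE x in M. g x = g' x"
  shows "ip M f g = ip M f' g'"
  unfolding ip_def
proof (rule integral_cong_AE)
  note [measurable] = assms(1-4)[THEN sq_measurable]
  show "(\<lambda>x. f x * cnj (g x)) \<in> borel_measurable M" "(\<lambda>x. f' x * cnj (g' x)) \<in> borel_measurable M"
    by measurable
  show "AE x in M. f x * cnj (g x) = f' x * cnj (g' x)" using assms(5,6) by eventually_elim simp
qed

lemma nrm_nonneg [simp]: "0 \<le> nrm M f" by (simp add: nrm_def)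

lemma nrm_sq: "(nrm M f)\<^sup>2 = (\<integral>x. (cmod (f x))\<^sup>2 \<partial>M)" by (simp add: nrm_def)

lemma nrm_zero [simp]: "nrm M (\<lambda>x. 0) = 0" by (simp add: nrm_def)

lemma ip_self: "ip M f f = complex_of_real ((nrm M f)\<^sup>2)"
  unfolding ip_def nrm_sq
  by (simp only: complex_norm_square[symmetric] of_real_power[symmetric] integral_complex_of_real)

lemma nrm_scale: "nrm M (\<lambda>x. c * f x) = cmod c * nrm M f"
  by (simp add: nrm_def norm_mult power_mult_distrib real_sqrt_mult)

lemma nrm_eq_0_iff: "f \<in> sq M \<Longrightarrow> nrm M f = 0 \<longleftrightarrow> (AE x in M. f x = 0)"
  unfolding nrm_def real_sqrt_eq_0_iff by (subst integral_nonneg_eq_0_iff_AE) (auto simp: sq_integrable)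

lemma nrm_cong_AE:
  assumes "f \<in> sq M" "g \<in> sq M" "AE x in M. f x = g x" shows "nrm M f = nrm M g"
  using ip_cong_AE[OF assms(1,1) assms(2,2) assms(3,3)]
  by (metis ip_self nrm_nonneg of_real_eq_iff power2_eq_imp_eq)

text \<open>The quadratic in \<open>c\<close> behind the Cauchy-Schwarz inequality, the projection
  theorem and Bessel's inequality.\<close>

lemma nrm_diff_expand:
  assumes "f \<in> sq M" "g \<in> sq M"
  shows "(nrm M (\<lambda>x. f x - c * g x))\<^sup>2 =
    (nrm M f)\<^sup>2 - 2 * Re (cnj c * ip M f g) + (cmod c)\<^sup>2 * (nrm M g)\<^sup>2"
proof -
  have "complex_of_real ((nrm M (\<lambda>x. f x - c * g x))\<^sup>2) =
      ip M f f - cnj c * ip M f g - (c * ip M g f - c * (cnj c * ip M g g))"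
    unfolding ip_self[symmetric] using assms
    by (simp add: ip_diff_left ip_diff_right ip_scale_left ip_scale_right algebra_simps)
  also have "c * ip M g f = cnj (cnj c * ip M f g)" by (simp add: cnj_ip)
  also have "c * (cnj c * ip M g g) = complex_of_real ((cmod c)\<^sup>2 * (nrm M g)\<^sup>2)"
    using complex_norm_square[of c] by (simp add: ip_self mult.assoc[symmetric])
  finally have "Re (complex_of_real ((nrm M (\<lambda>x. f x - c * g x))\<^sup>2)) =
    Re (ip M f f - cnj c * ip M f g - (cnj (cnj c * ip M f g) - complex_of_real ((cmod c)\<^sup>2 * (nrm M g)\<^sup>2)))"
    by simp
  then show ?thesis by (simp add: ip_self)
qed

lemma ip_bound:
  assumes "f \<in> sq M" "g \<in> sq M" shows "cmod (ip M f g) \<le> nrm M f * nrm M g"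
proof (cases "nrm M g = 0")
  case True
  then have "AE x in M. g x = 0" using assms by (simp add: nrm_eq_0_iff)
  then have "ip M f g = ip M f (\<lambda>x. 0)" using assms by (intro ip_cong_AE) auto
  then show ?thesis by simp
next
  case False
  \<comment> \<open>The coefficient of the orthogonal projection of \<open>f\<close> onto
    \<open>g\<close>, where the quadratic of \<open>nrm_diff_expand\<close> is smallest.\<close>
  define c where "c = ip M f g / (nrm M g)\<^sup>2"
  have c: "Re (cnj c * ip M f g) = (cmod (ip M f g))\<^sup>2 / (nrm M g)\<^sup>2"
    unfolding c_def complex_cnj_divide
    by (simp add: complex_norm_square[symmetric] mult.commute[of "cnj _"] flip: of_real_power of_real_divide)
  have "0 \<le> (nrm M f)\<^sup>2 - 2 * Re (cnj c * ip M f g) + (cmod c)\<^sup>2 * (nrm M g)\<^sup>2"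
    unfolding nrm_diff_expand[OF assms, symmetric] by simp
  also have "\<dots> = (nrm M f)\<^sup>2 - (cmod (ip M f g))\<^sup>2 / (nrm M g)\<^sup>2"
    unfolding c using False
    by (simp add: c_def norm_divide norm_power power_divide) (simp add: power2_eq_square power4_eq_xxxx field_simps)
  finally have "(cmod (ip M f g))\<^sup>2 \<le> (nrm M f * nrm M g)\<^sup>2"
    using False by (simp add: field_simps power_mult_distrib)
  then show ?thesis by (rule power2_le_imp_le) simp
qed

lemma nrm_minus_commute: "nrm M (\<lambda>x. f x - g x) = nrm M (\<lambda>x. g x - f x)"
  by (simp add: nrm_def norm_minus_commute)

lemma nrm_triangle:
  assumes "f \<in> sq M" "g \<in> sq M" shows "nrm M (\<lambda>x. f x + g x) \<le> nrm M f + nrm M g"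
proof -
  have "(nrm M (\<lambda>x. f x + g x))\<^sup>2 = (nrm M f)\<^sup>2 + 2 * Re (ip M f g) + (nrm M g)\<^sup>2"
    using nrm_diff_expand[OF assms, of "-1"] by simp
  also have "\<dots> \<le> (nrm M f)\<^sup>2 + 2 * (nrm M f * nrm M g) + (nrm M g)\<^sup>2"
    using ip_bound[OF assms] complex_Re_le_cmod[of "ip M f g"] by simp
  also have "\<dots> = (nrm M f + nrm M g)\<^sup>2" by (simp add: power2_sum)
  finally show ?thesis by (rule power2_le_imp_le) simp
qed

lemma nrm_triangle_diff:
  assumes "f \<in> sq M" "g \<in> sq M" "h \<in> sq M"
  shows "nrm M (\<lambda>x. f x - h x) \<le> nrm M (\<lambda>x. f x - g x) + nrm M (\<lambda>x. g x - h x)"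
  using nrm_triangle[of "\<lambda>x. f x - g x" M "\<lambda>x. g x - h x"] assms by simp

section \<open>Completeness, orthogonal projection and the Riesz representation theorem\<close>

lemma AE_summable:
  fixes h :: "nat \<Rightarrow> 'a \<Rightarrow> real"
  assumes "\<And>k. integrable M (h k)" "\<And>k x. 0 \<le> h k x" "summable (\<lambda>k. \<integral>x. h k x \<partial>M)"
  shows "AE x in M. summable (\<lambda>k. h k x)"
proof -
  have "(\<integral>\<^sup>+x. (\<Sum>k. ennreal (h k x)) \<partial>M) = (\<Sum>k. \<integral>\<^sup>+x. ennreal (h k x) \<partial>M)"
    using assms(1) by (intro nn_integral_suminf) auto
  also have "\<dots> = (\<Sum>k. ennreal (\<integral>x. h k x \<partial>M))"
    using assms by (simp add: nn_integral_eq_integral)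
  also have "\<dots> \<noteq> \<infinity>"
    using assms by (subst suminf_ennreal2) (auto intro: integral_nonneg_AE)
  finally have "AE x in M. (\<Sum>k. ennreal (h k x)) \<noteq> \<infinity>"
    using assms(1) by (intro nn_integral_noteq_infinite) auto
  then show ?thesis
  proof eventually_elim
    case (elim x)
    then show ?case by (intro summable_suminf_not_top assms(2)) simp
  qed
qed

text \<open>Stated with the nonnegative integral because Fatou's lemma delivers a bound before
  square integrability is known.\<close>

lemma sq_nn_bound:
  assumes [measurable]: "f \<in> borel_measurable M" and "0 \<le> c"
    and "(\<integral>\<^sup>+x. ennreal ((cmod (f x))\<^sup>2) \<partial>M) \<le> ennreal (c\<^sup>2)"
  shows "f \<in> sq M" "nrm M f \<le> c"
proof -
  have i: "integrable M (\<lambda>x. (cmod (f x))\<^sup>2)"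
    using assms by (intro integrableI_bounded) (auto simp: less_top[symmetric] top_unique)
  then show "f \<in> sq M" using assms(1) by (simp add: square_integrable_def)
  have "ennreal ((nrm M f)\<^sup>2) \<le> ennreal (c\<^sup>2)"
    using assms(3) unfolding nrm_sq by (subst (asm) nn_integral_eq_integral[OF i]) auto
  then have "(nrm M f)\<^sup>2 \<le> c\<^sup>2" by (subst (asm) ennreal_le_iff) auto
  then show "nrm M f \<le> c" using assms(2) by (rule power2_le_imp_le)
qed

lemma sq_nn: "f \<in> sq M \<Longrightarrow> (\<integral>\<^sup>+x. ennreal ((cmod (f x))\<^sup>2) \<partial>M) = ennreal ((nrm M f)\<^sup>2)"
  by (simp add: nrm_sq nn_integral_eq_integral sq_integrable)

text \<open>Riesz-Fischer: a rapidly converging subsequence converges almost everywhere, and Fatou's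
  lemma turns its pointwise limit into a limit in norm.\<close>

theorem L2_complete:
  assumes f: "\<And>n. f n \<in> sq M"
    and cauchy: "\<And>e. e > 0 \<Longrightarrow> \<exists>n0. \<forall>m\<ge>n0. \<forall>n\<ge>n0. nrm M (\<lambda>x. f m x - f n x) < e"
  obtains g where "g \<in> sq M" "(\<lambda>n. nrm M (\<lambda>x. f n x - g x)) \<longlonglongrightarrow> 0"
proof -
  note [measurable] = sq_measurable[OF f]
  have "\<forall>k. \<exists>n0. \<forall>m\<ge>n0. \<forall>n\<ge>n0. nrm M (\<lambda>x. f m x - f n x) < (1/4)^k"
    using cauchy by simp
  then obtain N where N: "\<And>k m n. m \<ge> N k \<Longrightarrow> n \<ge> N k \<Longrightarrow> nrm M (\<lambda>x. f m x - f n x) < (1/4)^k"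
    by metis
  \<comment> \<open>Summing the \<open>N j\<close> makes \<open>r\<close> monotone with
    \<open>r k\<close> beyond \<open>N k\<close>; the extra \<open>k\<close> forces
    \<open>r k\<close> to tend to infinity.\<close>
  define r where "r k = (\<Sum>j\<le>k. N j) + k" for k
  have rN: "N k \<le> r k" for k
    unfolding r_def using member_le_sum[of k "{..k}" N] by simp
  have rS: "r k \<le> r (Suc k)" for k by (simp add: r_def)
  have rk: "k \<le> r k" for k by (simp add: r_def)
  define d where "d k x = f (r (Suc k)) x - f (r k) x" for k x
  have d: "d k \<in> sq M" for k unfolding d_def using f by simp
  have dn: "nrm M (d k) \<le> (1/4)^k" for k
    unfolding d_def using N[OF order_trans[OF rN rS] rN, of k] by simp
  \<comment> \<open>The increments have norm at most \<open>(1/4)^k\<close>, so the weight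
    \<open>2^k\<close> leaves integrals of at most \<open>(1/8)^k\<close>. Pointwise, 2a \<le> 2^k
    a^2 + 2^(-k) then makes the increments absolutely summable.\<close>
  have "AE x in M. summable (\<lambda>k. 2^k * (cmod (d k x))\<^sup>2)"
  proof (rule AE_summable)
    show "integrable M (\<lambda>x. 2^k * (cmod (d k x))\<^sup>2)" for k using sq_integrable[OF d] by simp
    show "summable (\<lambda>k. \<integral>x. 2^k * (cmod (d k x))\<^sup>2 \<partial>M)"
    proof (rule summable_comparison_test')
      show "summable (\<lambda>k. (1/8::real)^k)" by (rule summable_geometric) simp
      fix k
      have "(nrm M (d k))\<^sup>2 \<le> ((1/4)^k)\<^sup>2" using dn by (intro power_mono) auto
      then have "2^k * (nrm M (d k))\<^sup>2 \<le> 2^k * ((1/4)^k)\<^sup>2" by simp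
      also have "\<dots> = (1/8)^k" by (simp add: power2_eq_square flip: power_mult_distrib)
      finally show "norm (\<integral>x. 2^k * (cmod (d k x))\<^sup>2 \<partial>M) \<le> (1/8)^k" by (simp add: nrm_sq)
    qed
  qed simp
  then have conv: "AE x in M. convergent (\<lambda>k. f (r k) x)"
  proof eventually_elim
    case (elim x)
    have "summable (\<lambda>k. d k x)"
    proof (rule summable_comparison_test')
      show "summable (\<lambda>k. (1/2::real)^k + 2^k * (cmod (d k x))\<^sup>2)"
        by (intro summable_add elim summable_geometric) simp
      fix k
      define a where "a = cmod (d k x)"
      have "0 \<le> (2^k * a - 1)\<^sup>2 / 2^k" by simp
      also have "\<dots> = 2^k * a\<^sup>2 - 2 * a + (1/2)^k" by (simp add: power2_eq_square field_simps)
      finally show "norm (d k x) \<le> (1/2)^k + 2^k * (cmod (d k x))\<^sup>2"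
        unfolding a_def[symmetric] by (smt (verit) a_def norm_ge_zero)
    qed
    then have "convergent (\<lambda>k. \<Sum>j<k. d j x)" by (simp add: summable_iff_convergent)
    moreover have "(\<Sum>j<k. d j x) = f (r k) x - f (r 0) x" for k
      unfolding d_def by (rule sum_lessThan_telescope)
    ultimately have "convergent (\<lambda>k. f (r k) x - f (r 0) x)" by simp
    then have "convergent (\<lambda>k. (f (r k) x - f (r 0) x) + f (r 0) x)"
      by (intro convergent_add convergent_const)
    then show ?case by simp
  qed
  define g where "g x = lim (\<lambda>k. f (r k) x)" for x
  have [measurable]: "g \<in> borel_measurable M" unfolding g_def by (rule borel_measurable_lim_metric) measurable
  have lim: "AE x in M. (\<lambda>k. f (r k) x) \<longlonglongrightarrow> g x"
    using conv by eventually_elim (simp add: g_def convergent_LIMSEQ_iff)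
  \<comment> \<open>Fatou along the subsequence. The bound 1 yields square integrability of the
    limit, the bound \<open>e/2\<close> convergence in norm.\<close>
  have main: "(\<lambda>x. f n x - g x) \<in> sq M \<and> nrm M (\<lambda>x. f n x - g x) \<le> e"
    if e: "e > 0" and n0: "\<And>m. m \<ge> n \<Longrightarrow> nrm M (\<lambda>x. f n x - f m x) < e" for n e
  proof -
    have "(\<integral>\<^sup>+x. ennreal ((cmod (f n x - g x))\<^sup>2) \<partial>M)
        = (\<integral>\<^sup>+x. liminf (\<lambda>k. ennreal ((cmod (f n x - f (r k) x))\<^sup>2)) \<partial>M)"
    proof (rule nn_integral_cong_AE)
      show "AE x in M. ennreal ((cmod (f n x - g x))\<^sup>2) = liminf (\<lambda>k. ennreal ((cmod (f n x - f (r k) x))\<^sup>2))"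
        using lim
      proof eventually_elim
        case (elim x)
        have "(\<lambda>k. ennreal ((cmod (f n x - f (r k) x))\<^sup>2)) \<longlonglongrightarrow> ennreal ((cmod (f n x - g x))\<^sup>2)"
          by (intro tendsto_ennrealI tendsto_intros elim)
        from lim_imp_Liminf[OF _ this] show ?case by simp
      qed
    qed
    also have "\<dots> \<le> liminf (\<lambda>k. \<integral>\<^sup>+x. ennreal ((cmod (f n x - f (r k) x))\<^sup>2) \<partial>M)"
      by (rule nn_integral_liminf) measurable
    also have "\<dots> \<le> ennreal (e\<^sup>2)"
    proof (rule Liminf_le)
      show "sequentially \<noteq> bot" by simp
      show "\<forall>\<^sub>F k in sequentially. (\<integral>\<^sup>+x. ennreal ((cmod (f n x - f (r k) x))\<^sup>2) \<partial>M) \<le> ennreal (e\<^sup>2)"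
        using eventually_ge_at_top[of n]
      proof eventually_elim
        case (elim k)
        then have "nrm M (\<lambda>x. f n x - f (r k) x) \<le> e" using n0[of "r k"] rk[of k] by simp
        then have "(nrm M (\<lambda>x. f n x - f (r k) x))\<^sup>2 \<le> e\<^sup>2" by (intro power_mono) auto
        then show ?case by (subst sq_nn) (auto simp: f ennreal_leI)
      qed
    qed
    finally show ?thesis using e by (intro conjI sq_nn_bound[where c = e]) auto
  qed
  obtain n1 where n1: "\<And>m n. m \<ge> n1 \<Longrightarrow> n \<ge> n1 \<Longrightarrow> nrm M (\<lambda>x. f m x - f n x) < 1"
    using cauchy[of 1] by auto
  have "(\<lambda>x. f n1 x - g x) \<in> sq M" using main[of 1 n1] n1 by auto
  from sq_diff[OF f[of n1] this] have g: "g \<in> sq M" by simp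
  have "(\<lambda>n. nrm M (\<lambda>x. f n x - g x)) \<longlonglongrightarrow> 0"
  proof (rule LIMSEQ_I)
    fix e :: real assume "e > 0"
    then obtain n0 where n0: "\<And>m n. m \<ge> n0 \<Longrightarrow> n \<ge> n0 \<Longrightarrow> nrm M (\<lambda>x. f m x - f n x) < e/2"
      using cauchy[of "e/2"] by auto
    have "nrm M (\<lambda>x. f n x - g x) < e" if "n \<ge> n0" for n
      using main[of "e/2" n] n0[OF that] \<open>e > 0\<close> that by fastforce
    then show "\<exists>n0. \<forall>n\<ge>n0. norm (nrm M (\<lambda>x. f n x - g x) - 0) < e" by auto
  qed
  with g show thesis by (rule that)
qed

definition subsp :: "'a measure \<Rightarrow> ('a \<Rightarrow> complex) set \<Rightarrow> bool" where
  "subsp M K \<longleftrightarrow> K \<subseteq> sq M \<and> (\<lambda>x. 0) \<in> K \<and>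
    (\<forall>f\<in>K. \<forall>g\<in>K. (\<lambda>x. f x + g x) \<in> K) \<and> (\<forall>c. \<forall>f\<in>K. (\<lambda>x. c * f x) \<in> K)"

lemma subspD:
  assumes "subsp M K"
  shows "f \<in> K \<Longrightarrow> f \<in> sq M" "(\<lambda>x. 0) \<in> K"
    "f \<in> K \<Longrightarrow> g \<in> K \<Longrightarrow> (\<lambda>x. f x + g x) \<in> K" "f \<in> K \<Longrightarrow> (\<lambda>x. c * f x) \<in> K"
  using assms by (auto simp: subsp_def)

text \<open>Orthogonality survives norm limits. It complements \<open>projection\<close>, whose
  \<open>p\<close> is only a limit of elements of the subspace.\<close>

lemma limit_zero_ip:
  assumes "p \<in> sq M" "h \<in> sq M" "\<And>e. e > 0 \<Longrightarrow> \<exists>k\<in>sq M. ip M k h = 0 \<and> nrm M (\<lambda>x. p x - k x) < e"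
  shows "ip M p h = 0"
proof (rule ccontr)
  assume n: "ip M p h \<noteq> 0"
  \<comment> \<open>The extra 1 keeps the quotient meaningful when \<open>h\<close> is null.\<close>
  define e where "e = cmod (ip M p h) / (nrm M h + 1)"
  have hp: "nrm M h + 1 > 0" using nrm_nonneg[of M h] by linarith
  have e: "e > 0" using n hp by (simp add: e_def)
  obtain k where k: "k \<in> sq M" "ip M k h = 0" "nrm M (\<lambda>x. p x - k x) < e" using assms(3)[OF e] by blast
  have "cmod (ip M p h) = cmod (ip M (\<lambda>x. p x - k x) h)" using k assms by (simp add: ip_diff_left)
  also have "\<dots> \<le> nrm M (\<lambda>x. p x - k x) * nrm M h" using k assms by (intro ip_bound) auto
  also have "\<dots> \<le> e * nrm M h" using k by (intro mult_right_mono) auto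
  also have "\<dots> < e * (nrm M h + 1)" using e by simp
  also have "\<dots> = cmod (ip M p h)" using hp by (simp add: e_def)
  finally show False by simp
qed

text \<open>As \<open>K\<close> may fail to be closed, membership of \<open>p\<close> is replaced by
  approximation from \<open>K\<close>. Minimising sequences are Cauchy by the parallelogram
  law.\<close>

theorem projection:
  assumes K: "subsp M K" and f: "f \<in> sq M"
  obtains p where "p \<in> sq M" "\<And>k. k \<in> K \<Longrightarrow> ip M (\<lambda>x. f x - p x) k = 0"
    "\<And>e. e > 0 \<Longrightarrow> \<exists>k\<in>K. nrm M (\<lambda>x. p x - k x) < e"
proof -
  have Ksq: "k \<in> sq M" if "k \<in> K" for k using K that by (auto simp: subsp_def)
  define d where "d = (INF k\<in>K. nrm M (\<lambda>x. f x - k x))"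
  have K0: "K \<noteq> {}" using K by (auto simp: subsp_def)
  have bdd: "bdd_below ((\<lambda>k. nrm M (\<lambda>x. f x - k x)) ` K)" by (intro bdd_belowI2[where m = 0]) simp
  have dle: "d \<le> nrm M (\<lambda>x. f x - k x)" if "k \<in> K" for k
    unfolding d_def using bdd that by (rule cINF_lower)
  have d0: "0 \<le> d" unfolding d_def using K0 by (intro cINF_greatest) auto
  have "\<exists>k\<in>K. nrm M (\<lambda>x. f x - k x) < d + 1 / (real n + 1)" for n
    using cINF_less_iff[OF K0 bdd, of "d + 1 / (real n + 1)"] unfolding d_def by simp
  then obtain k where k: "\<And>n. k n \<in> K" "\<And>n. nrm M (\<lambda>x. f x - k n x) < d + 1 / (real n + 1)"
    by metis
  have ksq: "k n \<in> sq M" for n using Ksq k by auto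
  have par: "(nrm M (\<lambda>x. k m x - k n x))\<^sup>2 \<le> 4 * (2 * d + 1) / (real n0 + 1)"
    if "m \<ge> n0" "n \<ge> n0" for m n n0
  proof -
    let ?a = "\<lambda>x. f x - k m x" and ?b = "\<lambda>x. f x - k n x"
    \<comment> \<open>The midpoint stays in \<open>K\<close>, hence at distance at least
      \<open>d\<close> from \<open>f\<close>; this bounds the sum term of the parallelogram identity
      from below.\<close>
    let ?s = "\<lambda>x. (1/2) * (k m x + k n x)"
    have s: "?s \<in> K" by (intro subspD[OF K] k)
    have a: "?a \<in> sq M" "?b \<in> sq M" using ksq f by auto
    have 1: "(nrm M (\<lambda>x. ?a x - 1 * ?b x))\<^sup>2 = (nrm M ?a)\<^sup>2 - 2 * Re (ip M ?a ?b) + (nrm M ?b)\<^sup>2"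
      using nrm_diff_expand[OF a, of 1] by simp
    have 2: "(nrm M (\<lambda>x. ?a x - (-1) * ?b x))\<^sup>2 = (nrm M ?a)\<^sup>2 + 2 * Re (ip M ?a ?b) + (nrm M ?b)\<^sup>2"
      using nrm_diff_expand[OF a, of "-1"] by simp
    have 3: "(\<lambda>x. ?a x - (-1) * ?b x) = (\<lambda>x. 2 * (f x - ?s x))" by (auto simp: field_simps)
    have 4: "(\<lambda>x. ?a x - 1 * ?b x) = (\<lambda>x. k n x - k m x)" by auto
    have "d\<^sup>2 \<le> (nrm M (\<lambda>x. f x - ?s x))\<^sup>2" using dle[OF s] d0 by (intro power_mono) auto
    then have 5: "4 * d\<^sup>2 \<le> (nrm M (\<lambda>x. ?a x - (-1) * ?b x))\<^sup>2" unfolding 3 nrm_scale by (simp add: power_mult_distrib)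
    define t where "t = 1 / (real n0 + 1)"
    have t: "0 \<le> t" "t \<le> 1" by (auto simp: t_def)
    have q: "(nrm M (\<lambda>x. f x - k j x))\<^sup>2 \<le> (d + t)\<^sup>2" if "j \<ge> n0" for j
    proof (rule power_mono)
      have "1 / (real j + 1) \<le> t" unfolding t_def using that by (simp add: frac_le)
      then show "nrm M (\<lambda>x. f x - k j x) \<le> d + t" using k(2)[of j] by simp
    qed simp
    have "(nrm M (\<lambda>x. k m x - k n x))\<^sup>2 \<le> 2 * (d + t)\<^sup>2 + 2 * (d + t)\<^sup>2 - 4 * d\<^sup>2"
      using 1 2 5 q[of m] q[of n] that unfolding 4 nrm_minus_commute[of M "k m"] by linarith
    also have "\<dots> = 4 * t * (2 * d + t)" by (simp add: power2_eq_square algebra_simps)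
    also have "\<dots> \<le> 4 * t * (2 * d + 1)" using t d0 by (intro mult_left_mono) auto
    finally show ?thesis by (simp add: t_def)
  qed
  obtain p where p: "p \<in> sq M" "(\<lambda>n. nrm M (\<lambda>x. k n x - p x)) \<longlonglongrightarrow> 0"
  proof (rule L2_complete[OF ksq])
    fix e :: real assume e: "e > 0"
    obtain n0 :: nat where n0: "4 * (2 * d + 1) / e\<^sup>2 < real n0" using reals_Archimedean2 by blast
    have "4 * (2 * d + 1) / (real n0 + 1) < e\<^sup>2"
      using n0 e by (simp add: field_simps) (smt (verit) zero_less_power)
    then have "nrm M (\<lambda>x. k m x - k n x) < e" if "m \<ge> n0" "n \<ge> n0" for m n
      using par[OF that] e by (intro power2_less_imp_less[of _ e]) auto
    then show "\<exists>n0. \<forall>m\<ge>n0. \<forall>n\<ge>n0. nrm M (\<lambda>x. k m x - k n x) < e" by blast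
  qed
  have app: "\<exists>k\<in>K. nrm M (\<lambda>x. p x - k x) < e" if "e > 0" for e
  proof -
    have "\<forall>\<^sub>F n in sequentially. nrm M (\<lambda>x. k n x - p x) < e" using order_tendstoD(2)[OF p(2) that] .
    then obtain n where "nrm M (\<lambda>x. k n x - p x) < e" using eventually_happens by force
    then show ?thesis using k(1) nrm_minus_commute by metis
  qed
  define h where "h x = f x - p x" for x
  have h: "h \<in> sq M" unfolding h_def using f p by simp
  have hd: "nrm M h \<le> d"
  proof (rule field_le_epsilon)
    fix e :: real assume e: "e > 0"
    have "\<forall>\<^sub>F n in sequentially. nrm M (\<lambda>x. k n x - p x) < e/2" using order_tendstoD(2)[OF p(2), of "e/2"] e by simp
    moreover have "\<forall>\<^sub>F n in sequentially. 1 / (real n + 1) < e/2"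
      using order_tendstoD(2)[OF LIMSEQ_inverse_real_of_nat, of "e/2"] e
      by (simp add: inverse_eq_divide add.commute)
    ultimately have "\<forall>\<^sub>F n in sequentially. nrm M (\<lambda>x. k n x - p x) < e/2 \<and> 1 / (real n + 1) < e/2"
      by eventually_elim simp
    then obtain n where n: "nrm M (\<lambda>x. k n x - p x) < e/2" "1 / (real n + 1) < e/2"
      using eventually_happens by force
    show "nrm M h \<le> d + e" unfolding h_def using nrm_triangle_diff[OF f ksq[of n] p(1)] n k(2)[of n] by simp
  qed
  have "ip M h u = 0" if u: "u \<in> K" for u
  proof (rule ccontr)
    assume n: "ip M h u \<noteq> 0"
    define a where "a = ip M h u"
    have dd: "d \<le> nrm M (\<lambda>x. h x - c * u x)" for c
    proof (rule field_le_epsilon)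
      fix e :: real assume "e > 0"
      then obtain v where v: "v \<in> K" "nrm M (\<lambda>x. p x - v x) < e" using app by blast
      have "(\<lambda>x. v x + c * u x) \<in> K" using K u v by (auto simp: subsp_def)
      then have "d \<le> nrm M (\<lambda>x. f x - (v x + c * u x))" by (rule dle)
      also have "\<dots> = nrm M (\<lambda>x. (h x - c * u x) + (p x - v x))" by (simp add: h_def algebra_simps)
      also have "\<dots> \<le> nrm M (\<lambda>x. h x - c * u x) + nrm M (\<lambda>x. p x - v x)"
        using h u v p Ksq by (intro nrm_triangle) auto
      finally show "d \<le> nrm M (\<lambda>x. h x - c * u x) + e" using v by simp
    qed
    \<comment> \<open>Small enough that a step of \<open>t * a\<close> along \<open>u\<close> would
      come strictly closer to \<open>f\<close> than \<open>d\<close>.\<close>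
    define t where "t = 1 / ((nrm M u)\<^sup>2 + 1)"
    have pos: "(nrm M u)\<^sup>2 + 1 > 0" by (smt (verit) zero_le_power2)
    have t: "t > 0" "t * (nrm M u)\<^sup>2 < 1" using pos by (auto simp: t_def field_simps)
    have "(nrm M h)\<^sup>2 \<le> d\<^sup>2" using hd by (intro power_mono) auto
    also have "d\<^sup>2 \<le> (nrm M (\<lambda>x. h x - (t * a) * u x))\<^sup>2" using dd d0 by (intro power_mono) auto
    also have "\<dots> = (nrm M h)\<^sup>2 - 2 * Re (cnj (t * a) * a) + (cmod (t * a))\<^sup>2 * (nrm M u)\<^sup>2"
      unfolding a_def using nrm_diff_expand[OF h Ksq[OF u]] by blast
    also have "cnj (t * a) * a = complex_of_real (t * (cmod a)\<^sup>2)"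
      using complex_norm_square[of a] by (simp add: mult.commute)
    finally have "2 * t * (cmod a)\<^sup>2 \<le> t\<^sup>2 * (cmod a)\<^sup>2 * (nrm M u)\<^sup>2"
      by (simp add: norm_mult power_mult_distrib)
    then have "(t * (cmod a)\<^sup>2) * 2 \<le> (t * (cmod a)\<^sup>2) * (t * (nrm M u)\<^sup>2)" by (simp add: power2_eq_square algebra_simps)
    moreover have "t * (cmod a)\<^sup>2 > 0" using n t by (simp add: a_def)
    ultimately have "2 \<le> t * (nrm M u)\<^sup>2" by (rule mult_left_le_imp_le)
    then show False using t by simp
  qed
  then have "ip M (\<lambda>x. f x - p x) u = 0" if "u \<in> K" for u using that unfolding h_def .
  then show thesis using that[OF p(1)] app by blast
qed

text \<open>For nonzero \<phi>, boundedness makes \<phi> vanish at the projection \<open>p\<close>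
  of \<open>f\<close> to the kernel, so \<open>h = f - p\<close> is orthogonal to the kernel while
  \<phi> is nonzero at \<open>h\<close>. Everything else is a multiple of \<open>h\<close> plus an
  element of the kernel.\<close>

theorem riesz:
  assumes add: "\<And>f g. f \<in> sq M \<Longrightarrow> g \<in> sq M \<Longrightarrow> \<phi> (\<lambda>x. f x + g x) = \<phi> f + \<phi> g"
    and sc: "\<And>c f. f \<in> sq M \<Longrightarrow> \<phi> (\<lambda>x. c * f x) = c * \<phi> f"
    and bd: "\<And>f. f \<in> sq M \<Longrightarrow> cmod (\<phi> f) \<le> C * nrm M f"
  obtains z where "z \<in> sq M" "\<And>f. f \<in> sq M \<Longrightarrow> \<phi> f = ip M f z"
proof (cases "\<forall>f\<in>sq M. \<phi> f = 0")
  case True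
  then show ?thesis using that[of "\<lambda>x. 0"] by simp
next
  case False
  have diff: "\<phi> (\<lambda>x. f x - c * g x) = \<phi> f - c * \<phi> g" if "f \<in> sq M" "g \<in> sq M" for f g c
    using add[of f "\<lambda>x. (-c) * g x"] sc[of g "-c"] that by simp
  obtain f where f: "f \<in> sq M" "\<phi> f \<noteq> 0" using False by blast
  define K where "K = {k \<in> sq M. \<phi> k = 0}"
  have "\<phi> (\<lambda>x. 0) = 0" using sc[of "\<lambda>x. 0" 0] by simp
  then have K: "subsp M K" unfolding subsp_def K_def using add sc by auto
  obtain p where p: "p \<in> sq M" "\<And>k. k \<in> K \<Longrightarrow> ip M (\<lambda>x. f x - p x) k = 0"
    "\<And>e. e > 0 \<Longrightarrow> \<exists>k\<in>K. nrm M (\<lambda>x. p x - k x) < e" using projection[OF K f(1)] by blast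
  have C: "\<phi> p = 0"
  proof (rule ccontr)
    assume n: "\<phi> p \<noteq> 0"
    define e where "e = cmod (\<phi> p) / (\<bar>C\<bar> + 1)"
    have cp: "\<bar>C\<bar> + 1 > 0" by linarith
    have e: "e > 0" using n cp by (simp add: e_def)
    obtain k where k: "k \<in> K" "nrm M (\<lambda>x. p x - k x) < e" using p(3)[OF e] by blast
    have ks: "k \<in> sq M" "\<phi> k = 0" using k by (auto simp: K_def)
    have "cmod (\<phi> p) = cmod (\<phi> (\<lambda>x. p x - 1 * k x))" using diff[OF p(1) ks(1), of 1] ks by simp
    also have "\<dots> \<le> C * nrm M (\<lambda>x. p x - k x)" using bd[of "\<lambda>x. p x - k x"] ks p by simp
    also have "\<dots> \<le> \<bar>C\<bar> * e" using k by (intro mult_mono) auto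
    also have "\<dots> < (\<bar>C\<bar> + 1) * e" using e by simp
    also have "\<dots> = cmod (\<phi> p)" using cp by (simp add: e_def)
    finally show False by simp
  qed
  define h where "h x = f x - p x" for x
  have h: "h \<in> sq M" unfolding h_def using f p by simp
  have hf: "\<phi> h = \<phi> f" unfolding h_def using diff[OF f(1) p(1), of 1] C by simp
  have h0: "nrm M h \<noteq> 0" using bd[OF h] hf f by auto
  \<comment> \<open>Scaled so that \<open>ip M h z\<close> equals \<open>\<phi> h\<close>.\<close>
  define z where "z x = (cnj (\<phi> h) / (nrm M h)\<^sup>2) * h x" for x
  have "\<phi> u = ip M u z" if u: "u \<in> sq M" for u
  proof -
    define c where "c = \<phi> u / \<phi> h"
    have "(\<lambda>x. u x - c * h x) \<in> K" unfolding K_def using diff[OF u h, of c] sq_diff[OF u sq_scale[OF h, of c]] hf f by (simp add: c_def)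
    from p(2)[OF this] have "ip M h (\<lambda>x. u x - c * h x) = 0" unfolding h_def .
    then have "ip M (\<lambda>x. u x - c * h x) h = 0" using cnj_ip complex_cnj_zero by metis
    then have "ip M u h = c * (nrm M h)\<^sup>2" using u h by (simp add: ip_diff_left ip_scale_left ip_self)
    then show ?thesis unfolding z_def ip_scale_right using h0 hf f by (simp add: c_def)
  qed
  moreover have "z \<in> sq M" unfolding z_def using h by (rule sq_scale)
  ultimately show ?thesis using that by blast
qed

lemma riesz_ex:
  assumes "\<And>f g. f \<in> sq M \<Longrightarrow> g \<in> sq M \<Longrightarrow> \<phi> (\<lambda>x. f x + g x) = \<phi> f + \<phi> g"
    and "\<And>c f. f \<in> sq M \<Longrightarrow> \<phi> (\<lambda>x. c * f x) = c * \<phi> f"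
    and "\<And>f. f \<in> sq M \<Longrightarrow> cmod (\<phi> f) \<le> C * nrm M f"
  shows "\<exists>z\<in>sq M. \<forall>f\<in>sq M. \<phi> f = ip M f z"
proof -
  obtain z where "z \<in> sq M" "\<And>f. f \<in> sq M \<Longrightarrow> \<phi> f = ip M f z"
    using riesz[of M \<phi> C, OF assms] by blast
  then show ?thesis by blast
qed

section \<open>Operators as bounded sesquilinear forms\<close>

lemma l2_rep_class:
  assumes "f \<in> sq M"
  shows "l2_rep (l2_class M f) \<in> sq M" "AE x in M. l2_rep (l2_class M f) x = f x"
proof -
  have "f \<in> l2_class M f" using assms by (simp add: l2_class_def)
  then have "l2_rep (l2_class M f) \<in> l2_class M f" unfolding l2_rep_def by (rule someI[where P = "\<lambda>h. h \<in> _"])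
  then show "l2_rep (l2_class M f) \<in> sq M" "AE x in M. l2_rep (l2_class M f) x = f x"
    by (auto simp: l2_class_def)
qed

lemma l2_class_in [simp, intro]: "f \<in> sq M \<Longrightarrow> l2_class M f \<in> L2 M"
  by (simp add: L2_def)

lemma l2_class_rep: "u \<in> L2 M \<Longrightarrow> l2_class M (l2_rep u) = u"
  using l2_rep_in(3) by metis

lemma l2_class_eq_iff:
  assumes "f \<in> sq M" "g \<in> sq M" shows "l2_class M f = l2_class M g \<longleftrightarrow> (AE x in M. f x = g x)"
proof
  assume "l2_class M f = l2_class M g"
  moreover have "f \<in> l2_class M f" using assms by (simp add: l2_class_def)
  ultimately show "AE x in M. f x = g x" by (simp add: l2_class_def)
qed (rule l2_class_cong)

lemma l2_add_in: "u \<in> L2 M \<Longrightarrow> v \<in> L2 M \<Longrightarrow> l2_add M u v \<in> L2 M"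
  and l2_scale_in: "u \<in> L2 M \<Longrightarrow> l2_scale M c u \<in> L2 M"
  unfolding l2_add_def l2_scale_def using l2_rep_in(2) by auto

lemma l2_add_class:
  assumes "f \<in> sq M" "g \<in> sq M"
  shows "l2_add M (l2_class M f) (l2_class M g) = l2_class M (\<lambda>x. f x + g x)"
  unfolding l2_add_def
proof (rule l2_class_cong)
  show "AE x in M. l2_rep (l2_class M f) x + l2_rep (l2_class M g) x = f x + g x"
    using l2_rep_class(2)[OF assms(1)] l2_rep_class(2)[OF assms(2)] by eventually_elim simp
qed

lemma l2_scale_class:
  assumes "f \<in> sq M"
  shows "l2_scale M c (l2_class M f) = l2_class M (\<lambda>x. c * f x)"
  unfolding l2_scale_def
proof (rule l2_class_cong)
  show "AE x in M. c * l2_rep (l2_class M f) x = c * f x"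
    using l2_rep_class(2)[OF assms(1)] by eventually_elim simp
qed

lemma l2_inner_eq: "l2_inner M u v = ip M (l2_rep u) (l2_rep v)"
  by (simp add: l2_inner_def ip_def)

lemma l2_norm_eq: "l2_norm M u = nrm M (l2_rep u)"
  by (simp add: l2_norm_def nrm_def)

lemma l2_dist_eq: "l2_dist M u v = nrm M (\<lambda>x. l2_rep u x - l2_rep v x)"
  by (simp add: l2_dist_def nrm_def)

lemma ip_l2_class:
  assumes "f \<in> sq M" "g \<in> sq M"
  shows "ip M (l2_rep (l2_class M f)) g = ip M f g" "ip M g (l2_rep (l2_class M f)) = ip M g f"
  using assms l2_rep_class[OF assms(1)] by (auto intro!: ip_cong_AE)

lemma AE_eq_if_ip_eq:
  assumes "f \<in> sq M" "g \<in> sq M" "\<And>h. h \<in> sq M \<Longrightarrow> ip M f h = ip M g h"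
  shows "AE x in M. f x = g x"
proof -
  let ?d = "\<lambda>x. f x - g x"
  have d: "?d \<in> sq M" using assms by simp
  have "ip M ?d ?d = 0" using assms(3)[OF d] assms(1,2) d by (simp add: ip_diff_left)
  then have "nrm M ?d = 0" by (simp add: ip_self)
  then show ?thesis using nrm_eq_0_iff[OF d] by simp
qed

text \<open>Operators are handled through their forms: the values of \<open>app\<close> are only additive up to null functions,
  whereas the identities for \<open>form\<close> are exact.\<close>

definition app :: "'a measure \<Rightarrow> ('a, 'b) oper \<Rightarrow> ('a \<Rightarrow> complex) \<Rightarrow> 'b \<Rightarrow> complex" where
  "app M T f = l2_rep (T (l2_class M f))"

definition form :: "'a measure \<Rightarrow> 'b measure \<Rightarrow> ('a, 'b) oper \<Rightarrow> ('a \<Rightarrow> complex) \<Rightarrow> ('b \<Rightarrow> complex) \<Rightarrow> complex" where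
  "form M N T f g = ip N (app M T f) g"

text \<open>The bound \<open>C\<close> is a parameter because limits of nets of forms need one bound
  for the whole net.\<close>

definition bform :: "'a measure \<Rightarrow> 'b measure \<Rightarrow> real \<Rightarrow> (('a \<Rightarrow> complex) \<Rightarrow> ('b \<Rightarrow> complex) \<Rightarrow> complex) \<Rightarrow> bool" where
  "bform M N C B \<longleftrightarrow> C \<ge> 0 \<and>
    (\<forall>f\<in>sq M. \<forall>f'\<in>sq M. \<forall>g\<in>sq N. B (\<lambda>x. f x + f' x) g = B f g + B f' g) \<and>
    (\<forall>c. \<forall>f\<in>sq M. \<forall>g\<in>sq N. B (\<lambda>x. c * f x) g = c * B f g) \<and>
    (\<forall>f\<in>sq M. \<forall>g\<in>sq N. \<forall>g'\<in>sq N. B f (\<lambda>x. g x + g' x) = B f g + B f g') \<and>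
    (\<forall>c. \<forall>f\<in>sq M. \<forall>g\<in>sq N. B f (\<lambda>x. c * g x) = cnj c * B f g) \<and>
    (\<forall>f\<in>sq M. \<forall>g\<in>sq N. cmod (B f g) \<le> C * nrm M f * nrm N g)"

lemma bformD:
  assumes "bform M N C B"
  shows "C \<ge> 0"
    "f \<in> sq M \<Longrightarrow> f' \<in> sq M \<Longrightarrow> g \<in> sq N \<Longrightarrow> B (\<lambda>x. f x + f' x) g = B f g + B f' g"
    "f \<in> sq M \<Longrightarrow> g \<in> sq N \<Longrightarrow> B (\<lambda>x. c * f x) g = c * B f g"
    "f \<in> sq M \<Longrightarrow> g \<in> sq N \<Longrightarrow> g' \<in> sq N \<Longrightarrow> B f (\<lambda>x. g x + g' x) = B f g + B f g'"
    "f \<in> sq M \<Longrightarrow> g \<in> sq N \<Longrightarrow> B f (\<lambda>x. c * g x) = cnj c * B f g"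
    "f \<in> sq M \<Longrightarrow> g \<in> sq N \<Longrightarrow> cmod (B f g) \<le> C * nrm M f * nrm N g"
  using assms by (auto simp: bform_def)

lemma bform_diff:
  assumes "bform M N C B" "f \<in> sq M" "g \<in> sq N"
  shows "f' \<in> sq M \<Longrightarrow> B (\<lambda>x. f x - f' x) g = B f g - B f' g"
    "g' \<in> sq N \<Longrightarrow> B f (\<lambda>x. g x - g' x) = B f g - B f g'"
  using bformD(2)[OF assms(1), of f "\<lambda>x. (-1) * f' x" g] bformD(3)[OF assms(1), of f' g "-1"]
    bformD(4)[OF assms(1), of f g "\<lambda>x. (-1) * g' x"] bformD(5)[OF assms(1), of f g' "-1"] assms
  by auto

text \<open>The bound forces a form to vanish on null functions, so representatives do not
  matter.\<close>

lemma bform_cong_AE: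
  assumes "bform M N C B" "f \<in> sq M" "g \<in> sq N" "f' \<in> sq M" "g' \<in> sq N"
    "AE x in M. f x = f' x" "AE x in N. g x = g' x"
  shows "B f g = B f' g'"
proof -
  have 1: "nrm M (\<lambda>x. f x - f' x) = 0" "nrm N (\<lambda>x. g x - g' x) = 0"
    using assms by (auto simp: nrm_eq_0_iff)
  have "cmod (B (\<lambda>x. f x - f' x) g) \<le> 0" "cmod (B f' (\<lambda>x. g x - g' x)) \<le> 0"
    using bformD(6)[OF assms(1), of "\<lambda>x. f x - f' x" g] bformD(6)[OF assms(1), of f' "\<lambda>x. g x - g' x"] 1 assms
    by auto
  then show ?thesis using bform_diff[OF assms(1)] assms by auto
qed

lemma bounded_opsD:
  assumes "T \<in> bounded_ops M N"
  shows "u \<in> L2 M \<Longrightarrow> T u \<in> L2 N"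
    "u \<in> L2 M \<Longrightarrow> v \<in> L2 M \<Longrightarrow> T (l2_add M u v) = l2_add N (T u) (T v)"
    "u \<in> L2 M \<Longrightarrow> T (l2_scale M c u) = l2_scale N c (T u)"
  using assms by (auto simp: bounded_ops_def)

lemma app_sq [simp, intro]: "T \<in> bounded_ops M N \<Longrightarrow> f \<in> sq M \<Longrightarrow> app M T f \<in> sq N"
  unfolding app_def by (rule l2_rep_in(2)) (simp add: bounded_opsD(1))

lemma app_class: "T \<in> bounded_ops M N \<Longrightarrow> f \<in> sq M \<Longrightarrow> T (l2_class M f) = l2_class N (app M T f)"
  unfolding app_def using bounded_opsD(1)[of T M N] by (simp add: l2_class_rep)

lemma app_bound:
  assumes "T \<in> bounded_ops M N"
  obtains C where "C \<ge> 0" "\<And>f. f \<in> sq M \<Longrightarrow> nrm N (app M T f) \<le> C * nrm M f"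
proof -
  obtain C where C: "\<And>u. u \<in> L2 M \<Longrightarrow> l2_norm N (T u) \<le> C * l2_norm M u"
    using assms unfolding bounded_ops_def by blast
  have "nrm N (app M T f) \<le> \<bar>C\<bar> * nrm M f" if f: "f \<in> sq M" for f
  proof -
    have "nrm N (app M T f) \<le> C * nrm M (l2_rep (l2_class M f))"
      using C[of "l2_class M f"] f by (simp add: l2_norm_eq app_def)
    also have "\<dots> \<le> \<bar>C\<bar> * nrm M (l2_rep (l2_class M f))" by (intro mult_right_mono) auto
    also have "nrm M (l2_rep (l2_class M f)) = nrm M f" using l2_rep_class[OF f] f by (intro nrm_cong_AE)
    finally show ?thesis .
  qed
  then show thesis using that[of "\<bar>C\<bar>"] by simp
qed

lemma form_bform:
  assumes T: "T \<in> bounded_ops M N" obtains C where "bform M N C (form M N T)"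
proof -
  obtain C where C: "C \<ge> 0" "\<And>f. f \<in> sq M \<Longrightarrow> nrm N (app M T f) \<le> C * nrm M f"
    using app_bound[OF T] by metis
  have add: "AE x in N. app M T (\<lambda>x. f x + f' x) x = app M T f x + app M T f' x" if "f \<in> sq M" "f' \<in> sq M" for f f'
  proof -
    have "l2_class N (app M T (\<lambda>x. f x + f' x)) = T (l2_add M (l2_class M f) (l2_class M f'))"
      using that T by (simp add: app_class l2_add_class)
    also have "\<dots> = l2_class N (\<lambda>x. app M T f x + app M T f' x)"
      using that by (subst bounded_opsD(2)[OF T]) (auto simp: app_class[OF T] l2_add_class app_sq[OF T])
    finally show ?thesis using that T by (simp add: l2_class_eq_iff)
  qed
  have sc: "AE x in N. app M T (\<lambda>x. c * f x) x = c * app M T f x" if "f \<in> sq M" for f c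
  proof -
    have "l2_class N (app M T (\<lambda>x. c * f x)) = T (l2_scale M c (l2_class M f))"
      using that T by (simp add: app_class l2_scale_class)
    also have "\<dots> = l2_class N (\<lambda>x. c * app M T f x)"
      using that by (subst bounded_opsD(3)[OF T]) (auto simp: app_class[OF T] l2_scale_class app_sq[OF T])
    finally show ?thesis using that T by (simp add: l2_class_eq_iff)
  qed
  have "bform M N C (form M N T)"
    unfolding bform_def form_def
  proof (intro conjI ballI allI)
    fix f f' g assume *: "f \<in> sq M" "f' \<in> sq M" "g \<in> sq N"
    show "ip N (app M T (\<lambda>x. f x + f' x)) g = ip N (app M T f) g + ip N (app M T f') g"
      using * T by (subst ip_add_left[symmetric]) (auto intro!: ip_cong_AE add)
  next
    fix c f g assume *: "f \<in> sq M" "g \<in> sq N"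
    show "ip N (app M T (\<lambda>x. c * f x)) g = c * ip N (app M T f) g"
      using * T by (subst ip_scale_left[symmetric]) (auto intro!: ip_cong_AE sc)
  next
    fix f g assume *: "f \<in> sq M" "g \<in> sq N"
    have "cmod (ip N (app M T f) g) \<le> nrm N (app M T f) * nrm N g" using * T by (intro ip_bound) auto
    also have "\<dots> \<le> C * nrm M f * nrm N g" using C * by (intro mult_right_mono) auto
    finally show "cmod (ip N (app M T f) g) \<le> C * nrm M f * nrm N g" .
  qed (use C T in \<open>auto simp: ip_add_right ip_scale_right\<close>)
  then show thesis by (rule that)
qed

lemma op_eqI:
  assumes "S \<in> bounded_ops M N" "T \<in> bounded_ops M N"
    "\<And>f g. f \<in> sq M \<Longrightarrow> g \<in> sq N \<Longrightarrow> form M N S f g = form M N T f g"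
  shows "S = T"
proof
  fix u
  show "S u = T u"
  proof (cases "u \<in> L2 M")
    case True
    then have u: "u = l2_class M (l2_rep u)" "l2_rep u \<in> sq M" by (simp_all add: l2_class_rep l2_rep_in)
    have "AE x in N. app M S (l2_rep u) x = app M T (l2_rep u) x"
      using assms u by (intro AE_eq_if_ip_eq) (auto simp: form_def)
    then have "l2_class N (app M S (l2_rep u)) = l2_class N (app M T (l2_rep u))" by (rule l2_class_cong)
    then show ?thesis using u assms by (metis app_class)
  next
    case False
    then show ?thesis using assms by (auto simp: bounded_ops_def PiE_def extensional_def)
  qed
qed

text \<open>Riesz representation in the second variable gives the value at \<open>f\<close>. Sums,
  limits and rank one operators are all produced from their forms in this way.\<close>

lemma op_of_form:
  assumes B: "bform M N C B"
  obtains T where "T \<in> bounded_ops M N" "\<And>f g. f \<in> sq M \<Longrightarrow> g \<in> sq N \<Longrightarrow> form M N T f g = B f g"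
proof -
  have "\<exists>z\<in>sq N. \<forall>g\<in>sq N. ip N z g = B f g" if f: "f \<in> sq M" for f
  proof -
    obtain z where z: "z \<in> sq N" "\<And>g. g \<in> sq N \<Longrightarrow> cnj (B f g) = ip N g z"
    proof (rule riesz[where \<phi> = "\<lambda>g. cnj (B f g)" and C = "C * nrm M f" and M = N])
    qed (use f bformD[OF B] in \<open>auto simp: mult.commute mult.left_commute\<close>)
    then have "\<forall>g\<in>sq N. ip N z g = B f g" by (metis cnj_ip complex_cnj_cnj)
    with z show ?thesis by blast
  qed
  then obtain Z where Z: "\<And>f. f \<in> sq M \<Longrightarrow> Z f \<in> sq N" "\<And>f g. f \<in> sq M \<Longrightarrow> g \<in> sq N \<Longrightarrow> ip N (Z f) g = B f g"
    by metis
  define T where "T = (\<lambda>u\<in>L2 M. l2_class N (Z (l2_rep u)))"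
  have Zeq: "l2_class N h = l2_class N k" if "h \<in> sq N" "k \<in> sq N" "\<And>g. g \<in> sq N \<Longrightarrow> ip N h g = ip N k g" for h k
    using AE_eq_if_ip_eq[OF that] by (rule l2_class_cong)
  have rep: "l2_rep u \<in> sq M" if "u \<in> L2 M" for u using that l2_rep_in by blast
  have addrep: "l2_add M u v = l2_class M (\<lambda>x. l2_rep u x + l2_rep v x)" for u v by (simp add: l2_add_def)
  have T1: "T (l2_class M f) = l2_class N (Z f)" if f: "f \<in> sq M" for f
  proof -
    have "l2_class N (Z (l2_rep (l2_class M f))) = l2_class N (Z f)"
      using l2_rep_class[OF f] f by (intro Zeq) (auto simp: Z intro!: bform_cong_AE[OF B])
    then show ?thesis using f by (simp add: T_def)
  qed
  have "T \<in> bounded_ops M N"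
    unfolding bounded_ops_def
  proof (intro CollectI conjI ballI allI)
    show "T \<in> L2 M \<rightarrow>\<^sub>E L2 N" unfolding T_def using Z rep by auto
  next
    fix u v assume uv: "u \<in> L2 M" "v \<in> L2 M"
    have "T (l2_add M u v) = l2_class N (Z (\<lambda>x. l2_rep u x + l2_rep v x))"
      unfolding addrep using uv rep by (intro T1) auto
    also have "\<dots> = l2_class N (\<lambda>x. Z (l2_rep u) x + Z (l2_rep v) x)"
      using uv rep by (intro Zeq) (auto simp: Z bformD[OF B] ip_add_left)
    also have "\<dots> = l2_add N (T u) (T v)" using uv rep Z by (simp add: T_def l2_add_class)
    finally show "T (l2_add M u v) = l2_add N (T u) (T v)" .
  next
    fix c u assume u: "u \<in> L2 M"
    have "T (l2_scale M c u) = l2_class N (Z (\<lambda>x. c * l2_rep u x))"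
      unfolding l2_scale_def using u rep by (intro T1) auto
    also have "\<dots> = l2_class N (\<lambda>x. c * Z (l2_rep u) x)"
      using u rep by (intro Zeq) (auto simp: Z bformD[OF B] ip_scale_left)
    also have "\<dots> = l2_scale N c (T u)" using u rep Z by (simp add: T_def l2_scale_class)
    finally show "T (l2_scale M c u) = l2_scale N c (T u)" .
  next
    have "l2_norm N (T u) \<le> C * l2_norm M u" if u: "u \<in> L2 M" for u
    proof -
      let ?z = "Z (l2_rep u)"
      have z: "?z \<in> sq N" using Z rep u by simp
      have "nrm N (l2_rep (T u)) = nrm N ?z"
        using l2_rep_class[OF z] z u by (simp add: T_def, intro nrm_cong_AE) auto
      \<comment> \<open>Testing the form against the value itself bounds the norm of that
        value.\<close>
      moreover have "nrm N ?z * nrm N ?z \<le> (C * nrm M (l2_rep u)) * nrm N ?z"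
      proof -
        have "complex_of_real (nrm N ?z * nrm N ?z) = B (l2_rep u) ?z"
          using Z(2)[OF rep[OF u] z] by (simp add: ip_self power2_eq_square)
        then have "nrm N ?z * nrm N ?z = cmod (B (l2_rep u) ?z)"
          by (metis abs_of_nonneg mult_nonneg_nonneg norm_of_real nrm_nonneg)
        then show ?thesis using bformD(6)[OF B rep[OF u] z] by simp
      qed
      then have "nrm N ?z \<le> C * nrm M (l2_rep u)"
        using bformD(1)[OF B] by (cases "nrm N ?z = 0") (auto simp: mult_le_cancel_right less_le)
      ultimately show ?thesis by (simp add: l2_norm_eq)
    qed
    then show "\<exists>C. \<forall>u\<in>L2 M. l2_norm N (T u) \<le> C * l2_norm M u" by blast
  qed
  moreover have "form M N T f g = B f g" if "f \<in> sq M" "g \<in> sq N" for f g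
    using that Z by (simp add: form_def app_def T1 ip_l2_class)
  ultimately show thesis using that by blast
qed

section \<open>Linear operations and composition of operators in terms of forms\<close>

lemma bform_add:
  assumes "bform M N C B" "bform M N C' B'" shows "bform M N (C + C') (\<lambda>f g. B f g + B' f g)"
proof -
  have "cmod (B f g + B' f g) \<le> (C + C') * nrm M f * nrm N g" if "f \<in> sq M" "g \<in> sq N" for f g
    using norm_triangle_ineq[of "B f g" "B' f g"] bformD(6)[OF assms(1) that] bformD(6)[OF assms(2) that]
    by (simp add: algebra_simps)
  then show ?thesis using assms unfolding bform_def by (simp add: algebra_simps)
qed

lemma bform_scale:
  assumes "bform M N C B" shows "bform M N (cmod c * C) (\<lambda>f g. c * B f g)"
proof -
  have "cmod (c * B f g) \<le> cmod c * C * nrm M f * nrm N g" if "f \<in> sq M" "g \<in> sq N" for f g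
    using mult_left_mono[OF bformD(6)[OF assms that], of "cmod c"]
    by (simp add: algebra_simps norm_mult)
  then show ?thesis using assms unfolding bform_def by (simp add: algebra_simps)
qed

text \<open>\<open>op_of_form\<close> supplies a bounded operator with the summed form, and the
  pointwise sum is shown to coincide with it.\<close>

lemma op_add_form:
  assumes S: "S \<in> bounded_ops M N" and T: "T \<in> bounded_ops M N"
  shows "op_add M N S T \<in> bounded_ops M N"
    "f \<in> sq M \<Longrightarrow> g \<in> sq N \<Longrightarrow> form M N (op_add M N S T) f g = form M N S f g + form M N T f g"
proof -
  obtain C C' where C: "bform M N C (form M N S)" "bform M N C' (form M N T)"
    using form_bform S T by metis
  obtain R where R: "R \<in> bounded_ops M N" "\<And>f g. f \<in> sq M \<Longrightarrow> g \<in> sq N \<Longrightarrow> form M N R f g = form M N S f g + form M N T f g"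
    using op_of_form[OF bform_add[OF C]] by blast
  have "op_add M N S T = R"
  proof
    fix u
    show "op_add M N S T u = R u"
    proof (cases "u \<in> L2 M")
      case True
      then have u: "u = l2_class M (l2_rep u)" "l2_rep u \<in> sq M" by (simp_all add: l2_class_rep l2_rep_in)
      let ?f = "l2_rep u"
      have "op_add M N S T u = l2_class N (\<lambda>x. app M S ?f x + app M T ?f x)"
        using True u S T by (simp add: op_add_def) (metis app_class app_sq l2_add_class)
      also have "\<dots> = l2_class N (app M R ?f)"
        using u R S T by (intro l2_class_cong AE_eq_if_ip_eq) (auto simp: form_def ip_add_left)
      finally show ?thesis using u R by (metis app_class)
    next
      case False
      then show ?thesis using R by (auto simp: op_add_def bounded_ops_def PiE_def extensional_def)
    qed
  qed
  with R show "op_add M N S T \<in> bounded_ops M N"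
    "f \<in> sq M \<Longrightarrow> g \<in> sq N \<Longrightarrow> form M N (op_add M N S T) f g = form M N S f g + form M N T f g"
    by auto
qed

lemma op_scale_form:
  assumes T: "T \<in> bounded_ops M N"
  shows "op_scale M N c T \<in> bounded_ops M N"
    "f \<in> sq M \<Longrightarrow> g \<in> sq N \<Longrightarrow> form M N (op_scale M N c T) f g = c * form M N T f g"
proof -
  obtain C where C: "bform M N C (form M N T)" using form_bform T by metis
  obtain R where R: "R \<in> bounded_ops M N" "\<And>f g. f \<in> sq M \<Longrightarrow> g \<in> sq N \<Longrightarrow> form M N R f g = c * form M N T f g"
    using op_of_form[OF bform_scale[OF C]] by blast
  have "op_scale M N c T = R"
  proof
    fix u
    show "op_scale M N c T u = R u"
    proof (cases "u \<in> L2 M")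
      case True
      then have u: "u = l2_class M (l2_rep u)" "l2_rep u \<in> sq M" by (simp_all add: l2_class_rep l2_rep_in)
      let ?f = "l2_rep u"
      have "op_scale M N c T u = l2_class N (\<lambda>x. c * app M T ?f x)"
        using True u T by (simp add: op_scale_def) (metis app_class app_sq l2_scale_class)
      also have "\<dots> = l2_class N (app M R ?f)"
        using u R T by (intro l2_class_cong AE_eq_if_ip_eq) (auto simp: form_def ip_scale_left)
      finally show ?thesis using u R by (metis app_class)
    next
      case False
      then show ?thesis using R by (auto simp: op_scale_def bounded_ops_def PiE_def extensional_def)
    qed
  qed
  with R show "op_scale M N c T \<in> bounded_ops M N"
    "f \<in> sq M \<Longrightarrow> g \<in> sq N \<Longrightarrow> form M N (op_scale M N c T) f g = c * form M N T f g"
    by auto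
qed

lemma op_zero_form:
  shows "op_zero M N \<in> bounded_ops M N"
    "f \<in> sq M \<Longrightarrow> g \<in> sq N \<Longrightarrow> form M N (op_zero M N) f g = 0"
proof -
  have "bform M N 0 (\<lambda>f g. 0)" by (simp add: bform_def)
  then obtain R where R: "R \<in> bounded_ops M N" "\<And>f g. f \<in> sq M \<Longrightarrow> g \<in> sq N \<Longrightarrow> form M N R f g = 0"
    using op_of_form by blast
  have "op_zero M N = R"
  proof
    fix u
    show "op_zero M N u = R u"
    proof (cases "u \<in> L2 M")
      case True
      then have u: "u = l2_class M (l2_rep u)" "l2_rep u \<in> sq M" by (simp_all add: l2_class_rep l2_rep_in)
      have "op_zero M N u = l2_class N (app M R (l2_rep u))"
        using True u R unfolding op_zero_def l2_zero_def
        by simp (intro l2_class_cong AE_eq_if_ip_eq, auto simp: form_def)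
      then show ?thesis using u R by (metis app_class)
    next
      case False
      then show ?thesis using R by (auto simp: op_zero_def bounded_ops_def PiE_def extensional_def)
    qed
  qed
  with R show "op_zero M N \<in> bounded_ops M N"
    "f \<in> sq M \<Longrightarrow> g \<in> sq N \<Longrightarrow> form M N (op_zero M N) f g = 0" by auto
qed

lemma compose_form:
  assumes S: "S \<in> bounded_ops M N" and T: "T \<in> bounded_ops N K"
  shows "compose (L2 M) T S \<in> bounded_ops M K"
    "f \<in> sq M \<Longrightarrow> g \<in> sq K \<Longrightarrow> form M K (compose (L2 M) T S) f g = form N K T (app M S f) g"
proof -
  obtain C where C: "C \<ge> 0" "\<And>f. f \<in> sq M \<Longrightarrow> nrm N (app M S f) \<le> C * nrm M f"
    using app_bound[OF S] by metis
  obtain C' where C': "C' \<ge> 0" "\<And>f. f \<in> sq N \<Longrightarrow> nrm K (app N T f) \<le> C' * nrm N f"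
    using app_bound[OF T] by metis
  have "l2_norm K (T (S u)) \<le> C' * C * l2_norm M u" if u: "u \<in> L2 M" for u
  proof -
    let ?f = "l2_rep u"
    have u': "u = l2_class M (l2_rep u)" "l2_rep u \<in> sq M" using u by (simp_all add: l2_class_rep l2_rep_in)
    have "T (S u) = T (l2_class N (app M S ?f))" using u' S by (metis app_class)
    then have "l2_norm K (T (S u)) = nrm K (app N T (app M S ?f))"
      by (simp add: l2_norm_eq app_def)
    also have "\<dots> \<le> C' * (C * nrm M ?f)"
      using C(2)[OF u'(2)] C'(2)[OF app_sq[OF S u'(2)]] C'(1) by (smt (verit) mult_left_mono)
    finally show ?thesis by (simp add: l2_norm_eq)
  qed
  moreover have "compose (L2 M) T S \<in> L2 M \<rightarrow>\<^sub>E L2 K"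
    using bounded_opsD(1)[OF S] bounded_opsD(1)[OF T] by (auto simp: compose_def)
  ultimately show "compose (L2 M) T S \<in> bounded_ops M K"
    using bounded_opsD[OF S] bounded_opsD[OF T] unfolding bounded_ops_def
    by (auto simp: compose_eq l2_add_in l2_scale_in intro!: exI[of _ "C' * C"])
  assume f: "f \<in> sq M" and g: "g \<in> sq K"
  show "form M K (compose (L2 M) T S) f g = form N K T (app M S f) g"
    unfolding form_def app_def[of M "compose _ _ _"] app_def[of N T] using f S
    by (simp add: compose_def app_class[symmetric])
qed

section \<open>Multiplication operators, restriction to sets, corners of operators\<close>

lemma ess_bounded_mult:
  assumes "a \<in> ess_bounded M" "f \<in> sq M" shows "(\<lambda>x. a x * f x) \<in> sq M"
proof -
  obtain C where C: "AE x in M. cmod (a x) \<le> C" and [measurable]: "a \<in> borel_measurable M"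
    using assms by (auto simp: ess_bounded_def)
  have [measurable]: "f \<in> borel_measurable M" using assms sq_measurable by auto
  show ?thesis
  proof (rule sq_bound[where C = C])
    show "AE x in M. cmod (a x * f x) \<le> C * cmod (f x)"
      using C by eventually_elim (simp add: norm_mult mult_right_mono)
  qed (use assms in auto)
qed

lemma mult_op_form:
  assumes a: "a \<in> ess_bounded M"
  shows "mult_op M a \<in> bounded_ops M M"
    "f \<in> sq M \<Longrightarrow> AE x in M. app M (mult_op M a) f x = a x * f x"
    "f \<in> sq M \<Longrightarrow> mult_op M a (l2_class M f) = l2_class M (\<lambda>x. a x * f x)"
proof -
  have cl: "mult_op M a (l2_class M f) = l2_class M (\<lambda>x. a x * f x)" if f: "f \<in> sq M" for f
  proof -
    have "AE x in M. a x * l2_rep (l2_class M f) x = a x * f x"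
      using l2_rep_class(2)[OF f] by eventually_elim simp
    from l2_class_cong[OF this] show ?thesis using f by (simp add: mult_op_def)
  qed
  then show "f \<in> sq M \<Longrightarrow> mult_op M a (l2_class M f) = l2_class M (\<lambda>x. a x * f x)" .
  note am = ess_bounded_mult[OF a]
  show "f \<in> sq M \<Longrightarrow> AE x in M. app M (mult_op M a) f x = a x * f x"
    unfolding app_def using cl l2_rep_class(2)[OF am] by simp
  obtain C where C: "AE x in M. cmod (a x) \<le> C" and [measurable]: "a \<in> borel_measurable M"
    using a by (auto simp: ess_bounded_def)
  have nb: "nrm M (\<lambda>x. a x * f x) \<le> \<bar>C\<bar> * nrm M f" if f: "f \<in> sq M" for f
  proof (rule power2_le_imp_le)
    have "(nrm M (\<lambda>x. a x * f x))\<^sup>2 \<le> (\<integral>x. C\<^sup>2 * (cmod (f x))\<^sup>2 \<partial>M)"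
      unfolding nrm_sq
    proof (rule integral_mono_AE)
      show "AE x in M. (cmod (a x * f x))\<^sup>2 \<le> C\<^sup>2 * (cmod (f x))\<^sup>2"
        using C
      proof eventually_elim
        case (elim x)
        then have "(cmod (a x))\<^sup>2 \<le> C\<^sup>2" by (intro power_mono) auto
        then show ?case by (simp add: norm_mult power_mult_distrib mult_right_mono)
      qed
    qed (use sq_integrable[OF am[OF f]] sq_integrable[OF f] in auto)
    also have "\<dots> = (\<bar>C\<bar> * nrm M f)\<^sup>2" by (simp add: nrm_sq power_mult_distrib)
    finally show "(nrm M (\<lambda>x. a x * f x))\<^sup>2 \<le> (\<bar>C\<bar> * nrm M f)\<^sup>2" .
  qed simp
  show "mult_op M a \<in> bounded_ops M M"
    unfolding bounded_ops_def
  proof (intro CollectI conjI ballI allI)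
    show "mult_op M a \<in> L2 M \<rightarrow>\<^sub>E L2 M" unfolding mult_op_def using am l2_rep_in(2) by auto
  next
    fix u v assume uv: "u \<in> L2 M" "v \<in> L2 M"
    let ?f = "l2_rep u" and ?g = "l2_rep v"
    have r: "?f \<in> sq M" "?g \<in> sq M" using uv l2_rep_in by auto
    have "mult_op M a (l2_add M u v) = l2_class M (\<lambda>x. a x * ?f x + a x * ?g x)"
      unfolding l2_add_def using r by (simp add: cl distrib_left)
    also have "\<dots> = l2_add M (mult_op M a u) (mult_op M a v)"
      using uv r am by (simp add: mult_op_def l2_add_class)
    finally show "mult_op M a (l2_add M u v) = l2_add M (mult_op M a u) (mult_op M a v)" .
  next
    fix c u assume u: "u \<in> L2 M"
    let ?f = "l2_rep u"
    have r: "?f \<in> sq M" using u l2_rep_in by auto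
    have "mult_op M a (l2_scale M c u) = l2_class M (\<lambda>x. c * (a x * ?f x))"
      unfolding l2_scale_def using r by (simp add: cl mult.left_commute)
    also have "\<dots> = l2_scale M c (mult_op M a u)"
      using u r am by (simp add: mult_op_def l2_scale_class)
    finally show "mult_op M a (l2_scale M c u) = l2_scale M c (mult_op M a u)" .
  next
    have "l2_norm M (mult_op M a u) \<le> \<bar>C\<bar> * l2_norm M u" if u: "u \<in> L2 M" for u
    proof -
      have r: "l2_rep u \<in> sq M" using u l2_rep_in by auto
      have "nrm M (l2_rep (mult_op M a u)) = nrm M (\<lambda>x. a x * l2_rep u x)"
        using u r l2_rep_class[OF am[OF r]] am by (simp add: mult_op_def, intro nrm_cong_AE) auto
      then show ?thesis using nb[OF r] by (simp add: l2_norm_eq)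
    qed
    then show "\<exists>C. \<forall>u\<in>L2 M. l2_norm M (mult_op M a u) \<le> C * l2_norm M u" by blast
  qed
qed

definition restr :: "'a set \<Rightarrow> ('a \<Rightarrow> complex) \<Rightarrow> 'a \<Rightarrow> complex" where
  "restr S f x = indicator S x * f x"

lemma indicator_ess_bounded: "S \<in> sets M \<Longrightarrow> indicator S \<in> ess_bounded M"
  unfolding ess_bounded_def by (auto intro!: exI[of _ 1] AE_I2 split: split_indicator)

lemma restr_sq [simp, intro]: "S \<in> sets M \<Longrightarrow> f \<in> sq M \<Longrightarrow> restr S f \<in> sq M"
  using ess_bounded_mult[OF indicator_ess_bounded] unfolding restr_def[abs_def] .

lemma restr_add: "restr S (\<lambda>x. f x + g x) = (\<lambda>x. restr S f x + restr S g x)"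
  and restr_scale: "restr S (\<lambda>x. c * f x) = (\<lambda>x. c * restr S f x)"
  and restr_restr: "restr S (restr R f) = restr (S \<inter> R) f"
  by (auto simp: restr_def algebra_simps split: split_indicator)

lemma ip_restr: "ip M (restr S f) g = ip M f (restr S g)"
  unfolding ip_def restr_def by (rule Bochner_Integration.integral_cong) (auto split: split_indicator)

lemma nrm_restr_split:
  assumes "S \<in> sets M" "f \<in> sq M"
  shows "(nrm M f)\<^sup>2 = (nrm M (restr S f))\<^sup>2 + (nrm M (restr (space M - S) f))\<^sup>2"
proof -
  have "(nrm M (restr S f))\<^sup>2 + (nrm M (restr (space M - S) f))\<^sup>2
      = (\<integral>x. (cmod (restr S f x))\<^sup>2 + (cmod (restr (space M - S) f x))\<^sup>2 \<partial>M)"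
    unfolding nrm_sq using assms
    by (intro Bochner_Integration.integral_add[symmetric] sq_integrable restr_sq) auto
  also have "\<dots> = (nrm M f)\<^sup>2" unfolding nrm_sq
    by (rule Bochner_Integration.integral_cong) (auto simp: restr_def split: split_indicator)
  finally show ?thesis by simp
qed

lemma nrm_restr_le:
  assumes "S \<in> sets M" "f \<in> sq M" shows "nrm M (restr S f) \<le> nrm M f"
  using nrm_restr_split[OF assms] by (simp add: power2_le_imp_le[where x = "nrm M (restr S f)"])

lemma bform_restr:
  assumes B: "bform M N C B" and S: "S \<in> sets M" and R: "R \<in> sets N"
  shows "bform M N C (\<lambda>f g. B (restr S f) (restr R g))"
proof -
  have "cmod (B (restr S f) (restr R g)) \<le> C * nrm M f * nrm N g" if "f \<in> sq M" "g \<in> sq N" for f g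
  proof -
    have "cmod (B (restr S f) (restr R g)) \<le> C * nrm M (restr S f) * nrm N (restr R g)"
      using bformD(6)[OF B] that S R by simp
    also have "\<dots> \<le> C * nrm M f * nrm N g"
      using that S R bformD(1)[OF B] by (intro mult_mono nrm_restr_le) auto
    finally show ?thesis .
  qed
  then show ?thesis using bformD[OF B] S R unfolding bform_def by (simp add: restr_add restr_scale)
qed

text \<open>Compression of \<open>T\<close> to the columns \<open>S\<close> and the rows
  \<open>R\<close>. The invariance of a masa-bimodule is exploited only through these
  corners.\<close>

definition block :: "'a measure \<Rightarrow> 'b measure \<Rightarrow> 'a set \<Rightarrow> 'b set \<Rightarrow> ('a, 'b) oper \<Rightarrow> ('a, 'b) oper" where
  "block M N S R T = compose (L2 M) (mult_op N (indicator R)) (compose (L2 M) T (mult_op M (indicator S)))"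

lemma block_form:
  assumes T: "T \<in> bounded_ops M N" and S: "S \<in> sets M" and R: "R \<in> sets N"
  shows "block M N S R T \<in> bounded_ops M N"
    "f \<in> sq M \<Longrightarrow> g \<in> sq N \<Longrightarrow> form M N (block M N S R T) f g = form M N T (restr S f) (restr R g)"
proof -
  note mS = mult_op_form[OF indicator_ess_bounded[OF S]]
  note mR = mult_op_form[OF indicator_ess_bounded[OF R]]
  note c1 = compose_form[OF mS(1) T]
  note c2 = compose_form[OF c1(1) mR(1)]
  show "block M N S R T \<in> bounded_ops M N" unfolding block_def by (rule c2)
  assume f: "f \<in> sq M" and g: "g \<in> sq N"
  obtain C where C: "bform M N C (form M N T)" using form_bform[OF T] .
  let ?h = "app M (compose (L2 M) T (mult_op M (indicator S))) f"
  have h: "?h \<in> sq N" using c1(1) f by simp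
  have "form M N (block M N S R T) f g = ip N (app N (mult_op N (indicator R)) ?h) g"
    unfolding block_def c2(2)[OF f g] by (simp add: form_def)
  also have "\<dots> = ip N (restr R ?h) g"
    using mR(2)[OF h] mR(1) h g R by (intro ip_cong_AE) (auto simp: restr_def)
  also have "\<dots> = form M N (compose (L2 M) T (mult_op M (indicator S))) f (restr R g)"
    by (simp add: ip_restr form_def)
  also have "\<dots> = form M N T (app M (mult_op M (indicator S)) f) (restr R g)"
    using f g R by (intro c1(2)) auto
  also have "\<dots> = form M N T (restr S f) (restr R g)"
    using mS f g R S by (intro bform_cong_AE[OF C]) (auto simp: restr_def)
  finally show "form M N (block M N S R T) f g = form M N T (restr S f) (restr R g)" .
qed

section \<open>Orthonormal bases and trace class operators\<close>

text \<open>Written as a family over \<open>E\<close>, so that a basis given as a set of classes can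
  be used through the representatives \<open>l2_rep\<close>.\<close>

definition onb :: "'a measure \<Rightarrow> 'i set \<Rightarrow> ('i \<Rightarrow> 'a \<Rightarrow> complex) \<Rightarrow> bool" where
  "onb M E r \<longleftrightarrow> (\<forall>e\<in>E. r e \<in> sq M) \<and> (\<forall>e\<in>E. \<forall>f\<in>E. ip M (r e) (r f) = (if e = f then 1 else 0)) \<and>
    (\<forall>u\<in>sq M. (\<forall>e\<in>E. ip M u (r e) = 0) \<longrightarrow> nrm M u = 0)"

lemma onbD:
  assumes "onb M E r"
  shows "e \<in> E \<Longrightarrow> r e \<in> sq M" "e \<in> E \<Longrightarrow> f \<in> E \<Longrightarrow> ip M (r e) (r f) = (if e = f then 1 else 0)"
    "u \<in> sq M \<Longrightarrow> (\<And>e. e \<in> E \<Longrightarrow> ip M u (r e) = 0) \<Longrightarrow> nrm M u = 0"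
  using assms by (auto simp: onb_def)

lemma orthonormal_basis_onb:
  assumes "orthonormal_basis M E" shows "onb M E l2_rep"
proof -
  have E: "E \<subseteq> L2 M" "\<And>e f. e \<in> E \<Longrightarrow> f \<in> E \<Longrightarrow> l2_inner M e f = (if e = f then 1 else 0)"
    "\<And>u. u \<in> L2 M \<Longrightarrow> (\<And>e. e \<in> E \<Longrightarrow> l2_inner M u e = 0) \<Longrightarrow> u = l2_zero M"
    using assms by (auto simp: orthonormal_basis_def)
  have r: "l2_rep e \<in> sq M" if "e \<in> E" for e using E(1) that l2_rep_in by blast
  have "nrm M u = 0" if u: "u \<in> sq M" and z: "\<And>e. e \<in> E \<Longrightarrow> ip M u (l2_rep e) = 0" for u
  proof -
    have "l2_class M u = l2_zero M" using u z r by (intro E(3)) (auto simp: l2_inner_eq ip_l2_class)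
    then have "AE x in M. u x = 0" unfolding l2_zero_def using u by (subst (asm) l2_class_eq_iff) auto
    then show ?thesis using u by (simp add: nrm_eq_0_iff)
  qed
  then show ?thesis using r E(2) by (auto simp: onb_def l2_inner_eq)
qed

text \<open>Zorn's lemma: to a maximal orthonormal set no normalised orthogonal vector can be
  added.\<close>

lemma orthonormal_basis_exists: "\<exists>E. orthonormal_basis M E"
proof -
  define \<A> where "\<A> = {E. E \<subseteq> L2 M \<and> (\<forall>e\<in>E. \<forall>f\<in>E. l2_inner M e f = (if e = f then 1 else 0))}"
  have "\<exists>E\<in>\<A>. \<forall>X\<in>\<A>. E \<subseteq> X \<longrightarrow> X = E"
  proof (rule subset_Zorn')
    fix C assume C: "subset.chain \<A> C"
    have "l2_inner M e f = (if e = f then 1 else 0)" if "e \<in> \<Union>C" "f \<in> \<Union>C" for e f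
    proof -
      obtain X Y where XY: "X \<in> C" "Y \<in> C" "e \<in> X" "f \<in> Y" using \<open>e \<in> \<Union>C\<close> \<open>f \<in> \<Union>C\<close> by blast
      then have "X \<subseteq> Y \<or> Y \<subseteq> X" using C unfolding subset.chain_def by blast
      then obtain Z where "Z \<in> C" "e \<in> Z" "f \<in> Z" using XY by blast
      then show ?thesis using C unfolding subset.chain_def \<A>_def by blast
    qed
    moreover have "\<Union>C \<subseteq> L2 M" using C unfolding subset.chain_def \<A>_def by blast
    ultimately show "\<Union>C \<in> \<A>" unfolding \<A>_def by blast
  qed
  then obtain E where E: "E \<in> \<A>" and max: "\<And>X. X \<in> \<A> \<Longrightarrow> E \<subseteq> X \<Longrightarrow> X = E" by blast
  have "u = l2_zero M" if u: "u \<in> L2 M" and z: "\<forall>e\<in>E. l2_inner M u e = 0" for u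
  proof (rule ccontr)
    assume ne: "u \<noteq> l2_zero M"
    let ?f = "l2_rep u"
    have f: "?f \<in> sq M" "u = l2_class M ?f" using u by (simp_all add: l2_class_rep l2_rep_in)
    have n0: "nrm M ?f \<noteq> 0"
    proof
      assume "nrm M ?f = 0"
      then have "AE x in M. ?f x = 0" using f by (simp add: nrm_eq_0_iff)
      then have "l2_class M ?f = l2_class M (\<lambda>x. 0)" by (rule l2_class_cong)
      then show False using ne f by (simp add: l2_zero_def)
    qed
    define g where "g x = complex_of_real (1 / nrm M ?f) * ?f x" for x
    have g: "g \<in> sq M" unfolding g_def using f by (intro sq_scale)
    have gn: "nrm M g = 1" unfolding g_def nrm_scale using n0 by (simp add: norm_divide)
    define v where "v = l2_class M g"
    have v: "v \<in> L2 M" unfolding v_def using g by simp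
    have vv: "l2_inner M v v = 1"
      unfolding l2_inner_eq v_def using ip_l2_class(1)[OF g l2_rep_class(1)[OF g]] ip_l2_class(2)[OF g g] gn ip_self[of M g] by simp
    have ve: "l2_inner M v e = 0" "l2_inner M e v = 0" if e: "e \<in> E" for e
    proof -
      have er: "l2_rep e \<in> sq M" using e E l2_rep_in unfolding \<A>_def by blast
      have "ip M ?f (l2_rep e) = 0" using z e by (simp add: l2_inner_eq)
      then have "ip M g (l2_rep e) = 0" unfolding g_def ip_scale_left by simp
      then show "l2_inner M v e = 0" using er g by (simp add: l2_inner_eq v_def ip_l2_class)
      then show "l2_inner M e v = 0" unfolding l2_inner_eq by (metis cnj_ip complex_cnj_zero)
    qed
    have vE: "v \<notin> E" using ve(1)[of v] vv by auto
    have "insert v E \<in> \<A>" using E v vv ve vE unfolding \<A>_def by auto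
    then have "insert v E = E" by (rule max) auto
    then show False using vE by auto
  qed
  then show ?thesis using E unfolding orthonormal_basis_def \<A>_def by blast
qed

text \<open>For the partial expansion \<open>s\<close> both \<open>ip M u s\<close> and
  \<open>(nrm M s)\<^sup>2\<close> equal the finite sum, so the inequality says that the squared
  norm of \<open>u - s\<close> is nonnegative.\<close>

lemma bessel:
  assumes E: "onb M E r" and u: "u \<in> sq M"
  shows "(\<lambda>e. (cmod (ip M u (r e)))\<^sup>2) summable_on E"
    "finite F \<Longrightarrow> F \<subseteq> E \<Longrightarrow> (\<Sum>e\<in>F. (cmod (ip M u (r e)))\<^sup>2) \<le> (nrm M u)\<^sup>2"
proof -
  have *: "(\<Sum>e\<in>F. (cmod (ip M u (r e)))\<^sup>2) \<le> (nrm M u)\<^sup>2" if F: "finite F" "F \<subseteq> E" for F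
  proof -
    define s where "s x = (\<Sum>e\<in>F. ip M u (r e) * r e x)" for x
    have r: "r e \<in> sq M" if "e \<in> F" for e using that F onbD(1)[OF E] by blast
    have s: "s \<in> sq M" unfolding s_def using r by auto
    have 1: "ip M u s = complex_of_real (\<Sum>e\<in>F. (cmod (ip M u (r e)))\<^sup>2)"
      unfolding s_def of_real_sum complex_norm_square
      using r u by (simp add: ip_sum_right ip_scale_right) (simp add: mult.commute)
    have rs: "ip M (r e) s = cnj (ip M u (r e))" if e: "e \<in> F" for e
    proof -
      have "ip M (r e) s = (\<Sum>f\<in>F. cnj (ip M u (r f)) * (if e = f then 1 else 0))"
        unfolding s_def using r e F onbD(2)[OF E] by (simp add: ip_sum_right ip_scale_right subset_iff)
      also have "\<dots> = (\<Sum>f\<in>F. if e = f then cnj (ip M u (r e)) else 0)" by (intro sum.cong) auto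
      finally show ?thesis using F e by simp
    qed
    have "ip M s s = (\<Sum>e\<in>F. ip M u (r e) * ip M (r e) s)"
    proof -
      have "ip M s s = ip M (\<lambda>x. \<Sum>e\<in>F. ip M u (r e) * r e x) s" by (simp add: s_def[abs_def])
      also have "\<dots> = (\<Sum>e\<in>F. ip M u (r e) * ip M (r e) s)" using r s by (simp add: ip_sum_left ip_scale_left)
      finally show ?thesis .
    qed
    also have "\<dots> = complex_of_real (\<Sum>e\<in>F. (cmod (ip M u (r e)))\<^sup>2)"
      unfolding of_real_sum complex_norm_square using rs by simp
    finally have 2: "(nrm M s)\<^sup>2 = (\<Sum>e\<in>F. (cmod (ip M u (r e)))\<^sup>2)"
      unfolding ip_self of_real_eq_iff .
    have "0 \<le> (nrm M u)\<^sup>2 - 2 * Re (ip M u s) + (nrm M s)\<^sup>2"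
      using nrm_diff_expand[OF u s, of 1] zero_le_power2[of "nrm M (\<lambda>x. u x - 1 * s x)"] by simp
    then show ?thesis unfolding 1 2 by simp
  qed
  then show "finite F \<Longrightarrow> F \<subseteq> E \<Longrightarrow> (\<Sum>e\<in>F. (cmod (ip M u (r e)))\<^sup>2) \<le> (nrm M u)\<^sup>2" .
  show "(\<lambda>e. (cmod (ip M u (r e)))\<^sup>2) summable_on E"
    using * by (intro nonneg_bdd_above_summable_on bdd_aboveI2[where M = "(nrm M u)\<^sup>2"]) auto
qed

lemma bessel_mult:
  assumes E: "onb M E r" and u: "u \<in> sq M" and v: "v \<in> sq M"
  shows "(\<lambda>e. cmod (ip M u (r e)) * cmod (ip M v (r e))) summable_on E"
    "(\<Sum>\<^sub>\<infinity>e\<in>E. cmod (ip M u (r e)) * cmod (ip M v (r e))) \<le> nrm M u * nrm M v"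
proof -
  have *: "(\<Sum>e\<in>F. cmod (ip M u (r e)) * cmod (ip M v (r e))) \<le> nrm M u * nrm M v"
    if F: "finite F" "F \<subseteq> E" for F
  proof (rule power2_le_imp_le)
    have "(\<Sum>e\<in>F. cmod (ip M u (r e)) * cmod (ip M v (r e)))\<^sup>2
        \<le> (\<Sum>e\<in>F. (cmod (ip M u (r e)))\<^sup>2) * (\<Sum>e\<in>F. (cmod (ip M v (r e)))\<^sup>2)"
      by (rule Cauchy_Schwarz_ineq_sum)
    also have "\<dots> \<le> (nrm M u)\<^sup>2 * (nrm M v)\<^sup>2"
      using F by (intro mult_mono bessel(2)[OF E] u v sum_nonneg) auto
    finally show "(\<Sum>e\<in>F. cmod (ip M u (r e)) * cmod (ip M v (r e)))\<^sup>2 \<le> (nrm M u * nrm M v)\<^sup>2"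
      by (simp add: power_mult_distrib)
  qed simp
  show 1: "(\<lambda>e. cmod (ip M u (r e)) * cmod (ip M v (r e))) summable_on E"
    using * by (intro nonneg_bdd_above_summable_on bdd_aboveI2[where M = "nrm M u * nrm M v"]) auto
  show "(\<Sum>\<^sub>\<infinity>e\<in>E. cmod (ip M u (r e)) * cmod (ip M v (r e))) \<le> nrm M u * nrm M v"
    using * by (intro infsum_le_finite_sums 1)
qed

lemma cmod_ip_commute: "cmod (ip M f g) = cmod (ip M g f)"
  by (metis cnj_ip complex_mod_cnj)

lemma parseval_summable:
  assumes E: "onb M E r" and u: "u \<in> sq M" and v: "v \<in> sq M"
  shows "(\<lambda>e. norm (ip M u (r e) * ip M (r e) v)) summable_on E"
  using bessel_mult(1)[OF assms] by (simp add: norm_mult cmod_ip_commute[of M _ v])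

text \<open>As a functional of \<open>u\<close> the left side is bounded, hence given by some
  \<open>z\<close>; evaluation at basis vectors shows that \<open>z - v\<close> is orthogonal to the
  basis and therefore null.\<close>

theorem parseval:
  assumes E: "onb M E r" and u: "u \<in> sq M" and v: "v \<in> sq M"
  shows "(\<Sum>\<^sub>\<infinity>e\<in>E. ip M u (r e) * ip M (r e) v) = ip M u v"
proof -
  let ?\<phi> = "\<lambda>u. \<Sum>\<^sub>\<infinity>e\<in>E. ip M u (r e) * ip M (r e) v"
  have s: "(\<lambda>e. ip M u (r e) * ip M (r e) v) summable_on E" if "u \<in> sq M" for u
    using parseval_summable[OF E that v] by (rule abs_summable_summable)
  have "\<exists>z\<in>sq M. \<forall>u\<in>sq M. ?\<phi> u = ip M u z"
  proof (rule riesz_ex[where C = "nrm M v"])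
    fix f g assume fg: "f \<in> sq M" "g \<in> sq M"
    show "?\<phi> (\<lambda>x. f x + g x) = ?\<phi> f + ?\<phi> g"
      using s fg onbD(1)[OF E] by (subst infsum_add[symmetric]) (auto simp: ip_add_left distrib_right intro!: infsum_cong)
  next
    fix c f assume f: "f \<in> sq M"
    show "?\<phi> (\<lambda>x. c * f x) = c * ?\<phi> f"
      by (subst infsum_cmult_right'[symmetric]) (simp add: ip_scale_left mult.assoc)
  next
    fix f assume f: "f \<in> sq M"
    have "cmod (?\<phi> f) \<le> (\<Sum>\<^sub>\<infinity>e\<in>E. cmod (ip M f (r e) * ip M (r e) v))"
      by (rule norm_infsum_bound) (rule parseval_summable[OF E f v])
    also have "\<dots> \<le> nrm M f * nrm M v"
      using bessel_mult(2)[OF E f v] by (simp add: norm_mult cmod_ip_commute[of M _ v])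
    finally show "cmod (?\<phi> f) \<le> nrm M v * nrm M f" by (simp add: mult.commute)
  qed
  then obtain z where z: "z \<in> sq M" "\<And>u. u \<in> sq M \<Longrightarrow> ?\<phi> u = ip M u z" by blast
  have "ip M (\<lambda>x. z x - v x) (r e) = 0" if e: "e \<in> E" for e
  proof -
    have "?\<phi> (r e) = (\<Sum>\<^sub>\<infinity>f\<in>{e}. ip M (r e) (r f) * ip M (r f) v)"
      using e onbD(2)[OF E] by (intro infsum_cong_neutral) auto
    also have "\<dots> = ip M (r e) v" using onbD(2)[OF E e e] by simp
    finally have "ip M (r e) z = ip M (r e) v" using z onbD(1)[OF E e] by simp
    then have "ip M z (r e) = ip M v (r e)" by (metis cnj_ip)
    then show ?thesis using z v onbD(1)[OF E e] by (simp add: ip_diff_left)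
  qed
  then have "nrm M (\<lambda>x. z x - v x) = 0" using z v by (intro onbD(3)[OF E]) auto
  then have "ip M u (\<lambda>x. z x - v x) = 0"
    using ip_bound[OF u, of "\<lambda>x. z x - v x"] z v by simp
  then show ?thesis using z u v by (simp add: ip_diff_right)
qed

lemma parseval_norm:
  assumes "onb M E r" and "u \<in> sq M"
  shows "(\<Sum>\<^sub>\<infinity>e\<in>E. (cmod (ip M u (r e)))\<^sup>2) = (nrm M u)\<^sup>2"
proof -
  have "complex_of_real (\<Sum>\<^sub>\<infinity>e\<in>E. (cmod (ip M u (r e)))\<^sup>2) = (\<Sum>\<^sub>\<infinity>e\<in>E. complex_of_real ((cmod (ip M u (r e)))\<^sup>2))"
    using bessel(1)[OF assms] summable_on_of_real[OF bessel(1)[OF assms], where 'a = complex]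
    by (intro infsum_bounded_linear_strong[symmetric] bounded_linear_of_real) blast
  also have "\<dots> = (\<Sum>\<^sub>\<infinity>e\<in>E. ip M u (r e) * ip M (r e) u)"
    by (simp only: complex_norm_square cnj_ip)
  also have "\<dots> = complex_of_real ((nrm M u)\<^sup>2)" using parseval[OF assms assms(2)] by (simp add: ip_self)
  finally show ?thesis by (simp only: of_real_eq_iff)
qed

section \<open>Square summable sequences and trace functionals\<close>

definition sq_seq :: "'a measure \<Rightarrow> (nat \<Rightarrow> 'a \<Rightarrow> complex) \<Rightarrow> bool" where
  "sq_seq M x \<longleftrightarrow> (\<forall>n. x n \<in> sq M) \<and> summable (\<lambda>n. (nrm M (x n))\<^sup>2)"

lemma sq_seqD: "sq_seq M x \<Longrightarrow> x n \<in> sq M" "sq_seq M x \<Longrightarrow> summable (\<lambda>n. (nrm M (x n))\<^sup>2)"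
  by (auto simp: sq_seq_def)

lemma sq_seq_mult_summable:
  assumes "sq_seq M x" "sq_seq N y" shows "summable (\<lambda>n. nrm M (x n) * nrm N (y n))"
proof (rule summable_comparison_test')
  show "summable (\<lambda>n. (nrm M (x n))\<^sup>2 + (nrm N (y n))\<^sup>2)" using assms by (auto simp: sq_seq_def intro: summable_add)
  fix n
  have "2 * nrm M (x n) * nrm N (y n) \<le> (nrm M (x n))\<^sup>2 + (nrm N (y n))\<^sup>2" by (rule sum_squares_bound)
  moreover have "0 \<le> nrm M (x n) * nrm N (y n)" by simp
  ultimately show "norm (nrm M (x n) * nrm N (y n)) \<le> (nrm M (x n))\<^sup>2 + (nrm N (y n))\<^sup>2"
    unfolding real_norm_def abs_of_nonneg[OF \<open>0 \<le> nrm M (x n) * nrm N (y n)\<close>] by linarith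
qed

lemma form_seq_summable:
  assumes "bform M N C B" "sq_seq M x" "sq_seq N y"
  shows "summable (\<lambda>n. norm (B (x n) (y n)))"
proof (rule summable_comparison_test')
  show "summable (\<lambda>n. C * (nrm M (x n) * nrm N (y n)))"
    using sq_seq_mult_summable[OF assms(2,3)] by (rule summable_mult)
  show "norm (norm (B (x n) (y n))) \<le> C * (nrm M (x n) * nrm N (y n))" for n
    using bformD(6)[OF assms(1), of "x n" "y n"] assms(2,3) by (simp add: sq_seq_def mult.assoc)
qed

text \<open>The functionals \<open>T \<mapsto> tr (T A)\<close> in coordinates. In this form they are visibly closed under linear combinations,
  which for the operators \<open>A\<close> would require the absolute value of a sum.\<close>

definition vfun :: "'a measure \<Rightarrow> 'b measure \<Rightarrow> (nat \<Rightarrow> 'a \<Rightarrow> complex) \<Rightarrow> (nat \<Rightarrow> 'b \<Rightarrow> complex) \<Rightarrow> ('a, 'b) oper \<Rightarrow> complex" where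
  "vfun M N x y T = (\<Sum>n. form M N T (x n) (y n))"

text \<open>The sum over the basis is exchanged with the sum over \<open>n\<close>. Absolute
  summability comes from Bessel's inequality in the basis index and from Cauchy-Schwarz in
  \<open>n\<close>.\<close>

lemma op_trace_eq:
  fixes M :: "'a measure" and N :: "'b measure"
  assumes A: "A \<in> bounded_ops N M" and T: "T \<in> bounded_ops M N" and x: "sq_seq M x" and y: "sq_seq N y"
    and rep: "\<And>v w. v \<in> sq N \<Longrightarrow> w \<in> sq M \<Longrightarrow> (\<lambda>n. ip N v (y n) * ip M (x n) w) sums form N M A v w"
  shows "op_trace N (compose (L2 N) T A) = vfun M N x y T"
proof -
  define E where "E = (SOME E. orthonormal_basis N E)"
  have Eb: "orthonormal_basis N E" unfolding E_def using orthonormal_basis_exists by (rule someI_ex)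
  let ?r = "l2_rep :: 'b vec \<Rightarrow> _"
  have E: "onb N E ?r" using Eb by (rule orthonormal_basis_onb)
  note r = onbD(1)[OF E]
  obtain C where C: "bform M N C (form M N T)" using form_bform[OF T] .
  define a where "a n e = ip N (?r e) (y n) * form M N T (x n) (?r e)" for n e
  have xs: "x n \<in> sq M" and ys: "y n \<in> sq N" for n using x y by (auto simp: sq_seq_def)
  have ae: "(\<lambda>e. norm (a n e)) summable_on E"
    "(\<Sum>\<^sub>\<infinity>e\<in>E. norm (a n e)) \<le> C * (nrm M (x n) * nrm N (y n))" for n
  proof -
    let ?t = "app M T (x n)"
    have t: "?t \<in> sq N" using xs T by simp
    have eq: "norm (a n e) = cmod (ip N ?t (?r e)) * cmod (ip N (y n) (?r e))" for e
      unfolding a_def form_def norm_mult by (simp add: cmod_ip_commute[of N "y n"])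
    show "(\<lambda>e. norm (a n e)) summable_on E" unfolding eq by (rule bessel_mult(1)[OF E t ys])
    have "(\<Sum>\<^sub>\<infinity>e\<in>E. norm (a n e)) \<le> nrm N ?t * nrm N (y n)" unfolding eq by (rule bessel_mult(2)[OF E t ys])
    also have "nrm N ?t \<le> C * nrm M (x n)"
    proof (cases "nrm N ?t = 0")
      case False
      have "complex_of_real (nrm N ?t * nrm N ?t) = form M N T (x n) ?t"
        by (simp add: form_def ip_self power2_eq_square)
      then have "nrm N ?t * nrm N ?t = cmod (form M N T (x n) ?t)"
        by (metis abs_of_nonneg mult_nonneg_nonneg norm_of_real nrm_nonneg)
      also have "\<dots> \<le> C * nrm M (x n) * nrm N ?t" using bformD(6)[OF C xs t] .
      finally show ?thesis using False by (simp add: mult_le_cancel_right less_le)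
    qed (use bformD(1)[OF C] in simp)
    finally show "(\<Sum>\<^sub>\<infinity>e\<in>E. norm (a n e)) \<le> C * (nrm M (x n) * nrm N (y n))"
      by (simp add: mult_right_mono mult.assoc[symmetric])
  qed
  have "summable (\<lambda>n. \<Sum>\<^sub>\<infinity>e\<in>E. norm (a n e))"
    by (rule summable_comparison_test'[OF summable_mult[OF sq_seq_mult_summable[OF x y], of C], of 0])
      (use ae(2) in \<open>simp add: infsum_nonneg\<close>)
  then have "(\<lambda>n. \<Sum>\<^sub>\<infinity>e\<in>E. norm (a n e)) summable_on UNIV"
    by (subst summable_on_UNIV_nonneg_real_iff) (auto intro: infsum_nonneg)
  then have "(\<lambda>p. norm (case p of (n, e) \<Rightarrow> a n e)) summable_on UNIV \<times> E"
    using ae(1) by (intro Infinite_Sum.abs_summable_on_Sigma_iff[THEN iffD2]) (simp add: infsum_nonneg)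
  then have sw: "(\<lambda>(n, e). a n e) summable_on UNIV \<times> E" by (rule abs_summable_summable)
  have sw2: "(\<lambda>n. norm (a n e)) summable_on UNIV" if e: "e \<in> E" for e
  proof -
    have "(\<lambda>n. norm (a n e)) summable_on UNIV"
    proof (rule summable_on_comparison_test)
      show "(\<lambda>n. \<Sum>\<^sub>\<infinity>e\<in>E. norm (a n e)) summable_on UNIV" by fact
      show "norm (a n e) \<le> (\<Sum>\<^sub>\<infinity>e\<in>E. norm (a n e))" for n
        using finite_sum_le_infsum[OF ae(1)[of n], of "{e}"] e by simp
    qed simp
    then show ?thesis .
  qed
  have "op_trace N (compose (L2 N) T A) = (\<Sum>\<^sub>\<infinity>e\<in>E. \<Sum>\<^sub>\<infinity>n. a n e)"
    unfolding op_trace_def E_def[symmetric]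
  proof (rule infsum_cong)
    fix e assume e: "e \<in> E"
    have eL: "e \<in> L2 N" using e Eb by (auto simp: orthonormal_basis_def)
    have "l2_inner N (compose (L2 N) T A e) e = form N N (compose (L2 N) T A) (?r e) (?r e)"
      unfolding l2_inner_eq form_def app_def by (simp add: l2_class_rep eL)
    also have "\<dots> = form M N T (app N A (?r e)) (?r e)" using r[OF e] by (intro compose_form(2)[OF A T])
    also have "\<dots> = (\<Sum>\<^sub>\<infinity>n. a n e)"
    proof -
      \<comment> \<open>\<open>z\<close> is the adjoint of \<open>T\<close> at the basis vector;
        with \<open>T\<close> moved there, \<open>rep\<close> applies to \<open>A\<close>
        alone.\<close>
      have "\<exists>z\<in>sq M. \<forall>u\<in>sq M. form M N T u (?r e) = ip M u z"
        using bformD[OF C] r[OF e] by (intro riesz_ex[where C = "C * nrm N (?r e)"]) (auto simp: mult_ac)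
      then obtain z where z: "z \<in> sq M" "\<And>u. u \<in> sq M \<Longrightarrow> form M N T u (?r e) = ip M u z" by blast
      have "form M N T (app N A (?r e)) (?r e) = form N M A (?r e) z"
        using z A r[OF e] by (simp add: form_def[of N M])
      moreover have "(\<lambda>n. a n e) sums form N M A (?r e) z"
        using rep[OF r[OF e] z(1)] unfolding a_def by (simp add: z(2)[OF xs])
      moreover have "(\<lambda>n. a n e) sums (\<Sum>\<^sub>\<infinity>n. a n e)"
        using abs_summable_summable[OF sw2[OF e]] by (intro has_sum_imp_sums) simp
      ultimately show ?thesis using sums_unique2 by metis
    qed
    finally show "l2_inner N (compose (L2 N) T A e) e = (\<Sum>\<^sub>\<infinity>n. a n e)" .
  qed
  also have "\<dots> = (\<Sum>\<^sub>\<infinity>n. \<Sum>\<^sub>\<infinity>e\<in>E. a n e)" by (rule infsum_swap_banach[OF sw, symmetric])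
  also have "\<dots> = (\<Sum>\<^sub>\<infinity>n. form M N T (x n) (y n))"
  proof (rule infsum_cong)
    fix n
    have "(\<Sum>\<^sub>\<infinity>e\<in>E. a n e) = (\<Sum>\<^sub>\<infinity>e\<in>E. ip N (app M T (x n)) (?r e) * ip N (?r e) (y n))"
      by (simp add: a_def form_def mult.commute)
    also have "\<dots> = form M N T (x n) (y n)" unfolding form_def using xs ys T by (intro parseval[OF E]) auto
    finally show "(\<Sum>\<^sub>\<infinity>e\<in>E. a n e) = form M N T (x n) (y n)" .
  qed
  also have "\<dots> = vfun M N x y T"
  proof -
    have "(\<lambda>n. form M N T (x n) (y n)) summable_on UNIV"
      using form_seq_summable[OF C x y] by (intro norm_summable_imp_summable_on)
    then have "(\<lambda>n. form M N T (x n) (y n)) sums (\<Sum>\<^sub>\<infinity>n. form M N T (x n) (y n))"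
      by (intro has_sum_imp_sums) simp
    then show ?thesis by (simp add: vfun_def sums_iff)
  qed
  finally show ?thesis .
qed

text \<open>Orthonormalisation for a possibly degenerate positive form \<open>p\<close>; a vector that contributes nothing is replaced by 0.
  For \<open>p u v = \<langle>P u, v\<rangle>\<close> with \<open>P\<close> the absolute value of \<open>A\<close> and \<open>g\<close> an orthonormal basis, the resulting \<open>f\<^sub>n\<close> give
  \<open>A v = \<Sum>\<^sub>n \<langle>v, P f\<^sub>n\<rangle> A f\<^sub>n\<close> with \<open>P f\<^sub>n\<close> and \<open>A f\<^sub>n\<close> square summable, which makes square roots and the polar
  decomposition unnecessary.\<close>

fun gram_schmidt :: "(('a \<Rightarrow> complex) \<Rightarrow> ('a \<Rightarrow> complex) \<Rightarrow> complex) \<Rightarrow> (nat \<Rightarrow> 'a \<Rightarrow> complex) \<Rightarrow> nat \<Rightarrow> 'a \<Rightarrow> complex" where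
  "gram_schmidt p g n =
    (let h = (\<lambda>x. g n x - (\<Sum>i<n. p (g n) (gram_schmidt p g i) * gram_schmidt p g i x))
     in if p h h = 0 then (\<lambda>x. 0) else (\<lambda>x. complex_of_real (1 / sqrt (Re (p h h))) * h x))"

declare gram_schmidt.simps [simp del]

definition posform :: "'a measure \<Rightarrow> (('a \<Rightarrow> complex) \<Rightarrow> ('a \<Rightarrow> complex) \<Rightarrow> complex) \<Rightarrow> bool" where
  "posform M p \<longleftrightarrow> (\<exists>C. bform M M C p) \<and> (\<forall>u\<in>sq M. p u u \<in> \<real>\<^sub>\<ge>\<^sub>0)"

lemma posformD:
  assumes "posform M p" "u \<in> sq M"
  shows "p u u = complex_of_real (Re (p u u))" "0 \<le> Re (p u u)"
  using assms by (auto simp: posform_def nonneg_Reals_def complex_eq_iff)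

lemma posform_lin:
  assumes "posform M p"
  shows "f \<in> sq M \<Longrightarrow> f' \<in> sq M \<Longrightarrow> g \<in> sq M \<Longrightarrow> p (\<lambda>x. f x + f' x) g = p f g + p f' g"
    "f \<in> sq M \<Longrightarrow> g \<in> sq M \<Longrightarrow> p (\<lambda>x. c * f x) g = c * p f g"
    "f \<in> sq M \<Longrightarrow> g \<in> sq M \<Longrightarrow> g' \<in> sq M \<Longrightarrow> p f (\<lambda>x. g x + g' x) = p f g + p f g'"
    "f \<in> sq M \<Longrightarrow> g \<in> sq M \<Longrightarrow> p f (\<lambda>x. c * g x) = cnj c * p f g"
    "f \<in> sq M \<Longrightarrow> f' \<in> sq M \<Longrightarrow> g \<in> sq M \<Longrightarrow> p (\<lambda>x. f x - f' x) g = p f g - p f' g"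
    "f \<in> sq M \<Longrightarrow> g \<in> sq M \<Longrightarrow> g' \<in> sq M \<Longrightarrow> p f (\<lambda>x. g x - g' x) = p f g - p f g'"
proof -
  obtain C where C: "bform M M C p" using assms by (auto simp: posform_def)
  show "f \<in> sq M \<Longrightarrow> f' \<in> sq M \<Longrightarrow> g \<in> sq M \<Longrightarrow> p (\<lambda>x. f x + f' x) g = p f g + p f' g"
    "f \<in> sq M \<Longrightarrow> g \<in> sq M \<Longrightarrow> p (\<lambda>x. c * f x) g = c * p f g"
    "f \<in> sq M \<Longrightarrow> g \<in> sq M \<Longrightarrow> g' \<in> sq M \<Longrightarrow> p f (\<lambda>x. g x + g' x) = p f g + p f g'"
    "f \<in> sq M \<Longrightarrow> g \<in> sq M \<Longrightarrow> p f (\<lambda>x. c * g x) = cnj c * p f g"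
    by (fact bformD[OF C])+
  show "f \<in> sq M \<Longrightarrow> f' \<in> sq M \<Longrightarrow> g \<in> sq M \<Longrightarrow> p (\<lambda>x. f x - f' x) g = p f g - p f' g"
    "f \<in> sq M \<Longrightarrow> g \<in> sq M \<Longrightarrow> g' \<in> sq M \<Longrightarrow> p f (\<lambda>x. g x - g' x) = p f g - p f g'"
    using bform_diff[OF C] by blast+
qed

lemma posform_sum:
  assumes p: "posform M p" and "g \<in> sq M" "\<And>i. i \<in> I \<Longrightarrow> f i \<in> sq M"
  shows "p (\<lambda>x. \<Sum>i\<in>I. c i * f i x) g = (\<Sum>i\<in>I. c i * p (f i) g)"
  using assms(3)
proof (induction I rule: infinite_finite_induct)
  case (insert i I)
  then show ?case using assms(2) by (simp add: posform_lin[OF p])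
qed (use posform_lin(2)[OF p, of "\<lambda>x. 0" g 0] assms(2) in auto)

lemma posform_diff_sum:
  assumes p: "posform M p" and u: "u \<in> sq M" and f: "\<And>i. f i \<in> sq M" and v: "v \<in> sq M"
  shows "p (\<lambda>x. u x - (\<Sum>i\<in>I. c i * f i x)) v = p u v - (\<Sum>i\<in>I. c i * p (f i) v)"
proof -
  have "(\<lambda>x. \<Sum>i\<in>I. c i * f i x) \<in> sq M" using f by (intro sq_sum sq_scale)
  then show ?thesis by (simp only: posform_lin(5)[OF p u _ v] posform_sum[OF p v f])
qed

text \<open>Polarisation: \<open>p\<close> is real on the diagonal, and testing \<open>u + v\<close>
  and \<open>u + \<i> * v\<close> forces hermitian symmetry.\<close>

lemma posform_sym:
  assumes p: "posform M p" and u: "u \<in> sq M" and v: "v \<in> sq M"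
  shows "cnj (p u v) = p v u"
proof -
  note l = posform_lin[OF p]
  have im: "Im (p w w) = 0" if "w \<in> sq M" for w using posformD(1)[OF p that] by (metis Im_complex_of_real)
  have 1: "p (\<lambda>x. u x + v x) (\<lambda>x. u x + v x) = p u u + p u v + (p v u + p v v)" using u v by (simp add: l)
  have 2: "p (\<lambda>x. u x + \<i> * v x) (\<lambda>x. u x + \<i> * v x) = p u u - \<i> * p u v + (\<i> * p v u + p v v)"
    using u v by (simp add: l algebra_simps)
  have "Im (p u v) + Im (p v u) = 0" using im[of "\<lambda>x. u x + v x"] im[OF u] im[OF v] u v unfolding 1 by simp
  moreover have "- Re (p u v) + Re (p v u) = 0"
    using im[of "\<lambda>x. u x + \<i> * v x"] im[OF u] im[OF v] u v unfolding 2 by simp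
  ultimately show ?thesis by (simp add: complex_eq_iff)
qed

lemma posform_expand:
  assumes p: "posform M p" and u: "u \<in> sq M" and v: "v \<in> sq M"
  shows "Re (p (\<lambda>x. u x - c * v x) (\<lambda>x. u x - c * v x)) =
    Re (p u u) - 2 * Re (cnj c * p u v) + (cmod c)\<^sup>2 * Re (p v v)"
proof -
  have "p (\<lambda>x. u x - c * v x) (\<lambda>x. u x - c * v x) = p u u - cnj c * p u v - (c * p v u - (c * cnj c) * p v v)"
    using u v by (simp add: posform_lin[OF p] algebra_simps)
  also have "c * p v u = cnj (cnj c * p u v)" using posform_sym[OF p u v] by simp
  also have "c * cnj c = complex_of_real ((cmod c)\<^sup>2)" by (rule complex_norm_square[symmetric])
  finally show ?thesis by simp
qed

lemma posform_null:
  assumes p: "posform M p" and u: "u \<in> sq M" and v: "v \<in> sq M" and 0: "p v v = 0"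
  shows "p u v = 0" "p v u = 0"
proof -
  show "p u v = 0"
  proof (rule ccontr)
    assume n: "p u v \<noteq> 0"
    define a where "a = p u v"
    \<comment> \<open>Chosen so that the quadratic takes the value \<open>- Re (p u u) - 2\<close>,
      against positivity.\<close>
    define t where "t = (Re (p u u) + 1) / (cmod a)\<^sup>2"
    have "0 \<le> Re (p (\<lambda>x. u x - (t * a) * v x) (\<lambda>x. u x - (t * a) * v x))"
      using u v by (intro posformD(2)[OF p]) auto
    also have "\<dots> = Re (p u u) - 2 * Re (cnj (t * a) * a)"
      unfolding posform_expand[OF p u v] 0 a_def by simp
    also have "cnj (t * a) * a = complex_of_real (t * (cmod a)\<^sup>2)"
      using complex_norm_square[of a] by (simp add: mult.commute)
    also have "t * (cmod a)\<^sup>2 = Re (p u u) + 1" using n by (simp add: t_def a_def)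
    finally show False using posformD(2)[OF p u] by simp
  qed
  then show "p v u = 0" using posform_sym[OF p u v] by simp
qed

locale gram =
  fixes M :: "'a measure" and p and g :: "nat \<Rightarrow> 'a \<Rightarrow> complex"
  assumes p: "posform M p" and g: "\<And>n. g n \<in> sq M"
begin

definition f where "f n = gram_schmidt p g n"
definition h where "h n = (\<lambda>x. g n x - (\<Sum>i<n. p (g n) (f i) * f i x))"

lemma f_eq: "f n = (if p (h n) (h n) = 0 then (\<lambda>x. 0) else (\<lambda>x. complex_of_real (1 / sqrt (Re (p (h n) (h n)))) * h n x))"
  unfolding f_def h_def by (subst gram_schmidt.simps) (simp add: Let_def)

lemma f_sq: "f n \<in> sq M"
proof (induction n rule: less_induct)
  case (less n)
  then have "h n \<in> sq M" unfolding h_def using g by (intro sq_diff sq_sum sq_scale) auto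
  then have "(\<lambda>x. complex_of_real (1 / sqrt (Re (p (h n) (h n)))) * h n x) \<in> sq M" by (rule sq_scale)
  then show ?case unfolding f_eq[of n] by auto
qed

lemma h_sq: "h n \<in> sq M" unfolding h_def using g f_sq by (intro sq_diff sq_sum sq_scale) auto

lemma p_zero: "u \<in> sq M \<Longrightarrow> p u (\<lambda>x. 0) = 0" "u \<in> sq M \<Longrightarrow> p (\<lambda>x. 0) u = 0"
  using posform_lin(2)[OF p, of u u 0] posform_lin(4)[OF p, of u u 0] by auto

lemma f_norm: "p (f n) (f n) = (if p (h n) (h n) = 0 then 0 else 1)"
proof (cases "p (h n) (h n) = 0")
  case False
  define q where "q = Re (p (h n) (h n))"
  have q: "p (h n) (h n) = complex_of_real q" "q \<ge> 0" unfolding q_def using posformD[OF p h_sq] by auto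
  then have q0: "q > 0" using False by (cases "q = 0") auto
  have fn: "f n = (\<lambda>x. complex_of_real (1 / sqrt q) * h n x)" using False by (simp add: f_eq q_def)
  have "p (f n) (f n) = complex_of_real (1 / sqrt q) * (cnj (complex_of_real (1 / sqrt q)) * p (h n) (h n))"
    unfolding fn posform_lin(2)[OF p h_sq sq_scale[OF h_sq]] posform_lin(4)[OF p h_sq h_sq] ..
  also have "\<dots> = complex_of_real ((1 / sqrt q) * (1 / sqrt q) * q)"
    unfolding q complex_cnj_complex_of_real of_real_mult by (simp only: mult.assoc)
  also have "(1 / sqrt q) * (1 / sqrt q) * q = 1" using q0 by (simp add: field_simps)
  finally show ?thesis using False by simp
qed (use f_sq in \<open>simp add: f_eq p_zero\<close>)

lemma f_orth: "i < n \<Longrightarrow> p (f n) (f i) = 0"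
proof (induction n arbitrary: i rule: less_induct)
  case (less n)
  have "p (h n) (f i) = p (g n) (f i) - (\<Sum>j<n. p (g n) (f j) * p (f j) (f i))"
    unfolding h_def by (rule posform_diff_sum[OF p g f_sq f_sq])
  also have "(\<Sum>j<n. p (g n) (f j) * p (f j) (f i)) = (\<Sum>j<n. if j = i then p (g n) (f i) * p (f i) (f i) else 0)"
  proof (rule sum.cong)
    fix j assume j: "j \<in> {..<n}"
    show "p (g n) (f j) * p (f j) (f i) = (if j = i then p (g n) (f i) * p (f i) (f i) else 0)"
    proof (cases i j rule: linorder_cases)
      case less
      then show ?thesis using less.IH[of j i] j by simp
    next
      case greater
      then have "p (f i) (f j) = 0" using less.IH[of i j] less.prems by simp
      then have "p (f j) (f i) = 0" using posform_sym[OF p f_sq f_sq, of i j] by simp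
      then show ?thesis using greater by simp
    qed simp
  qed simp
  also have "\<dots> = p (g n) (f i) * p (f i) (f i)" using less.prems by simp
  \<comment> \<open>If \<open>h i\<close> is null then \<open>f i\<close> is the zero function and
    both sides vanish; otherwise \<open>f i\<close> is normalised.\<close>
  also have "\<dots> = p (g n) (f i)"
    using f_norm[of i] g by (cases "p (h i) (h i) = 0") (auto simp: f_eq[of i] p_zero)
  finally have "p (h n) (f i) = 0" by simp
  then have "p (\<lambda>x. c * h n x) (f i) = 0" for c by (simp add: posform_lin(2)[OF p h_sq f_sq])
  then show ?case unfolding f_eq[of n] using p_zero(2)[OF f_sq] by presburger
qed

lemma f_orth': "i \<noteq> j \<Longrightarrow> p (f i) (f j) = 0"
  using f_orth posform_sym[OF p f_sq f_sq] by (metis complex_cnj_zero linorder_neqE_nat)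

text \<open>\<open>h n\<close> is either a multiple of \<open>f n\<close> or null for
  \<open>p\<close>, and \<open>p\<close> does not see null vectors. The functions themselves need
  not satisfy the identity.\<close>

lemma g_rep:
  assumes v: "v \<in> sq M"
  shows "p (g n) v = (\<Sum>i\<le>n. p (g n) (f i) * p (f i) v)"
proof -
  have hn: "p (h n) v = p (g n) v - (\<Sum>i<n. p (g n) (f i) * p (f i) v)" if "v \<in> sq M" for v
    unfolding h_def by (rule posform_diff_sum[OF p g f_sq that])
  have "p (h n) v = p (g n) (f n) * p (f n) v"
  proof (cases "p (h n) (h n) = 0")
    case True
    then show ?thesis using posform_null(2)[of M p v "h n", OF p v h_sq True] v by (simp add: f_eq p_zero)
  next
    case False
    have "p (h n) (f n) = p (g n) (f n)"
      unfolding hn[OF f_sq] using f_orth' by simp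
    define q where "q = Re (p (h n) (h n))"
    have q: "p (h n) (h n) = complex_of_real q" "q \<ge> 0" unfolding q_def using posformD[OF p h_sq] by auto
    then have q0: "q > 0" using False by (cases "q = 0") auto
    have fn: "f n = (\<lambda>x. complex_of_real (1 / sqrt q) * h n x)" using False by (simp add: f_eq q_def)
    have 1: "p (h n) (f n) = complex_of_real ((1 / sqrt q) * q)"
      unfolding fn posform_lin(4)[OF p h_sq h_sq] q by simp
    have 2: "p (f n) v = complex_of_real (1 / sqrt q) * p (h n) v"
      unfolding fn posform_lin(2)[OF p h_sq v] ..
    have "p (g n) (f n) * p (f n) v = complex_of_real ((1 / sqrt q) * q * (1 / sqrt q)) * p (h n) v"
      unfolding 1[unfolded \<open>p (h n) (f n) = p (g n) (f n)\<close>] 2 of_real_mult by (simp only: mult.assoc)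
    also have "(1 / sqrt q) * q * (1 / sqrt q) = 1" using q0 by (simp add: field_simps)
    finally show ?thesis by simp
  qed
  then have "p (g n) v = (\<Sum>i<n. p (g n) (f i) * p (f i) v) + p (g n) (f n) * p (f n) v"
    using hn[OF v] by (metis diff_eq_eq add.commute)
  then show ?thesis by (simp add: lessThan_Suc_atMost[symmetric])
qed

text \<open>Turns the series for the image of \<open>g n\<close> into a finite sum.\<close>

lemma g_orth: "n < m \<Longrightarrow> p (g n) (f m) = 0"
  using g_rep[OF f_sq, of n m] f_orth' by simp

lemma f_bessel:
  assumes u: "u \<in> sq M"
  shows "(\<Sum>n<k. (cmod (p u (f n)))\<^sup>2) \<le> Re (p u u)"
proof -
  define s where "s x = (\<Sum>n<k. p u (f n) * f n x)" for x
  have s: "s \<in> sq M" unfolding s_def using f_sq by auto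
  have sv: "p s v = (\<Sum>n<k. p u (f n) * p (f n) v)" if "v \<in> sq M" for v
    unfolding s_def by (rule posform_sum[OF p that f_sq])
  have fsum: "p s (f i) = p u (f i)" if i: "i < k" for i
  proof -
    have "p s (f i) = (\<Sum>n<k. if n = i then p u (f i) * p (f i) (f i) else 0)"
      unfolding sv[OF f_sq] using f_orth' by (intro sum.cong) auto
    also have "\<dots> = p u (f i) * p (f i) (f i)" using i by simp
    also have "\<dots> = p u (f i)" using f_norm[of i] u by (cases "p (h i) (h i) = 0") (auto simp: f_eq[of i] p_zero)
    finally show ?thesis .
  qed
  have us: "p s u = complex_of_real (\<Sum>n<k. (cmod (p u (f n)))\<^sup>2)"
    unfolding sv[OF u] of_real_sum complex_norm_square using posform_sym[OF p u f_sq] by simp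
  have ss: "p s s = complex_of_real (\<Sum>n<k. (cmod (p u (f n)))\<^sup>2)"
  proof -
    have "p (f n) s = cnj (p u (f n))" if "n < k" for n using fsum[OF that] posform_sym[OF p s f_sq] by metis
    then show ?thesis unfolding sv[OF s] of_real_sum complex_norm_square by simp
  qed
  have "p u s = complex_of_real (\<Sum>n<k. (cmod (p u (f n)))\<^sup>2)"
    using us posform_sym[OF p s u] by (metis complex_cnj_complex_of_real)
  then have "0 \<le> Re (p u u) - (\<Sum>n<k. (cmod (p u (f n)))\<^sup>2)"
    using posformD(2)[OF p sq_diff[OF u sq_scale[OF s, of 1]]] posform_expand[OF p u s, of 1] ss by simp
  then show ?thesis by simp
qed

end

section \<open>Coordinates for trace class operators\<close>

lemma has_sum_finite_sum:
  fixes F :: "'i \<Rightarrow> 'e \<Rightarrow> 'c::topological_comm_monoid_add"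
  assumes "finite I" "\<And>i. i \<in> I \<Longrightarrow> (F i has_sum s i) E"
  shows "((\<lambda>e. \<Sum>i\<in>I. F i e) has_sum (\<Sum>i\<in>I. s i)) E"
  using assms
proof (induction I)
  case (insert i I)
  then have "((\<lambda>e. F i e + (\<Sum>i\<in>I. F i e)) has_sum (s i + (\<Sum>i\<in>I. s i))) E"
    by (intro has_sum_add) auto
  then show ?case using insert.hyps by simp
qed (simp add: has_sum_0)

text \<open>With \<open>p\<close> the form of the absolute value \<open>P\<close>, the sequences
  consist of \<open>P\<close> and \<open>A\<close> applied to the vectors \<open>f n\<close>. These
  have equal norms, and Bessel's inequality for \<open>p\<close> bounds the sum of the squared norms
  by the trace of \<open>P\<close>.\<close>

lemma trace_class_rep:
  fixes A :: "('b, 'a) oper" and N :: "'b measure" and M :: "'a measure"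
  assumes "trace_class N M A"
  obtains x y where "sq_seq M x" "sq_seq N y"
    "\<And>v w. v \<in> sq N \<Longrightarrow> w \<in> sq M \<Longrightarrow> (\<lambda>n. ip N v (y n) * ip M (x n) w) sums form N M A v w"
proof -
  obtain P E where A: "A \<in> bounded_ops N M" and P: "is_abs_op N M A P" and Eb: "orthonormal_basis N E"
    and sm: "(\<lambda>e. l2_inner N (P e) e) summable_on E"
    using assms by (auto simp: trace_class_def)
  have Pb: "P \<in> bounded_ops N N" and pos: "\<And>u. u \<in> L2 N \<Longrightarrow> l2_inner N (P u) u \<in> \<real>\<^sub>\<ge>\<^sub>0"
    using P by (auto simp: is_abs_op_def positive_op_def)
  have E: "onb N E l2_rep" using Eb by (rule orthonormal_basis_onb)
  have r: "l2_rep e \<in> sq N" if "e \<in> E" for e using onbD(1)[OF E that] .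
  have eL: "e \<in> L2 N" if "e \<in> E" for e using that Eb by (auto simp: orthonormal_basis_def)
  define p where "p = form N N P"
  obtain C where C: "bform N N C p" unfolding p_def using form_bform[OF Pb] .
  have pp: "posform N p"
    unfolding posform_def
  proof (intro conjI ballI)
    fix u assume u: "u \<in> sq N"
    have "p u u = l2_inner N (P (l2_class N u)) (l2_class N u)"
      unfolding p_def form_def app_def l2_inner_eq using ip_l2_class(2)[OF u, of "l2_rep (P (l2_class N u))"]
        app_sq[OF Pb u] by (simp add: app_def)
    then show "p u u \<in> \<real>\<^sub>\<ge>\<^sub>0" using pos u by simp
  qed (use C in blast)
  have nrmA: "nrm M (app N A u) = nrm N (app N P u)" if u: "u \<in> sq N" for u
  proof -
    have "l2_inner N (P (P (l2_class N u))) (l2_class N u) = l2_inner M (A (l2_class N u)) (A (l2_class N u))"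
      using P u by (simp add: is_abs_op_def)
    moreover have "l2_inner N (P (P (l2_class N u))) (l2_class N u) = p (app N P u) u"
    proof -
      have "l2_inner N (P (P (l2_class N u))) (l2_class N u) = ip N (app N P (app N P u)) (l2_rep (l2_class N u))"
        unfolding l2_inner_eq app_class[OF Pb u] by (simp add: app_def[of N P "app N P u"])
      also have "\<dots> = p (app N P u) u"
        unfolding p_def form_def by (rule ip_l2_class(2)[OF u app_sq[OF Pb app_sq[OF Pb u]]])
      finally show ?thesis .
    qed
    moreover have "p (app N P u) u = ip N (app N P u) (app N P u)"
      using posform_sym[OF pp u app_sq[OF Pb u]] by (simp add: p_def form_def cnj_ip)
    ultimately have "(nrm N (app N P u))\<^sup>2 = (nrm M (app N A u))\<^sup>2"
      by (metis app_def ip_self l2_inner_eq of_real_eq_iff)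
    then show ?thesis by (simp add: power2_eq_iff_nonneg)
  qed
  have pe: "l2_inner N (P e) e = p (l2_rep e) (l2_rep e)" if "e \<in> E" for e
    using eL[OF that] by (simp add: l2_inner_eq p_def form_def app_def l2_class_rep)
  have smp: "(\<lambda>e. p (l2_rep e) (l2_rep e)) summable_on E"
    using sm pe by (simp cong: summable_on_cong)
  have smr: "(\<lambda>e. Re (p (l2_rep e) (l2_rep e))) summable_on E"
    using summable_on_bounded_linear[OF bounded_linear_Re smp] .
  define \<tau> where "\<tau> = (\<Sum>\<^sub>\<infinity>e\<in>E. Re (p (l2_rep e) (l2_rep e)))"
  \<comment> \<open>The basis may be uncountable, but a summable family has countable support. The
    basis vectors left out are null for \<open>p\<close> and are annihilated by
    \<open>A\<close>.\<close>
  define E' where "E' = {e \<in> E. p (l2_rep e) (l2_rep e) \<noteq> 0}"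
  have "countable E'" unfolding E'_def using summable_countable_complex[OF smp] .
  define g where "g n = (if E' = {} then (\<lambda>x. 0) else l2_rep (from_nat_into E' n))" for n
  have g: "g n \<in> sq N" for n
    unfolding g_def using r from_nat_into[of E' n] by (auto simp: E'_def)
  have gE: "\<exists>n. l2_rep e = g n" if "e \<in> E'" for e
  proof -
    have "\<exists>n. from_nat_into E' n = e" using from_nat_into_surj[OF \<open>countable E'\<close>] that by simp
    then obtain n where n: "from_nat_into E' n = e" ..
    have "E' \<noteq> {}" using that by blast
    then have "g n = l2_rep e" unfolding g_def n[symmetric] by simp
    then show ?thesis by metis
  qed
  interpret gram N p g using pp g by unfold_locales
  define y where "y n = app N P (f n)" for n
  define x where "x n = app N A (f n)" for n
  have y: "y n \<in> sq N" and x: "x n \<in> sq M" for n unfolding x_def y_def using f_sq A Pb by auto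
  have xy: "nrm M (x n) = nrm N (y n)" for n unfolding x_def y_def using nrmA f_sq by simp
  have ipy: "ip N v (y n) = p v (f n)" if "v \<in> sq N" for v n
    using posform_sym[OF pp f_sq that] unfolding y_def p_def form_def by (simp add: cnj_ip)
  \<comment> \<open>Parseval turns each squared norm into a sum over the basis. After the exchange,
    the sum over \<open>n\<close> at one basis vector is at most the diagonal value of
    \<open>p\<close> there.\<close>
  have bd: "(\<Sum>n<k. (nrm N (y n))\<^sup>2) \<le> \<tau>" for k
  proof -
    have "(\<Sum>n<k. (nrm N (y n))\<^sup>2) = (\<Sum>n<k. \<Sum>\<^sub>\<infinity>e\<in>E. (cmod (ip N (y n) (l2_rep e)))\<^sup>2)"
      by (intro sum.cong refl parseval_norm[OF E y, symmetric])
    also have "\<dots> = (\<Sum>\<^sub>\<infinity>e\<in>E. \<Sum>n<k. (cmod (ip N (y n) (l2_rep e)))\<^sup>2)"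
      by (rule infsumI[symmetric], rule has_sum_finite_sum) (use bessel(1)[OF E y] in auto)
    also have "\<dots> \<le> \<tau>" unfolding \<tau>_def
    proof (rule infsum_mono)
      show "(\<lambda>e. \<Sum>n<k. (cmod (ip N (y n) (l2_rep e)))\<^sup>2) summable_on E"
        by (rule has_sum_imp_summable[OF has_sum_finite_sum], rule finite_lessThan, rule has_sum_infsum, rule bessel(1)[OF E y])
      fix e assume e: "e \<in> E"
      have "cmod (ip N (y n) (l2_rep e)) = cmod (p (l2_rep e) (f n))" for n
        using ipy[OF r[OF e]] cmod_ip_commute by metis
      then show "(\<Sum>n<k. (cmod (ip N (y n) (l2_rep e)))\<^sup>2) \<le> Re (p (l2_rep e) (l2_rep e))"
        using f_bessel[OF r[OF e], of k] by simp
    qed (rule smr)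
    finally show ?thesis .
  qed
  have "summable (\<lambda>n. (nrm N (y n))\<^sup>2)"
    by (rule bounded_imp_summable[where B = \<tau>]) (use bd[of "Suc _"] in \<open>simp_all add: lessThan_Suc_atMost\<close>)
  then have ysq: "sq_seq N y" and xsq: "sq_seq M x" using x y by (auto simp: sq_seq_def xy)
  obtain D where D: "bform N M D (form N M A)" using form_bform[OF A] .
  have "(\<lambda>n. ip N v (y n) * ip M (x n) w) sums form N M A v w" if v: "v \<in> sq N" and w: "w \<in> sq M" for v w
  proof -
    have le: "norm (ip N v (y n) * ip M (x n) w) \<le> (nrm N v * nrm M w) * (nrm M (x n) * nrm N (y n))"
      if v: "v \<in> sq N" for v n
    proof -
      have "norm (ip N v (y n) * ip M (x n) w) \<le> (nrm N v * nrm N (y n)) * (nrm M (x n) * nrm M w)"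
        unfolding norm_mult using v w x y by (intro mult_mono ip_bound) auto
      then show ?thesis by (simp add: mult_ac)
    qed
    have s0: "summable (\<lambda>n. nrm M (x n) * nrm N (y n))" by (rule sq_seq_mult_summable[OF xsq ysq])
    have ns: "summable (\<lambda>n. norm (ip N v (y n) * ip M (x n) w))" if v: "v \<in> sq N" for v
      by (rule summable_comparison_test'[OF summable_mult[OF s0, of "nrm N v * nrm M w"], of 0])
         (use le[OF v] in simp)
    have s: "summable (\<lambda>n. ip N v (y n) * ip M (x n) w)" if v: "v \<in> sq N" for v
      using ns[OF v] by (rule summable_norm_cancel)
    \<comment> \<open>The difference of both sides is a bounded functional of \<open>v\<close>, so
      it is enough that it vanishes on the basis.\<close>
    define \<phi> where "\<phi> v = form N M A v w - (\<Sum>n. ip N v (y n) * ip M (x n) w)" for v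
    define K where "K = D * nrm M w + nrm M w * (\<Sum>n. nrm M (x n) * nrm N (y n))"
    have "\<exists>z\<in>sq N. \<forall>v\<in>sq N. \<phi> v = ip N v z"
    proof (rule riesz_ex[where C = K])
      fix a b assume ab: "a \<in> sq N" "b \<in> sq N"
      show "\<phi> (\<lambda>x. a x + b x) = \<phi> a + \<phi> b"
        unfolding \<phi>_def bformD(2)[OF D ab w] ip_add_left[OF ab y] distrib_right
          suminf_add[OF s[OF ab(1)] s[OF ab(2)], symmetric] by simp
    next
      fix c a assume a: "a \<in> sq N"
      show "\<phi> (\<lambda>x. c * a x) = c * \<phi> a"
        unfolding \<phi>_def bformD(3)[OF D a w] ip_scale_left mult.assoc suminf_mult[OF s[OF a]] right_diff_distrib ..
    next
      fix a assume a: "a \<in> sq N"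
      have "cmod (\<Sum>n. ip N a (y n) * ip M (x n) w) \<le> (\<Sum>n. norm (ip N a (y n) * ip M (x n) w))"
        by (rule summable_norm[OF ns[OF a]])
      also have "\<dots> \<le> (\<Sum>n. (nrm N a * nrm M w) * (nrm M (x n) * nrm N (y n)))"
        by (intro suminf_le ns[OF a] summable_mult s0 le[OF a])
      also have "\<dots> = (nrm N a * nrm M w) * (\<Sum>n. nrm M (x n) * nrm N (y n))"
        by (rule suminf_mult[OF s0])
      finally have "cmod (\<phi> a) \<le> D * nrm N a * nrm M w + (nrm N a * nrm M w) * (\<Sum>n. nrm M (x n) * nrm N (y n))"
        unfolding \<phi>_def using bformD(6)[OF D a w]
          norm_triangle_ineq4[of "form N M A a w" "\<Sum>n. ip N a (y n) * ip M (x n) w"] by linarith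
      then show "cmod (\<phi> a) \<le> K * nrm N a" by (simp add: K_def algebra_simps)
    qed
    then obtain z where z: "z \<in> sq N" "\<And>v. v \<in> sq N \<Longrightarrow> \<phi> v = ip N v z" by blast
    have "\<phi> (l2_rep e) = 0" if e: "e \<in> E" for e
    proof (cases "e \<in> E'")
      case True
      then obtain n where n: "l2_rep e = g n" using gE by blast
      \<comment> \<open>The error of the finite expansion of \<open>g n\<close> is null for
        \<open>p\<close>, so \<open>P\<close>, and with it \<open>A\<close>, sends it to a null
        function.\<close>
      define d where "d x = g n x - (\<Sum>m\<le>n. p (g n) (f m) * f m x)" for x
      have d: "d \<in> sq N" unfolding d_def using g f_sq by (intro sq_diff sq_sum sq_scale) auto
      have pd: "p d v = 0" if "v \<in> sq N" for v
      proof -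
        have "p d v = p (g n) v - (\<Sum>m\<le>n. p (g n) (f m) * p (f m) v)"
          unfolding d_def by (rule posform_diff_sum[OF pp g f_sq that])
        then show ?thesis using g_rep[OF that, of n] by simp
      qed
      have "complex_of_real ((nrm N (app N P d))\<^sup>2) = p d (app N P d)"
        by (simp only: p_def form_def ip_self)
      also have "\<dots> = 0" using pd d Pb by simp
      finally have "nrm M (app N A d) = 0" using nrmA[OF d] by simp
      then have "form N M A d w = 0"
        using ip_bound[of "app N A d" M w] d A w by (simp add: form_def)
      moreover have "form N M A d w = form N M A (g n) w - (\<Sum>m\<le>n. p (g n) (f m) * ip M (x m) w)"
      proof -
        have "form N M A (\<lambda>x. \<Sum>m\<in>I. p (g n) (f m) * f m x) w = (\<Sum>m\<in>I. p (g n) (f m) * ip M (x m) w)"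
          if "finite I" for I
          using that
        proof (induction I)
          case empty
          then show ?case using bformD(3)[OF D, of "\<lambda>x. 0" w 0] w by simp
        next
          case (insert i I)
          have "form N M A (\<lambda>x. \<Sum>m\<in>insert i I. p (g n) (f m) * f m x) w
              = form N M A (\<lambda>x. p (g n) (f i) * f i x + (\<Sum>m\<in>I. p (g n) (f m) * f m x)) w"
            using insert.hyps by simp
          also have "\<dots> = p (g n) (f i) * form N M A (f i) w + (\<Sum>m\<in>I. p (g n) (f m) * ip M (x m) w)"
            using f_sq w by (subst bformD(2)[OF D]) (auto simp: bformD(3)[OF D f_sq w] insert.IH)
          finally show ?case using insert.hyps by (simp add: x_def form_def)
        qed
        then show ?thesis unfolding d_def using g f_sq w by (subst bform_diff(1)[OF D]) auto
      qed
      moreover have "(\<Sum>m. ip N (g n) (y m) * ip M (x m) w) = (\<Sum>m\<le>n. p (g n) (f m) * ip M (x m) w)"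
        unfolding ipy[OF g] by (rule suminf_finite) (use g_orth in auto)
      ultimately show ?thesis by (simp add: \<phi>_def n)
    next
      case False
      then have 0: "p (l2_rep e) (l2_rep e) = 0" using e by (simp add: E'_def)
      note e' = r[OF e]
      have pz: "p (l2_rep e) v = 0" if "v \<in> sq N" for v using posform_null(2)[of N p v "l2_rep e", OF pp that e' 0] .
      have "complex_of_real ((nrm N (app N P (l2_rep e)))\<^sup>2) = p (l2_rep e) (app N P (l2_rep e))"
        by (simp only: p_def form_def ip_self)
      also have "\<dots> = 0" using pz e' Pb by simp
      finally have "nrm M (app N A (l2_rep e)) = 0" using nrmA[OF e'] by simp
      then have "form N M A (l2_rep e) w = 0"
        using ip_bound[of "app N A (l2_rep e)" M w] e' A w by (simp add: form_def)
      then show ?thesis by (simp add: \<phi>_def ipy[OF e'] pz[OF f_sq])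
    qed
    then have "ip N z (l2_rep e) = 0" if "e \<in> E" for e using z that r by (metis cnj_ip complex_cnj_zero)
    then have "nrm N z = 0" using z by (intro onbD(3)[OF E]) auto
    then have "\<phi> v = 0" using z(2)[OF v] ip_bound[OF v z(1)] by simp
    then have "(\<Sum>n. ip N v (y n) * ip M (x n) w) = form N M A v w" by (simp add: \<phi>_def)
    then show ?thesis using summable_sums[OF s[OF v]] by simp
  qed
  then show thesis using that xsq ysq by blast
qed

theorem trace_class_vfun:
  fixes M :: "'a measure" and N :: "'b measure"
  assumes A: "trace_class N M A"
  obtains x y where "sq_seq M x" "sq_seq N y"
    "\<And>T. T \<in> bounded_ops M N \<Longrightarrow> op_trace N (compose (L2 N) T A) = vfun M N x y T"
proof -
  obtain x y where xy: "sq_seq M x" "sq_seq N y"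
    "\<And>v w. v \<in> sq N \<Longrightarrow> w \<in> sq M \<Longrightarrow> (\<lambda>n. ip N v (y n) * ip M (x n) w) sums form N M A v w"
    using trace_class_rep[OF A] by metis
  have "A \<in> bounded_ops N M" using A by (simp add: trace_class_def)
  then show thesis using that[OF xy(1,2)] op_trace_eq[OF _ _ xy] by blast
qed

lemma bform_rank_one:
  assumes x: "x \<in> sq M" and y: "y \<in> sq N"
  shows "bform N M (nrm N y * nrm M x) (\<lambda>v w. ip N v y * ip M x w)"
  unfolding bform_def
proof (intro conjI ballI allI)
  fix v w assume "v \<in> sq N" "w \<in> sq M"
  then have "cmod (ip N v y) * cmod (ip M x w) \<le> (nrm N v * nrm N y) * (nrm M x * nrm M w)"
    using x y by (intro mult_mono ip_bound) auto
  then show "cmod (ip N v y * ip M x w) \<le> nrm N y * nrm M x * nrm N v * nrm M w"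
    by (simp add: norm_mult mult_ac)
qed (use x y in \<open>auto simp: ip_add_left ip_add_right ip_scale_left ip_scale_right algebra_simps\<close>)

text \<open>Makes the functionals \<open>form M N T x y\<close> weak* continuous. The operator
  behind them sends \<open>v\<close> to \<open>ip N v y\<close> times \<open>x\<close>.\<close>

theorem rank_one_vfun:
  fixes M :: "'a measure" and N :: "'b measure"
  assumes x: "x \<in> sq M" and y: "y \<in> sq N"
  obtains A where "trace_class N M A"
    "\<And>T. T \<in> bounded_ops M N \<Longrightarrow> op_trace N (compose (L2 N) T A) = form M N T x y"
proof -
  note B = bform_rank_one[OF x y]
  obtain A where A: "A \<in> bounded_ops N M" "\<And>v w. v \<in> sq N \<Longrightarrow> w \<in> sq M \<Longrightarrow> form N M A v w = ip N v y * ip M x w"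
    using op_of_form[OF B] by blast
  \<comment> \<open>The absolute value is \<open>c\<close> times the rank one operator built from
    \<open>y\<close> alone, which requires \<open>(c * nrm N y)\<^sup>2 = (nrm M x)\<^sup>2\<close>.
    For null \<open>y\<close> the quotient is 0, and both operators vanish anyway.\<close>
  define c where "c = nrm M x / nrm N y"
  have c: "c \<ge> 0" by (simp add: c_def)
  note BP = bform_rank_one[OF y y]
  obtain P where P: "P \<in> bounded_ops N N"
    "\<And>v w. v \<in> sq N \<Longrightarrow> w \<in> sq N \<Longrightarrow> form N N P v w = complex_of_real c * (ip N v y * ip N y w)"
    using op_of_form[OF bform_scale[OF BP, of "complex_of_real c"]] by blast
  have inner: "l2_inner N (P u) v = form N N P (l2_rep u) (l2_rep v)" if "u \<in> L2 N" for u v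
    using that by (simp add: l2_inner_eq form_def app_def l2_class_rep)
  have real: "ip N u y * ip N y u = complex_of_real ((cmod (ip N u y))\<^sup>2)" for u
    by (simp only: complex_norm_square cnj_ip)
  have "positive_op N P"
    unfolding positive_op_def
  proof (intro conjI ballI)
    fix u assume u: "u \<in> L2 N"
    then have r: "l2_rep u \<in> sq N" using l2_rep_in by auto
    have "l2_inner N (P u) u = complex_of_real (c * (cmod (ip N (l2_rep u) y))\<^sup>2)"
      using P(2)[OF r r] u by (simp add: inner real)
    then show "l2_inner N (P u) u \<in> \<real>\<^sub>\<ge>\<^sub>0" using c by simp
  qed (rule P)
  moreover have "l2_inner N (P (P u)) v = l2_inner M (A u) (A v)" if u: "u \<in> L2 N" and v: "v \<in> L2 N" for u v
  proof -
    let ?u = "l2_rep u" and ?v = "l2_rep v"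
    have r: "?u \<in> sq N" "?v \<in> sq N" using u v l2_rep_in by auto
    have Pu: "P u \<in> L2 N" using bounded_opsD(1)[OF P(1) u] .
    have ap: "l2_rep (P u) = app N P ?u" "l2_rep (A u) = app N A ?u" "l2_rep (A v) = app N A ?v"
      using u v by (simp_all add: app_def l2_class_rep)
    have aps: "app N P ?u \<in> sq N" "app N A ?u \<in> sq M" "app N A ?v \<in> sq M" using r P A by auto
    have "l2_inner N (P (P u)) v = complex_of_real c * (ip N (app N P ?u) y * ip N y ?v)"
      using inner[OF Pu] P(2)[OF aps(1) r(2)] by (simp add: ap)
    also have "ip N (app N P ?u) y = complex_of_real c * (ip N ?u y * ip N y y)"
      using P(2)[OF r(1) y] by (simp add: form_def)
    also have "complex_of_real c * (complex_of_real c * (ip N ?u y * ip N y y) * ip N y ?v)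
      = ip N ?u y * ip N y ?v * complex_of_real ((c * nrm N y)\<^sup>2)"
      by (simp add: ip_self power2_eq_square mult_ac)
    also have "\<dots> = ip N ?u y * ip N y ?v * complex_of_real ((nrm M x)\<^sup>2)"
    proof (cases "nrm N y = 0")
      case True
      then have "ip N ?u y = 0" using ip_bound[OF r(1) y] by simp
      then show ?thesis by simp
    qed (simp add: c_def)
    also have "\<dots> = l2_inner M (A u) (A v)"
    proof -
      have "l2_inner M (A u) (A v) = ip N ?u y * ip M x (app N A ?v)"
        using A(2)[OF r(1) aps(3)] by (simp add: l2_inner_eq ap form_def)
      also have "ip M x (app N A ?v) = cnj (ip N ?v y * ip M x x)"
        using A(2)[OF r(2) x] by (metis cnj_ip form_def)
      finally show ?thesis by (simp add: cnj_ip ip_self)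
    qed
    finally show ?thesis .
  qed
  ultimately have abs: "is_abs_op N M A P" by (simp add: is_abs_op_def)
  obtain E where E: "orthonormal_basis N E" using orthonormal_basis_exists by blast
  note o = orthonormal_basis_onb[OF E]
  have "(\<lambda>e. complex_of_real (c * (cmod (ip N y (l2_rep e)))\<^sup>2)) summable_on E"
    by (intro summable_on_of_real summable_on_cmult_right bessel(1)[OF o y])
  moreover have "l2_inner N (P e) e = complex_of_real (c * (cmod (ip N y (l2_rep e)))\<^sup>2)" if "e \<in> E" for e
    using that E inner[of e e] P(2)[of "l2_rep e" "l2_rep e"] onbD(1)[OF o that] real[of "l2_rep e"]
    by (auto simp: orthonormal_basis_def cmod_ip_commute[of N y])
  ultimately have "(\<lambda>e. l2_inner N (P e) e) summable_on E" by (simp cong: summable_on_cong)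
  then have tc: "trace_class N M A" using A(1) abs E by (auto simp: trace_class_def)
  \<comment> \<open>Padding with zeros turns the single pair into sequences to which
    \<open>op_trace_eq\<close> applies.\<close>
  define xs where "xs n = (if n = 0 then x else (\<lambda>_. 0))" for n :: nat
  define ys where "ys n = (if n = 0 then y else (\<lambda>_. 0))" for n :: nat
  have "summable (\<lambda>n. (nrm M (xs n))\<^sup>2)" "summable (\<lambda>n. (nrm N (ys n))\<^sup>2)"
    by (rule summable_finite[of "{0}"]; simp add: xs_def ys_def)+
  then have sq: "sq_seq M xs" "sq_seq N ys" using x y by (auto simp: sq_seq_def xs_def ys_def)
  have fin: "(\<lambda>n. F (xs n) (ys n)) sums F x y" if "F (\<lambda>_. 0) (\<lambda>_. 0) = 0" for F :: "_ \<Rightarrow> _ \<Rightarrow> complex"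
    using sums_finite[of "{0::nat}" "\<lambda>n. F (xs n) (ys n)"] that by (simp add: xs_def ys_def)
  have "op_trace N (compose (L2 N) T A) = form M N T x y" if T: "T \<in> bounded_ops M N" for T
  proof -
    obtain K where K: "bform M N K (form M N T)" using form_bform[OF T] .
    have "op_trace N (compose (L2 N) T A) = vfun M N xs ys T"
    proof (rule op_trace_eq[OF A(1) T sq])
      fix v w assume "v \<in> sq N" "w \<in> sq M"
      then show "(\<lambda>n. ip N v (ys n) * ip M (xs n) w) sums form N M A v w"
        using fin[of "\<lambda>a b. ip N v b * ip M a w"] A(2) by simp
    qed
    also have "\<dots> = form M N T x y"
      unfolding vfun_def using fin[of "form M N T"] bformD(3)[OF K, of "\<lambda>_. 0" "\<lambda>_. 0" 0] by (simp add: sums_iff)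
    finally show ?thesis .
  qed
  with tc show thesis by (rule that)
qed

section \<open>The weak* topology and reflexive hulls\<close>

abbreviation trc :: "'a measure \<Rightarrow> 'b measure \<Rightarrow> ('b, 'a) oper \<Rightarrow> ('a, 'b) oper \<Rightarrow> complex" where
  "trc M N A T \<equiv> op_trace N (compose (L2 N) T A)"

abbreviation wcl :: "'a measure \<Rightarrow> 'b measure \<Rightarrow> ('a, 'b) oper set \<Rightarrow> ('a, 'b) oper set" where
  "wcl M N X \<equiv> weak_star_topology M N closure_of X"

lemma topspace_weak_star: "topspace (weak_star_topology M N) = bounded_ops M N"
proof -
  \<comment> \<open>The generating sets cover all bounded operators as soon as there is one trace
    class operator.\<close>
  obtain A where "trace_class N M A" using rank_one_vfun[OF sq_zero sq_zero] by metis
  then show ?thesis unfolding weak_star_topology_def topology_generated_by_topspace by blast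
qed

text \<open>One tolerance for a finite set of trace class operators is enough: for intersections of
  open sets the finite sets are united and the smaller tolerance is taken.\<close>

lemma weak_star_closure_iff:
  assumes X: "X \<subseteq> bounded_ops M N"
  shows "T \<in> wcl M N X \<longleftrightarrow> T \<in> bounded_ops M N \<and>
    (\<forall>\<A> e. finite \<A> \<and> (\<forall>A\<in>\<A>. trace_class N M A) \<and> e > 0 \<longrightarrow>
      (\<exists>S\<in>X. \<forall>A\<in>\<A>. cmod (trc M N A S - trc M N A T) < e))" (is "_ \<longleftrightarrow> ?R")
proof
  assume T: "T \<in> wcl M N X"
  then have Tb: "T \<in> bounded_ops M N"
    using closure_of_subset_topspace[of "weak_star_topology M N" X] by (auto simp: topspace_weak_star)
  have "\<exists>S\<in>X. \<forall>A\<in>\<A>. cmod (trc M N A S - trc M N A T) < e"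
    if "finite \<A>" "\<forall>A\<in>\<A>. trace_class N M A" "e > 0" for \<A> e
  proof -
    have "openin (weak_star_topology M N) {S \<in> bounded_ops M N. \<forall>A\<in>\<A>. cmod (trc M N A S - trc M N A T) < e}"
      using that(1,2)
    proof (induction \<A>)
      case empty
      then show ?case using openin_topspace[of "weak_star_topology M N"] by (simp add: topspace_weak_star)
    next
      case (insert A \<A>)
      have "{S \<in> bounded_ops M N. trc M N A S \<in> ball (trc M N A T) e} \<in>
          {{T \<in> bounded_ops M N. trc M N A T \<in> G} | A G. trace_class N M A \<and> open G}"
        using insert.prems by blast
      then have "openin (weak_star_topology M N) {S \<in> bounded_ops M N. trc M N A S \<in> ball (trc M N A T) e}"
        unfolding weak_star_topology_def by (rule topology_generated_by_Basis)
      then have "openin (weak_star_topology M N) ({S \<in> bounded_ops M N. trc M N A S \<in> ball (trc M N A T) e}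
        \<inter> {S \<in> bounded_ops M N. \<forall>A\<in>\<A>. cmod (trc M N A S - trc M N A T) < e})"
        using insert by (intro openin_Int) auto
      moreover have "{S \<in> bounded_ops M N. trc M N A S \<in> ball (trc M N A T) e}
        \<inter> {S \<in> bounded_ops M N. \<forall>A\<in>\<A>. cmod (trc M N A S - trc M N A T) < e}
        = {S \<in> bounded_ops M N. \<forall>A\<in>insert A \<A>. cmod (trc M N A S - trc M N A T) < e}"
        by (auto simp: dist_norm norm_minus_commute)
      ultimately show ?case by simp
    qed
    note o = this
    have "T \<in> {S \<in> bounded_ops M N. \<forall>A\<in>\<A>. cmod (trc M N A S - trc M N A T) < e}"
      using Tb \<open>e > 0\<close> by simp
    moreover have "\<forall>U. T \<in> U \<and> openin (weak_star_topology M N) U \<longrightarrow> (\<exists>y. y \<in> X \<and> y \<in> U)"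
      using T by (simp add: in_closure_of)
    ultimately have "\<exists>y. y \<in> X \<and> y \<in> {S \<in> bounded_ops M N. \<forall>A\<in>\<A>. cmod (trc M N A S - trc M N A T) < e}"
      using o by (metis (lifting))
    then show ?thesis by blast
  qed
  with Tb show ?R by blast
next
  assume R: ?R
  \<comment> \<open>By induction over the generation of the topology, every open set contains a
    basic neighbourhood of each of its points.\<close>
  have nb: "\<forall>T\<in>U. \<exists>\<A> e. finite \<A> \<and> (\<forall>A\<in>\<A>. trace_class N M A) \<and> e > 0 \<and>
      (\<forall>S\<in>bounded_ops M N. (\<forall>A\<in>\<A>. cmod (trc M N A S - trc M N A T) < e) \<longrightarrow> S \<in> U)"
    if "openin (weak_star_topology M N) U" for U
    using that unfolding weak_star_topology_def openin_topology_generated_by_iff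
  proof (induction rule: generate_topology_on.induct)
    case (Int a b)
    show ?case
    proof
      fix T assume "T \<in> a \<inter> b"
      then obtain \<A> e \<B> d where *: "finite \<A>" "\<forall>A\<in>\<A>. trace_class N M A" "e > 0"
        "\<forall>S\<in>bounded_ops M N. (\<forall>A\<in>\<A>. cmod (trc M N A S - trc M N A T) < e) \<longrightarrow> S \<in> a"
        "finite \<B>" "\<forall>A\<in>\<B>. trace_class N M A" "d > 0"
        "\<forall>S\<in>bounded_ops M N. (\<forall>A\<in>\<B>. cmod (trc M N A S - trc M N A T) < d) \<longrightarrow> S \<in> b"
        using Int.IH[THEN bspec, of T] by (elim IntE) (metis (no_types, lifting))
      show "\<exists>\<A> e. finite \<A> \<and> (\<forall>A\<in>\<A>. trace_class N M A) \<and> e > 0 \<and>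
          (\<forall>S\<in>bounded_ops M N. (\<forall>A\<in>\<A>. cmod (trc M N A S - trc M N A T) < e) \<longrightarrow> S \<in> a \<inter> b)"
        using * by (intro exI[of _ "\<A> \<union> \<B>"] exI[of _ "min e d"]) auto
    qed
  next
    case (UN K)
    show ?case
    proof
      fix T assume "T \<in> \<Union>K"
      then obtain k where k: "k \<in> K" "T \<in> k" by blast
      then obtain \<A> e where *: "finite \<A>" "\<forall>A\<in>\<A>. trace_class N M A" "e > 0"
        "\<forall>S\<in>bounded_ops M N. (\<forall>A\<in>\<A>. cmod (trc M N A S - trc M N A T) < e) \<longrightarrow> S \<in> k"
        using UN.IH by metis
      then show "\<exists>\<A> e. finite \<A> \<and> (\<forall>A\<in>\<A>. trace_class N M A) \<and> e > 0 \<and>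
          (\<forall>S\<in>bounded_ops M N. (\<forall>A\<in>\<A>. cmod (trc M N A S - trc M N A T) < e) \<longrightarrow> S \<in> \<Union>K)"
        using k by (intro exI[of _ \<A>] exI[of _ e]) blast
    qed
  next
    case (Basis s)
    then obtain A G where s: "s = {T \<in> bounded_ops M N. trc M N A T \<in> G}" "trace_class N M A" "open G" by blast
    show ?case
    proof
      fix T assume "T \<in> s"
      then obtain e where e: "e > 0" "ball (trc M N A T) e \<subseteq> G" using s open_contains_ball by blast
      show "\<exists>\<A> e. finite \<A> \<and> (\<forall>A\<in>\<A>. trace_class N M A) \<and> e > 0 \<and>
          (\<forall>S\<in>bounded_ops M N. (\<forall>A\<in>\<A>. cmod (trc M N A S - trc M N A T) < e) \<longrightarrow> S \<in> s)"
        using e s by (intro exI[of _ "{A}"] exI[of _ e]) (auto simp: subset_iff dist_norm norm_minus_commute)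
    qed
  qed simp
  show "T \<in> wcl M N X"
    unfolding in_closure_of topspace_weak_star
  proof (intro conjI allI impI)
    fix U assume U: "T \<in> U \<and> openin (weak_star_topology M N) U"
    then obtain \<A> e where *: "finite \<A>" "\<forall>A\<in>\<A>. trace_class N M A" "e > 0"
        "\<forall>S\<in>bounded_ops M N. (\<forall>A\<in>\<A>. cmod (trc M N A S - trc M N A T) < e) \<longrightarrow> S \<in> U"
      using nb by metis
    then obtain S where "S \<in> X" "\<forall>A\<in>\<A>. cmod (trc M N A S - trc M N A T) < e" using R by blast
    then show "\<exists>y. y \<in> X \<and> y \<in> U" using * X by blast
  qed (use R in blast)
qed

lemma wcl_bounded: "wcl M N X \<subseteq> bounded_ops M N"
  using closure_of_subset_topspace[of "weak_star_topology M N" X] by (simp add: topspace_weak_star)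

lemma wcl_subset: "X \<subseteq> bounded_ops M N \<Longrightarrow> X \<subseteq> wcl M N X"
  by (rule closure_of_subset) (simp add: topspace_weak_star)

section \<open>Limits, translates and annihilators in weak* closures\<close>

lemma trc_add:
  assumes "trace_class N M A" "S \<in> bounded_ops M N" "T \<in> bounded_ops M N"
  shows "trc M N A (op_add M N S T) = trc M N A S + trc M N A T"
    and "trc M N A (op_scale M N c S) = c * trc M N A S"
proof -
  obtain x y where x: "sq_seq M x" and y: "sq_seq N y"
    and tr: "\<And>T. T \<in> bounded_ops M N \<Longrightarrow> trc M N A T = vfun M N x y T"
    using trace_class_vfun[OF assms(1)] by metis
  have s: "summable (\<lambda>n. form M N T (x n) (y n))" if T: "T \<in> bounded_ops M N" for T
  proof -
    obtain C where C: "bform M N C (form M N T)" using form_bform[OF T] .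
    show ?thesis using form_seq_summable[OF C x y] by (rule summable_norm_cancel)
  qed
  note xy = sq_seqD(1)[OF x] sq_seqD(1)[OF y]
  show "trc M N A (op_add M N S T) = trc M N A S + trc M N A T"
    using assms by (simp add: tr op_add_form vfun_def xy suminf_add[symmetric] s)
  show "trc M N A (op_scale M N c S) = c * trc M N A S"
    using assms by (simp add: tr op_scale_form vfun_def xy suminf_mult s)
qed

text \<open>For norm bounded nets convergence of the forms is enough: the bound dominates the series
  of each trace functional, and Tannery's theorem takes the limit inside.\<close>

lemma wcl_limit:
  fixes F :: "'i filter"
  assumes X: "X \<subseteq> bounded_ops M N" and T: "T \<in> bounded_ops M N" and F: "F \<noteq> bot"
    and S: "\<And>i. S i \<in> X" and bd: "\<And>i. bform M N C (form M N (S i))"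
    and lim: "\<And>f g. f \<in> sq M \<Longrightarrow> g \<in> sq N \<Longrightarrow> ((\<lambda>i. form M N (S i) f g) \<longlongrightarrow> form M N T f g) F"
  shows "T \<in> wcl M N X"
proof -
  have tl: "((\<lambda>i. trc M N A (S i)) \<longlongrightarrow> trc M N A T) F" if A: "trace_class N M A" for A
  proof -
    obtain x y where x: "sq_seq M x" and y: "sq_seq N y"
      and tr: "\<And>T. T \<in> bounded_ops M N \<Longrightarrow> trc M N A T = vfun M N x y T"
      using trace_class_vfun[OF A] by metis
    have "((\<lambda>i. \<Sum>n. form M N (S i) (x n) (y n)) \<longlongrightarrow> (\<Sum>n. form M N T (x n) (y n))) F"
    proof (rule tannerys_theorem[THEN conjunct2, THEN conjunct2])
      show "((\<lambda>i. form M N (S i) (x n) (y n)) \<longlongrightarrow> form M N T (x n) (y n)) F" for n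
        using lim sq_seqD(1)[OF x] sq_seqD(1)[OF y] by blast
      show "summable (\<lambda>n. C * (nrm M (x n) * nrm N (y n)))"
        using sq_seq_mult_summable[OF x y] by (rule summable_mult)
      have "norm (form M N (S i) (x n) (y n)) \<le> C * (nrm M (x n) * nrm N (y n))" for i n
        using bformD(6)[OF bd[of i] sq_seqD(1)[OF x] sq_seqD(1)[OF y]] by (simp add: mult.assoc)
      then show "\<forall>\<^sub>F (n, i) in sequentially \<times>\<^sub>F F. norm (form M N (S i) (x n) (y n)) \<le> C * (nrm M (x n) * nrm N (y n))"
        by (intro always_eventually) auto
    qed (rule F)
    moreover have "S i \<in> bounded_ops M N" for i using S X by blast
    ultimately show ?thesis using T by (simp add: tr vfun_def)
  qed
  show ?thesis
    unfolding weak_star_closure_iff[OF X]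
  proof (intro conjI allI impI, rule T, elim conjE)
    fix \<A> and e :: real
    assume a: "finite \<A>" "\<forall>A\<in>\<A>. trace_class N M A" "0 < e"
    have "\<forall>\<^sub>F i in F. \<forall>A\<in>\<A>. cmod (trc M N A (S i) - trc M N A T) < e"
    proof (rule eventually_ball_finite[OF a(1)], rule ballI)
      fix A assume "A \<in> \<A>"
      then have "((\<lambda>i. trc M N A (S i)) \<longlongrightarrow> trc M N A T) F" using tl a by blast
      then have "\<forall>\<^sub>F i in F. dist (trc M N A (S i)) (trc M N A T) < e" using a(3) by (rule tendstoD)
      then show "\<forall>\<^sub>F i in F. cmod (trc M N A (S i) - trc M N A T) < e" by (simp add: dist_norm)
    qed
    from eventually_happens[OF this] F
    obtain i where "\<forall>A\<in>\<A>. cmod (trc M N A (S i) - trc M N A T) < e" by blast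
    then show "\<exists>S\<in>X. \<forall>A\<in>\<A>. cmod (trc M N A S - trc M N A T) < e" using S by blast
  qed
qed

text \<open>Translation is weak* continuous. With \<open>U\<close> an element of \<U> this lets a
  closure absorb the first summand.\<close>

lemma wcl_translate:
  assumes Y: "Y \<subseteq> bounded_ops M N" and U: "U \<in> bounded_ops M N"
    and UY: "\<And>S. S \<in> Y \<Longrightarrow> op_add M N U S \<in> Y" and T: "T \<in> wcl M N Y"
  shows "op_add M N U T \<in> wcl M N Y"
  unfolding weak_star_closure_iff[OF Y]
proof (intro conjI allI impI)
  have Tb: "T \<in> bounded_ops M N" using T wcl_bounded by blast
  show "op_add M N U T \<in> bounded_ops M N" using U Tb by (rule op_add_form)
  fix \<A> and e :: real assume a: "finite \<A> \<and> (\<forall>A\<in>\<A>. trace_class N M A) \<and> 0 < e"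
  then obtain S where S: "S \<in> Y" "\<forall>A\<in>\<A>. cmod (trc M N A S - trc M N A T) < e"
    using T unfolding weak_star_closure_iff[OF Y] by blast
  have "S \<in> bounded_ops M N" using S Y by blast
  then have "\<forall>A\<in>\<A>. cmod (trc M N A (op_add M N U S) - trc M N A (op_add M N U T)) < e"
    using S a U Tb by (simp add: trc_add)
  then show "\<exists>S\<in>Y. \<forall>A\<in>\<A>. cmod (trc M N A S - trc M N A (op_add M N U T)) < e"
    using UY S(1) by blast
qed

text \<open>Rank one functionals are weak* continuous, so their zero sets are closed.\<close>

lemma wcl_annihilator:
  assumes X: "X \<subseteq> bounded_ops M N" and T: "T \<in> wcl M N X" and f: "f \<in> sq M" and g: "g \<in> sq N"
    and z: "\<And>S. S \<in> X \<Longrightarrow> form M N S f g = 0"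
  shows "form M N T f g = 0"
proof (rule ccontr)
  assume n: "form M N T f g \<noteq> 0"
  obtain A where A: "trace_class N M A" "\<And>T. T \<in> bounded_ops M N \<Longrightarrow> trc M N A T = form M N T f g"
    using rank_one_vfun[OF f g] by metis
  have "finite {A} \<and> (\<forall>A\<in>{A}. trace_class N M A) \<and> cmod (form M N T f g) > 0" using A n by simp
  then obtain S where S: "S \<in> X" "\<forall>A\<in>{A}. cmod (trc M N A S - trc M N A T) < cmod (form M N T f g)"
    using T unfolding weak_star_closure_iff[OF X] by blast
  have "S \<in> bounded_ops M N" "T \<in> bounded_ops M N" using S(1) X T wcl_bounded[of M N X] by auto
  then show False using S(2) by (simp add: A(2) z[OF S(1)])
qed

section \<open>Separation by trace functionals\<close>

lemma sums_interleave:
  fixes f g :: "nat \<Rightarrow> complex"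
  assumes "f sums a" "g sums b"
  shows "(\<lambda>n. if even n then f (n div 2) else g ((n - 1) div 2)) sums (a + b)"
proof -
  have "(\<lambda>n. if even n then Re (f (n div 2)) else Re (g ((n - 1) div 2))) sums (Re b + Re a)"
    "(\<lambda>n. if even n then Im (f (n div 2)) else Im (g ((n - 1) div 2))) sums (Im b + Im a)"
    using assms by (auto intro!: sums_if simp: sums_complex_iff)
  then show ?thesis unfolding sums_complex_iff
    by (simp add: if_distrib[of Re] if_distrib[of Im] add.commute cong: if_cong)
qed

lemma sq_seq_interleave:
  assumes "sq_seq M x" "sq_seq M x'"
  shows "sq_seq M (\<lambda>n. if even n then x (n div 2) else x' ((n - 1) div 2))"
proof -
  have "(\<lambda>n. if even n then (nrm M (x (n div 2)))\<^sup>2 else (nrm M (x' ((n - 1) div 2)))\<^sup>2) sums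
    ((\<Sum>n. (nrm M (x' n))\<^sup>2) + (\<Sum>n. (nrm M (x n))\<^sup>2))"
    using assms by (intro sums_if summable_sums sq_seqD)
  moreover have "(\<lambda>n. (nrm M (if even n then x (n div 2) else x' ((n - 1) div 2)))\<^sup>2) =
    (\<lambda>n. if even n then (nrm M (x (n div 2)))\<^sup>2 else (nrm M (x' ((n - 1) div 2)))\<^sup>2)" by auto
  ultimately show ?thesis using assms by (auto simp: sq_seq_def sums_iff)
qed

lemma vfun_sums:
  assumes "T \<in> bounded_ops M N" "sq_seq M x" "sq_seq N y"
  shows "(\<lambda>n. form M N T (x n) (y n)) sums vfun M N x y T"
proof -
  obtain C where C: "bform M N C (form M N T)" using form_bform[OF assms(1)] .
  show ?thesis unfolding vfun_def
    by (rule summable_sums[OF summable_norm_cancel[OF form_seq_summable[OF C assms(2,3)]]])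
qed

text \<open>Coefficients go into the first sequence, and functionals are added by interleaving their
  sequences.\<close>

lemma trace_combination:
  assumes "finite \<A>" "\<forall>A\<in>\<A>. trace_class N M A"
  shows "\<exists>x y. sq_seq M x \<and> sq_seq N y \<and>
    (\<forall>T\<in>bounded_ops M N. vfun M N x y T = (\<Sum>A\<in>\<A>. c A * trc M N A T))"
  using assms
proof (induction \<A>)
  case empty
  have "vfun M N (\<lambda>_ _. 0) (\<lambda>_ _. 0) T = 0" if T: "T \<in> bounded_ops M N" for T
  proof -
    obtain C where C: "bform M N C (form M N T)" using form_bform[OF T] .
    have "form M N T (\<lambda>_. 0) (\<lambda>_. 0) = 0" using bformD(3)[OF C, of "\<lambda>_. 0" "\<lambda>_. 0" 0] by simp
    then show ?thesis by (simp add: vfun_def)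
  qed
  then have h: "sq_seq M (\<lambda>_ _. 0) \<and> sq_seq N (\<lambda>_ _. 0) \<and>
    (\<forall>T\<in>bounded_ops M N. vfun M N (\<lambda>_ _. 0) (\<lambda>_ _. 0) T = (\<Sum>A\<in>{}. c A * trc M N A T))"
    by (simp add: sq_seq_def)
  show ?case by (rule exI, rule exI, rule h)
next
  case (insert A \<A>)
  then obtain x y where xy: "sq_seq M x" "sq_seq N y"
    "\<And>T. T \<in> bounded_ops M N \<Longrightarrow> vfun M N x y T = (\<Sum>A\<in>\<A>. c A * trc M N A T)" by auto
  obtain a b where ab: "sq_seq M a" "sq_seq N b"
    "\<And>T. T \<in> bounded_ops M N \<Longrightarrow> trc M N A T = vfun M N a b T"
    using trace_class_vfun[of N M A] insert.prems by auto
  define a' where "a' n = (\<lambda>t. c A * a n t)" for n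
  have a': "sq_seq M a'"
    using ab(1) unfolding sq_seq_def a'_def by (auto simp: nrm_scale power_mult_distrib intro: summable_mult)
  let ?x = "\<lambda>n. if even n then a' (n div 2) else x ((n - 1) div 2)"
  let ?y = "\<lambda>n. if even n then b (n div 2) else y ((n - 1) div 2)"
  have "vfun M N ?x ?y T = (\<Sum>A\<in>insert A \<A>. c A * trc M N A T)" if T: "T \<in> bounded_ops M N" for T
  proof -
    obtain C where C: "bform M N C (form M N T)" using form_bform[OF T] .
    have "(\<lambda>n. c A * form M N T (a n) (b n)) sums (c A * vfun M N a b T)"
      by (intro sums_mult vfun_sums T ab)
    moreover have "form M N T (a' n) (b n) = c A * form M N T (a n) (b n)" for n
      unfolding a'_def by (rule bformD(3)[OF C sq_seqD(1)[OF ab(1)] sq_seqD(1)[OF ab(2)]])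
    ultimately have "(\<lambda>n. form M N T (a' n) (b n)) sums (c A * vfun M N a b T)" by simp
    from sums_interleave[OF this vfun_sums[OF T xy(1,2)]]
    have "(\<lambda>n. if even n then form M N T (a' (n div 2)) (b (n div 2))
        else form M N T (x ((n - 1) div 2)) (y ((n - 1) div 2))) sums (c A * vfun M N a b T + vfun M N x y T)" .
    moreover have "(\<lambda>n. if even n then form M N T (a' (n div 2)) (b (n div 2))
        else form M N T (x ((n - 1) div 2)) (y ((n - 1) div 2))) = (\<lambda>n. form M N T (?x n) (?y n))" by auto
    ultimately have "vfun M N ?x ?y T = c A * vfun M N a b T + vfun M N x y T"
      unfolding vfun_def by (simp add: sums_iff)
    then show ?thesis using insert.hyps T by (simp add: ab xy)
  qed
  then have h: "sq_seq M ?x \<and> sq_seq N ?y \<and>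
    (\<forall>T\<in>bounded_ops M N. vfun M N ?x ?y T = (\<Sum>A\<in>insert A \<A>. c A * trc M N A T))"
    using sq_seq_interleave[OF a' xy(1)] sq_seq_interleave[OF ab(2) xy(2)] by (intro conjI ballI)
  show ?case by (rule exI, rule exI, rule h)
qed

lemma op_subspaceD:
  assumes "op_subspace M N X"
  shows "X \<subseteq> bounded_ops M N" "op_zero M N \<in> X" "S \<in> X \<Longrightarrow> T \<in> X \<Longrightarrow> op_add M N S T \<in> X"
    "T \<in> X \<Longrightarrow> op_scale M N c T \<in> X"
  using assms by (auto simp: op_subspace_def)

text \<open>Separation takes place in finite dimensions: the finitely many traces of a basic
  neighbourhood send \<open>X\<close> to a subspace that keeps its distance from the image of
  \<open>T\<close>, and the component of that image orthogonal to the subspace provides the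
  coefficients of the functional.\<close>

theorem wcl_separation:
  assumes X: "op_subspace M N X" and T: "T \<in> bounded_ops M N" and nT: "T \<notin> wcl M N X"
  obtains x y where "sq_seq M x" "sq_seq N y" "\<And>S. S \<in> X \<Longrightarrow> vfun M N x y S = 0" "vfun M N x y T \<noteq> 0"
proof -
  note Xb = op_subspaceD(1)[OF X]
  obtain \<A> e where A: "finite \<A>" "\<forall>A\<in>\<A>. trace_class N M A" "e > 0"
    and far: "\<And>S. S \<in> X \<Longrightarrow> \<exists>A\<in>\<A>. cmod (trc M N A S - trc M N A T) \<ge> e"
    using nT T unfolding weak_star_closure_iff[OF Xb] by (auto simp: not_less)
  \<comment> \<open>The finite dimensional space is \<open>L2\<close> of a counting measure, so that
    \<open>projection\<close> applies to it.\<close>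
  let ?M = "count_space \<A>"
  have all_sq: "f \<in> sq ?M" for f :: "_ \<Rightarrow> complex"
    unfolding square_integrable_def using A(1) by (auto intro: integrable_count_space)
  have ipc: "ip ?M f g = (\<Sum>A\<in>\<A>. f A * cnj (g A))" for f g :: "_ \<Rightarrow> complex"
    unfolding ip_def using A(1) by (rule lebesgue_integral_count_space_finite)
  have nc: "cmod (f A) \<le> nrm ?M f" if "A \<in> \<A>" for f :: "_ \<Rightarrow> complex" and A
  proof (rule power2_le_imp_le)
    have "(cmod (f A))\<^sup>2 \<le> (\<Sum>A\<in>\<A>. (cmod (f A))\<^sup>2)"
      using A(1) that by (intro member_le_sum) auto
    also have "\<dots> = (nrm ?M f)\<^sup>2" unfolding nrm_sq using A(1) by (rule lebesgue_integral_count_space_finite[symmetric])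
    finally show "(cmod (f A))\<^sup>2 \<le> (nrm ?M f)\<^sup>2" .
  qed simp
  define v where "v S A = (if A \<in> \<A> then trc M N A S else 0)" for S A
  have vadd: "v (op_add M N S S') = (\<lambda>A. v S A + v S' A)" "v (op_scale M N c S) = (\<lambda>A. c * v S A)"
    if "S \<in> bounded_ops M N" "S' \<in> bounded_ops M N" for S S' c
    using that A(2) by (auto simp: v_def fun_eq_iff trc_add)
  have K: "subsp ?M (v ` X)"
    unfolding subsp_def
  proof (intro conjI ballI allI)
    show "v ` X \<subseteq> sq ?M" using all_sq by blast
    have "v (op_scale M N 0 (op_zero M N)) = (\<lambda>x. 0)" using vadd(2)[OF op_zero_form(1) op_zero_form(1), of 0] by simp
    then show "(\<lambda>x. 0) \<in> v ` X" using op_subspaceD[OF X] by (metis image_eqI)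
    fix f assume "f \<in> v ` X"
    then obtain S where S: "S \<in> X" "f = v S" by blast
    have Sb: "S \<in> bounded_ops M N" using S Xb by blast
    show "(\<lambda>x. c * f x) \<in> v ` X" for c
      unfolding S(2) vadd(2)[OF Sb Sb, symmetric] by (rule imageI[OF op_subspaceD(4)[OF X S(1)]])
    fix g assume "g \<in> v ` X"
    then obtain S' where S': "S' \<in> X" "g = v S'" by blast
    have Sb': "S' \<in> bounded_ops M N" by (rule subsetD[OF Xb S'(1)])
    show "(\<lambda>x. f x + g x) \<in> v ` X"
      unfolding S(2) S'(2) vadd(1)[OF Sb Sb', symmetric] by (rule imageI[OF op_subspaceD(3)[OF X S(1) S'(1)]])
  qed
  obtain p where p: "\<And>k. k \<in> v ` X \<Longrightarrow> ip ?M (\<lambda>A. v T A - p A) k = 0"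
    "\<And>e. e > 0 \<Longrightarrow> \<exists>k\<in>v ` X. nrm ?M (\<lambda>A. p A - k A) < e" by (rule projection[OF K all_sq[of "v T"]]) blast
  define d where "d A = v T A - p A" for A
  have pd: "\<And>k. k \<in> v ` X \<Longrightarrow> ip ?M d k = 0" using p(1) unfolding d_def .
  have d0: "nrm ?M d \<noteq> 0"
  proof
    assume z: "nrm ?M d = 0"
    obtain S where S: "S \<in> X" "nrm ?M (\<lambda>A. p A - v S A) < e" using p(2)[OF A(3)] by blast
    obtain A where A': "A \<in> \<A>" "cmod (trc M N A S - trc M N A T) \<ge> e" using far[OF S(1)] by blast
    have "cmod (trc M N A S - trc M N A T) = cmod (v T A - v S A)" using A' by (simp add: v_def norm_minus_commute)
    also have "\<dots> \<le> nrm ?M (\<lambda>A. v T A - v S A)" by (rule nc[OF A'(1)])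
    also have "\<dots> \<le> nrm ?M (\<lambda>A. v T A - p A) + nrm ?M (\<lambda>A. p A - v S A)"
      by (rule nrm_triangle_diff[OF all_sq all_sq all_sq])
    also have "\<dots> < e" using z S by (simp add: d_def[abs_def])
    finally show False using A' by simp
  qed
  have kd: "ip ?M k d = 0" if "k \<in> v ` X" for k using pd[OF that] by (metis cnj_ip complex_cnj_zero)
  have "ip ?M p d = 0"
    by (rule limit_zero_ip[OF all_sq all_sq]) (use p(2) kd all_sq in blast)
  moreover have "ip ?M d d = ip ?M (v T) d - ip ?M p d"
    unfolding d_def[abs_def] by (rule ip_diff_left[OF all_sq all_sq all_sq])
  moreover have "ip ?M d d \<noteq> 0" using d0 by (simp add: ip_self)
  ultimately have Td: "ip ?M (v T) d \<noteq> 0" by simp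
  have vd: "ip ?M (v S) d = (\<Sum>A\<in>\<A>. cnj (d A) * trc M N A S)" for S
    unfolding ipc v_def by (intro sum.cong) (auto simp: mult.commute)
  obtain x y where xy: "sq_seq M x" "sq_seq N y"
    "\<forall>T\<in>bounded_ops M N. vfun M N x y T = (\<Sum>A\<in>\<A>. cnj (d A) * trc M N A T)"
    using trace_combination[OF A(1,2), of "\<lambda>A. cnj (d A)"] by blast
  have vv: "vfun M N x y S = ip ?M (v S) d" if "S \<in> bounded_ops M N" for S using xy(3) that vd by simp
  show thesis
  proof (rule that[OF xy(1,2)])
    show "vfun M N x y S = 0" if S: "S \<in> X" for S
    proof -
      have "S \<in> bounded_ops M N" using S Xb by blast
      then show ?thesis using vv kd[OF imageI[OF S]] by simp
    qed
    show "vfun M N x y T \<noteq> 0" using vv[OF T] Td by simp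
  qed
qed

section \<open>Reflexive hulls through rank one functionals\<close>

lemma reflexive_hull_annihilator:
  assumes X: "X \<subseteq> bounded_ops M N" and T: "T \<in> reflexive_hull M N X" and f: "f \<in> sq M" and g: "g \<in> sq N"
    and z: "\<And>S. S \<in> X \<Longrightarrow> form M N S f g = 0"
  shows "form M N T f g = 0"
proof -
  interpret Metric_space "L2 N" "l2_dist N" by (rule Metric_space_L2)
  have Tb: "T \<in> bounded_ops M N" using T by (simp add: reflexive_hull_def)
  have cl: "T (l2_class M f) \<in> mtopology closure_of ((\<lambda>S. S (l2_class M f)) ` X)"
    using T f unfolding reflexive_hull_def l2_topology_def by blast
  show ?thesis
    unfolding form_def
  proof (rule limit_zero_ip)
    show "app M T f \<in> sq N" using Tb f by simp
    show "g \<in> sq N" by (rule g)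
    fix e :: real assume "e > 0"
    then obtain S where S: "S \<in> X" "l2_dist N (T (l2_class M f)) (S (l2_class M f)) < e"
      using cl unfolding metric_closure_of by auto
    then show "\<exists>k\<in>sq N. ip N k g = 0 \<and> nrm N (\<lambda>x. app M T f x - k x) < e"
      using z[OF S(1)] X f by (intro bexI[of _ "app M S f"]) (auto simp: form_def l2_dist_eq app_def app_sq[unfolded app_def] subset_iff)
  qed
qed

text \<open>The component of \<open>T f\<close> orthogonal to the closure of the vectors
  \<open>S f\<close> is a \<open>g\<close> that annihilates all of \<open>X\<close> at
  \<open>f\<close>, so by assumption it is orthogonal to \<open>T f\<close> and hence null. With
  \<open>reflexive_hull_annihilator\<close> this describes the reflexive hull of a subspace.\<close>

lemma reflexive_hullI:
  assumes X: "op_subspace M N X" and T: "T \<in> bounded_ops M N"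
    and z: "\<And>f g. f \<in> sq M \<Longrightarrow> g \<in> sq N \<Longrightarrow> (\<And>S. S \<in> X \<Longrightarrow> form M N S f g = 0) \<Longrightarrow> form M N T f g = 0"
  shows "T \<in> reflexive_hull M N X"
proof -
  interpret Metric_space "L2 N" "l2_dist N" by (rule Metric_space_L2)
  note Xb = op_subspaceD(1)[OF X]
  have "T u \<in> mtopology closure_of ((\<lambda>S. S u) ` X)" if u: "u \<in> L2 M" for u
  proof -
    define f where "f = l2_rep u"
    have f: "f \<in> sq M" "u = l2_class M f" unfolding f_def using u by (simp_all add: l2_class_rep l2_rep_in)
    \<comment> \<open>All functions almost everywhere equal to some \<open>app M S f\<close>; the
      values of \<open>app\<close> alone need not be closed under addition.\<close>
    define K where "K = {k \<in> sq N. \<exists>S\<in>X. \<forall>g\<in>sq N. ip N k g = form M N S f g}"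
    have K: "subsp N K"
      unfolding subsp_def
    proof (intro conjI ballI allI)
      show "K \<subseteq> sq N" by (auto simp: K_def)
      show "(\<lambda>x. 0) \<in> K" unfolding K_def using op_subspaceD(2)[OF X] f op_zero_form(2) by force
      fix h assume "h \<in> K"
      then obtain S where S: "h \<in> sq N" "S \<in> X" "\<And>g. g \<in> sq N \<Longrightarrow> ip N h g = form M N S f g" by (auto simp: K_def)
      show "(\<lambda>x. c * h x) \<in> K" for c
        unfolding K_def using S Xb f op_subspaceD(4)[OF X S(2), of c]
        by (auto simp: ip_scale_left op_scale_form intro!: bexI[of _ "op_scale M N c S"])
      fix h' assume "h' \<in> K"
      then obtain S' where S': "h' \<in> sq N" "S' \<in> X" "\<And>g. g \<in> sq N \<Longrightarrow> ip N h' g = form M N S' f g" by (auto simp: K_def)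
      show "(\<lambda>x. h x + h' x) \<in> K"
        unfolding K_def using S S' Xb f op_subspaceD(3)[OF X S(2) S'(2)]
        by (auto simp: ip_add_left op_add_form subset_iff intro!: bexI[of _ "op_add M N S S'"])
    qed
    have Tf: "app M T f \<in> sq N" using T f by simp
    obtain p where p: "p \<in> sq N" "\<And>k. k \<in> K \<Longrightarrow> ip N (\<lambda>x. app M T f x - p x) k = 0"
      "\<And>e. e > 0 \<Longrightarrow> \<exists>k\<in>K. nrm N (\<lambda>x. p x - k x) < e" using projection[OF K Tf] by metis
    define g where "g x = app M T f x - p x" for x
    have g: "g \<in> sq N" unfolding g_def using Tf p by simp
    have kg: "ip N k g = 0" if "k \<in> K" for k using p(2)[OF that] unfolding g_def[symmetric] by (metis cnj_ip complex_cnj_zero)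
    have "form M N S f g = 0" if S: "S \<in> X" for S
    proof -
      have "app M S f \<in> K" unfolding K_def using S Xb f by (auto simp: form_def)
      then show ?thesis using kg by (simp add: form_def)
    qed
    then have "ip N (app M T f) g = 0" using z[OF f(1) g] by (simp add: form_def)
    moreover have "ip N p g = 0"
      by (rule limit_zero_ip[OF p(1) g]) (use p(3) kg subspD(1)[OF K] in blast)
    ultimately have "ip N g g = 0" using ip_diff_left[OF Tf p(1) g] by (simp add: g_def[abs_def])
    then have g0: "nrm N g = 0" by (simp add: ip_self)
    have "\<exists>S\<in>X. S u \<in> mball (T u) e" if e: "e > 0" for e
    proof -
      obtain k where k: "k \<in> K" "nrm N (\<lambda>x. p x - k x) < e" using p(3)[OF e] by blast
      then obtain S where S: "k \<in> sq N" "S \<in> X" "\<And>g. g \<in> sq N \<Longrightarrow> ip N k g = form M N S f g" by (auto simp: K_def)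
      have Sb: "S \<in> bounded_ops M N" using S Xb by blast
      have Sf: "app M S f \<in> sq N" using Sb f by simp
      have "AE x in N. k x = app M S f x" using S Sf by (intro AE_eq_if_ip_eq) (auto simp: form_def)
      then have "nrm N (\<lambda>x. app M T f x - app M S f x) = nrm N (\<lambda>x. app M T f x - k x)"
        using Tf Sf S by (intro nrm_cong_AE) auto
      also have "\<dots> \<le> nrm N (\<lambda>x. app M T f x - p x) + nrm N (\<lambda>x. p x - k x)"
        by (rule nrm_triangle_diff[OF Tf p(1) S(1)])
      also have "\<dots> < e" using g0 k by (simp add: g_def[abs_def])
      finally have "l2_dist N (T u) (S u) < e" unfolding f(2) by (simp add: l2_dist_eq app_def)
      then show ?thesis using S u bounded_opsD(1)[OF T u] bounded_opsD(1)[OF Sb u] by auto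
    qed
    then show ?thesis unfolding metric_closure_of using bounded_opsD(1)[OF T u] by auto
  qed
  then show ?thesis using T by (simp add: reflexive_hull_def l2_topology_def)
qed

section \<open>Nests as families of level sets\<close>

text \<open>A nowhere vanishing vector separates: identities between multiplication operators may be
  tested on it alone.\<close>

lemma positive_sq:
  assumes "sigma_finite_measure M" obtains w where "w \<in> sq M" "\<And>x. w x \<noteq> 0"
proof -
  interpret sigma_finite_measure M by fact
  obtain f :: "'a \<Rightarrow> real" where f: "f \<in> borel_measurable M" "\<And>x. f x > 0" "integrable M f"
    using obtain_positive_integrable_function by metis
  have [measurable]: "f \<in> borel_measurable M" by fact
  have "(\<lambda>x. (cmod (complex_of_real (sqrt (f x))))\<^sup>2) = f" using f(2) by (auto simp: fun_eq_iff less_imp_le)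
  then have "(\<lambda>x. complex_of_real (sqrt (f x))) \<in> sq M"
    unfolding square_integrable_def using f(3) by simp
  moreover have "complex_of_real (sqrt (f x)) \<noteq> 0" for x using f(2)[of x] by simp
  ultimately show thesis by (rule that)
qed

text \<open>A finite measure with the same null sets makes it possible to order a chain of sets by
  size.\<close>

lemma equivalent_finite_measure:
  assumes "sigma_finite_measure M"
  obtains \<nu> where "finite_measure \<nu>" "sets \<nu> = sets M" "space \<nu> = space M"
    "\<And>P. (AE x in \<nu>. P x) \<longleftrightarrow> (AE x in M. P x)"
proof -
  interpret sigma_finite_measure M by fact
  obtain f :: "'a \<Rightarrow> real" where f: "f \<in> borel_measurable M" "\<And>x. f x > 0" "integrable M f"
    using obtain_positive_integrable_function by metis
  have [measurable]: "f \<in> borel_measurable M" by fact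
  let ?\<nu> = "density M (\<lambda>x. ennreal (f x))"
  have "emeasure ?\<nu> (space M) = ennreal (\<integral>x. f x \<partial>M)"
  proof -
    have "emeasure ?\<nu> (space M) = (\<integral>\<^sup>+x. ennreal (f x) * indicator (space M) x \<partial>M)"
      by (rule emeasure_density) auto
    also have "\<dots> = (\<integral>\<^sup>+x. ennreal (f x) \<partial>M)" by (rule nn_integral_cong) simp
    also have "\<dots> = ennreal (\<integral>x. f x \<partial>M)"
      using f by (intro nn_integral_eq_integral) (auto intro: less_imp_le)
    finally show ?thesis .
  qed
  then have "finite_measure ?\<nu>" by (intro finite_measureI) simp
  moreover have "(AE x in ?\<nu>. P x) \<longleftrightarrow> (AE x in M. P x)" for P
    using f(2) by (subst AE_density) auto
  ultimately show thesis by (intro that[of ?\<nu>]) auto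
qed

section \<open>Chains of sets in a finite measure space\<close>

lemma (in finite_measure) AE_subset_antisym:
  assumes A: "A \<in> sets M" and B: "B \<in> sets M" and AB: "AE x in M. x \<in> A \<longrightarrow> x \<in> B"
    and le: "measure M B \<le> measure M A"
  shows "AE x in M. x \<in> B \<longrightarrow> x \<in> A"
proof -
  have "measure M (B - A) = measure M B - measure M (B \<inter> A)" using A B by (rule finite_measure_Diff'[rotated])
  also have "measure M (B \<inter> A) = measure M A"
    using AB A B by (intro measure_eq_AE) auto
  finally have "measure M (B - A) = 0" using le measure_nonneg[of M "B - A"] by simp
  then have "emeasure M (B - A) = 0" by (simp add: emeasure_eq_measure)
  then have "B - A \<in> null_sets M" using A B by auto
  then have "AE x in M. x \<notin> B - A" by (rule AE_not_in)
  then show ?thesis by eventually_elim auto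
qed

text \<open>\<open>L\<close> is the essential supremum of the members of size at most
  \<open>q\<close>. A sequence of members whose sizes approach the supremum replaces the possibly
  uncountable union.\<close>

lemma (in finite_measure) chain_sup:
  assumes S: "\<S> \<subseteq> sets M"
    and chain: "\<And>A B. A \<in> \<S> \<Longrightarrow> B \<in> \<S> \<Longrightarrow> (AE x in M. x \<in> A \<longrightarrow> x \<in> B) \<or> (AE x in M. x \<in> B \<longrightarrow> x \<in> A)"
    and q: "0 \<le> q"
  obtains L where "L \<in> sets M" "measure M L \<le> q"
    "\<And>A. A \<in> \<S> \<Longrightarrow> measure M A \<le> q \<Longrightarrow> AE x in M. x \<in> A \<longrightarrow> x \<in> L"
    "\<And>B. (\<And>A. A \<in> \<S> \<Longrightarrow> measure M A \<le> q \<Longrightarrow> AE x in M. x \<in> A \<longrightarrow> x \<in> B) \<Longrightarrow> AE x in M. x \<in> L \<longrightarrow> x \<in> B"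
proof -
  define \<T> where "\<T> = {A \<in> \<S>. measure M A \<le> q}"
  show thesis
  proof (cases "\<T> = {}")
    case True
    show thesis by (rule that[of "{}"]) (use True q in \<open>auto simp: \<T>_def\<close>)
  next
    case False
    define \<sigma> where "\<sigma> = (SUP A\<in>\<T>. measure M A)"
    have bdd: "bdd_above (measure M ` \<T>)" by (rule bdd_aboveI2[where M = q]) (simp add: \<T>_def)
    have "\<exists>A\<in>\<T>. \<sigma> - 1 / (real n + 1) < measure M A" for n
      using less_cSUP_iff[OF False bdd, of "\<sigma> - 1 / (real n + 1)"] unfolding \<sigma>_def by simp
    then obtain A where A: "\<And>n. A n \<in> \<T>" "\<And>n. \<sigma> - 1 / (real n + 1) < measure M (A n)" by metis
    have le\<sigma>: "measure M B \<le> \<sigma>" if "B \<in> \<T>" for B unfolding \<sigma>_def using that bdd by (rule cSUP_upper)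
    have "\<sigma> \<le> q" unfolding \<sigma>_def using False by (rule cSUP_least) (simp add: \<T>_def)
    have As: "A n \<in> sets M" for n using A(1)[of n] S by (auto simp: \<T>_def)
    define L where "L = (\<Union>n. A n)"
    have L: "L \<in> sets M" unfolding L_def using As by auto
    \<comment> \<open>A finite union of members of a chain is one of them up to null sets; this
      keeps the size of \<open>L\<close> at most \<open>\<sigma>\<close>.\<close>
    have fin: "\<exists>k. AE x in M. x \<in> (\<Union>i\<le>n. A i) \<longleftrightarrow> x \<in> A k" for n
    proof (induction n)
      case (Suc n)
      then obtain k where k: "AE x in M. x \<in> (\<Union>i\<le>n. A i) \<longleftrightarrow> x \<in> A k" by blast
      from chain[of "A k" "A (Suc n)"] A(1) consider
        "AE x in M. x \<in> A k \<longrightarrow> x \<in> A (Suc n)" | "AE x in M. x \<in> A (Suc n) \<longrightarrow> x \<in> A k" by (auto simp: \<T>_def)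
      then show ?case
      proof cases
        case 1
        with k have "AE x in M. x \<in> (\<Union>i\<le>Suc n. A i) \<longleftrightarrow> x \<in> A (Suc n)"
          by eventually_elim (auto simp: atMost_Suc)
        then show ?thesis by blast
      next
        case 2
        with k have "AE x in M. x \<in> (\<Union>i\<le>Suc n. A i) \<longleftrightarrow> x \<in> A k"
          by eventually_elim (auto simp: atMost_Suc)
        then show ?thesis by blast
      qed
    qed auto
    have mfin: "measure M (\<Union>i\<le>n. A i) \<le> \<sigma>" for n
    proof -
      obtain k where "AE x in M. x \<in> (\<Union>i\<le>n. A i) \<longleftrightarrow> x \<in> A k" using fin by blast
      then have "measure M (\<Union>i\<le>n. A i) = measure M (A k)" using As by (intro measure_eq_AE) auto
      then show ?thesis using le\<sigma>[OF A(1)] by simp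
    qed
    have "(\<lambda>n. measure M (\<Union>i\<le>n. A i)) \<longlonglongrightarrow> measure M (\<Union>n. \<Union>i\<le>n. A i)"
      using As by (intro finite_Lim_measure_incseq) (auto simp: incseq_def intro: order_trans)
    moreover have "(\<Union>n. \<Union>i\<le>n. A i) = L" unfolding L_def by auto
    ultimately have mL: "measure M L \<le> \<sigma>" using mfin by (auto intro!: LIMSEQ_le_const2)
    have \<sigma>L: "\<sigma> \<le> measure M L"
    proof (rule field_le_epsilon)
      fix e :: real assume "e > 0"
      then obtain n where "inverse (real (Suc n)) < e" using reals_Archimedean by blast
      then have "1 / (real n + 1) < e" by (simp add: inverse_eq_divide add.commute)
      moreover have "measure M (A n) \<le> measure M L"
        unfolding L_def using As by (intro finite_measure_mono) auto
      ultimately show "\<sigma> \<le> measure M L + e" using A(2)[of n] by simp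
    qed
    show thesis
    proof (rule that[OF L])
      show "measure M L \<le> q" using mL \<open>\<sigma> \<le> q\<close> by simp
      show "AE x in M. x \<in> B \<longrightarrow> x \<in> L" if B: "B \<in> \<S>" "measure M B \<le> q" for B
      proof (cases "\<exists>n. AE x in M. x \<in> B \<longrightarrow> x \<in> A n")
        case True
        then obtain n where "AE x in M. x \<in> B \<longrightarrow> x \<in> A n" by blast
        then show ?thesis unfolding L_def by eventually_elim auto
      next
        case False
        \<comment> \<open>In this case \<open>B\<close> lies above every \<open>A n\<close>, hence
          above \<open>L\<close>, without being larger in size; so the two agree up to null
          sets.\<close>
        have "AE x in M. x \<in> A n \<longrightarrow> x \<in> B" for n
          using chain[of B "A n"] False A(1)[of n] B(1) by (auto simp: \<T>_def)
        then have "AE x in M. \<forall>n. x \<in> A n \<longrightarrow> x \<in> B" unfolding AE_all_countable by blast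
        then have "AE x in M. x \<in> L \<longrightarrow> x \<in> B" unfolding L_def by eventually_elim auto
        moreover have "measure M B \<le> measure M L" using le\<sigma>[of B] B \<sigma>L by (simp add: \<T>_def)
        ultimately show ?thesis using B(1) S by (intro AE_subset_antisym[OF L]) auto
      qed
      show "AE x in M. x \<in> L \<longrightarrow> x \<in> B"
        if "\<And>A. A \<in> \<S> \<Longrightarrow> measure M A \<le> q \<Longrightarrow> AE x in M. x \<in> A \<longrightarrow> x \<in> B" for B
      proof -
        have "AE x in M. x \<in> A n \<longrightarrow> x \<in> B" for n using that A(1)[of n] by (simp add: \<T>_def)
        then have "AE x in M. \<forall>n. x \<in> A n \<longrightarrow> x \<in> B" unfolding AE_all_countable by blast
        then show ?thesis unfolding L_def by eventually_elim auto
      qed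
    qed
  qed
qed

text \<open>One real function records the whole chain: sets that are nested only up to null sets
  become sublevel sets, each up to a null set of its own.\<close>

lemma (in finite_measure) chain_levels:
  assumes S: "\<S> \<subseteq> sets M"
    and chain: "\<And>A B. A \<in> \<S> \<Longrightarrow> B \<in> \<S> \<Longrightarrow> (AE x in M. x \<in> A \<longrightarrow> x \<in> B) \<or> (AE x in M. x \<in> B \<longrightarrow> x \<in> A)"
  obtains f :: "'a \<Rightarrow> real" where "f \<in> borel_measurable M" "\<And>A. A \<in> \<S> \<Longrightarrow> \<exists>s. AE x in M. x \<in> A \<longleftrightarrow> f x \<le> s"
proof -
  define G where "G q L \<longleftrightarrow> L \<in> sets M \<and> measure M L \<le> q \<and>
    (\<forall>A\<in>\<S>. measure M A \<le> q \<longrightarrow> (AE x in M. x \<in> A \<longrightarrow> x \<in> L)) \<and>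
    (\<forall>B. (\<forall>A\<in>\<S>. measure M A \<le> q \<longrightarrow> (AE x in M. x \<in> A \<longrightarrow> x \<in> B)) \<longrightarrow> (AE x in M. x \<in> L \<longrightarrow> x \<in> B))"
    for q L
  have "\<exists>L. G q L" if "0 \<le> q" for q
  proof (rule chain_sup[OF S chain that])
    fix L
    assume a: "L \<in> sets M" "measure M L \<le> q"
      and b: "\<And>A. A \<in> \<S> \<Longrightarrow> measure M A \<le> q \<Longrightarrow> AE x in M. x \<in> A \<longrightarrow> x \<in> L"
      and c: "\<And>B. (\<And>A. A \<in> \<S> \<Longrightarrow> measure M A \<le> q \<Longrightarrow> AE x in M. x \<in> A \<longrightarrow> x \<in> B) \<Longrightarrow> AE x in M. x \<in> L \<longrightarrow> x \<in> B"
    show ?thesis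
      unfolding G_def
    proof (intro exI[of _ L] conjI ballI allI impI)
      fix A assume "A \<in> \<S>" "measure M A \<le> q"
      then show "AE x in M. x \<in> A \<longrightarrow> x \<in> L" by (rule b)
    next
      fix B assume "\<forall>A\<in>\<S>. measure M A \<le> q \<longrightarrow> (AE x in M. x \<in> A \<longrightarrow> x \<in> B)"
      then show "AE x in M. x \<in> L \<longrightarrow> x \<in> B" by (intro c) blast
    qed (fact a)+
  qed
  then obtain L where "\<And>q. 0 \<le> q \<Longrightarrow> G q (L q)" by metis
  then have L: "\<And>q. 0 \<le> q \<Longrightarrow> L q \<in> sets M" "\<And>q. 0 \<le> q \<Longrightarrow> measure M (L q) \<le> q"
    "\<And>q A. 0 \<le> q \<Longrightarrow> A \<in> \<S> \<Longrightarrow> measure M A \<le> q \<Longrightarrow> AE x in M. x \<in> A \<longrightarrow> x \<in> L q"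
    "\<And>q B. 0 \<le> q \<Longrightarrow> (\<forall>A\<in>\<S>. measure M A \<le> q \<longrightarrow> (AE x in M. x \<in> A \<longrightarrow> x \<in> B)) \<Longrightarrow> AE x in M. x \<in> L q \<longrightarrow> x \<in> B"
    unfolding G_def by blast+
  \<comment> \<open>Exceeds every size and serves as value at points lying in none of the
    \<open>L q\<close>.\<close>
  define c where "c = measure M (space M) + 1"
  define Q where "Q = {q::real. q \<in> \<rat> \<and> 0 \<le> q}"
  have Q: "countable Q" "Q \<noteq> {}" unfolding Q_def using countable_rat by (auto simp: Collect_conj_eq intro: countable_subset[of _ "\<rat>"])
  have Q0: "q \<ge> 0" if "q \<in> Q" for q using that by (simp add: Q_def)
  have Qd: "\<exists>q\<in>Q. a < q \<and> q < b" if "0 \<le> a" "a < b" for a b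
    using Rats_dense_in_real[OF that(2)] that(1) by (auto simp: Q_def intro: less_imp_le order_trans)
  define g where "g q x = (if x \<in> L q then q else c)" for q x
  \<comment> \<open>The size of the smallest member of the chain that contains \<open>x\<close>, up to null sets.\<close>
  define f where "f x = (INF q\<in>Q. g q x)" for x
  have bdd: "bdd_below ((\<lambda>q. g q x) ` Q)" for x
    by (rule bdd_belowI2[where m = 0]) (auto simp: g_def c_def Q0 add_nonneg_nonneg)
  have gm: "g q \<in> borel_measurable M" if "q \<in> Q" for q
    unfolding g_def[abs_def] using L(1)[OF Q0[OF that]] by measurable
  have "f \<in> borel_measurable M" unfolding f_def[abs_def] using gm Q bdd by (intro borel_measurable_cINF) auto
  moreover have "AE x in M. x \<in> A \<longleftrightarrow> f x \<le> measure M A" if A: "A \<in> \<S>" for A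
  proof -
    let ?s = "measure M A"
    have s0: "0 \<le> ?s" by simp
    have sc: "?s < c" unfolding c_def using bounded_measure[of A] by simp
    have AQ: "AE x in M. \<forall>q\<in>Q. ?s \<le> q \<longrightarrow> x \<in> A \<longrightarrow> x \<in> L q"
    proof (rule AE_ball_countable'[OF _ Q(1)])
      fix q assume "q \<in> Q"
      then show "AE x in M. ?s \<le> q \<longrightarrow> x \<in> A \<longrightarrow> x \<in> L q" using L(3)[OF Q0 A, of q] by (cases "?s \<le> q") auto
    qed
    have mono: "AE x in M. \<forall>q\<in>Q. \<forall>r\<in>Q. q \<le> r \<longrightarrow> x \<in> L q \<longrightarrow> x \<in> L r"
    proof (intro AE_ball_countable'[OF _ Q(1)])
      fix q r assume "q \<in> Q" "r \<in> Q"
      then show "AE x in M. q \<le> r \<longrightarrow> x \<in> L q \<longrightarrow> x \<in> L r"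
        using L(4)[OF Q0, of q "L r"] L(3)[OF Q0, of r] by (cases "q \<le> r") auto
    qed
    \<comment> \<open>The limit of the \<open>L q\<close> from above contains \<open>A\<close> up to
      a null set and has at most its size, so it agrees with \<open>A\<close> almost
      everywhere.\<close>
    define D where "D = space M \<inter> (\<Inter>q\<in>{q\<in>Q. ?s < q}. L q)"
    obtain q0 where q0: "q0 \<in> Q" "?s < q0" using Qd[OF s0 sc] by blast
    have Ds: "D \<in> sets M"
      unfolding D_def using Q(1) q0 L(1) Q0 by (intro sets.Int sets.top sets.countable_INT') (auto intro: countable_subset)
    have "measure M D \<le> ?s"
    proof (rule field_le_epsilon)
      fix e :: real assume "e > 0"
      then obtain q where q: "q \<in> Q" "?s < q" "q < ?s + e" using Qd[OF s0, of "?s + e"] by auto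
      have "measure M D \<le> measure M (L q)" using q L(1) Q0 by (intro finite_measure_mono) (auto simp: D_def)
      then show "measure M D \<le> ?s + e" using L(2)[OF Q0[OF q(1)]] q by simp
    qed
    moreover have As: "A \<in> sets M" using A S by blast
    have "AE x in M. x \<in> A \<longrightarrow> x \<in> D"
      using AQ AE_space by eventually_elim (auto simp: D_def)
    ultimately have DA: "AE x in M. x \<in> D \<longrightarrow> x \<in> A" by (intro AE_subset_antisym[OF As Ds])
    show ?thesis
      using AQ mono DA AE_space
    proof eventually_elim
      case (elim x)
      show ?case
      proof
        assume x: "x \<in> A"
        show "f x \<le> ?s"
        proof (rule field_le_epsilon)
          fix e :: real assume "e > 0"
          then obtain q where q: "q \<in> Q" "?s < q" "q < ?s + e" using Qd[OF s0, of "?s + e"] by auto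
          have "f x \<le> g q x" unfolding f_def using bdd q(1) by (rule cINF_lower)
          also have "\<dots> = q" using elim(1) q x by (simp add: g_def)
          finally show "f x \<le> ?s + e" using q by simp
        qed
      next
        assume fx: "f x \<le> ?s"
        have "x \<in> L q" if q: "q \<in> Q" "?s < q" for q
        proof -
          have "f x < min q c" using fx q sc by simp
          then obtain r where r: "r \<in> Q" "g r x < min q c"
            unfolding f_def using cINF_less_iff[OF Q(2) bdd] by blast
          then have "x \<in> L r" "r < q" by (auto simp: g_def split: if_splits)
          then show ?thesis using elim(2) r q by auto
        qed
        then have "x \<in> D" using elim(4) by (simp add: D_def)
        then show "x \<in> A" using elim(3) by simp
      qed
    qed
  qed
  ultimately show thesis using that by blast
qed

section \<open>From nests in the masas to level sets and rank one operators\<close>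

abbreviation sublevel :: "'a measure \<Rightarrow> ('a \<Rightarrow> real) \<Rightarrow> real \<Rightarrow> 'a set" where
  "sublevel M f t \<equiv> {x \<in> space M. f x \<le> t}"

abbreviation suplevel :: "'a measure \<Rightarrow> ('a \<Rightarrow> real) \<Rightarrow> real \<Rightarrow> 'a set" where
  "suplevel M f t \<equiv> {x \<in> space M. t \<le> f x}"

lemma sublevel_sets: "f \<in> borel_measurable M \<Longrightarrow> sublevel M f t \<in> sets M"
  by measurable

lemma suplevel_sets: "f \<in> borel_measurable M \<Longrightarrow> suplevel M f t \<in> sets M"
  by measurable

text \<open>Idempotence, tested on a nowhere vanishing function, leaves only the values 0 and 1 for
  the symbol.\<close>

lemma masa_projection_restr:
  assumes sf: "sigma_finite_measure M" and P: "projection_op M P" "P \<in> masa M"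
  obtains S where "S \<in> sets M" "\<And>u. u \<in> sq M \<Longrightarrow> P (l2_class M u) = l2_class M (restr S u)"
proof -
  obtain g where g: "g \<in> ess_bounded M" "P = mult_op M g" using P(2) by (auto simp: masa_def)
  have [measurable]: "g \<in> borel_measurable M" using g(1) by (simp add: ess_bounded_def)
  obtain w where w: "w \<in> sq M" "\<And>x. w x \<noteq> 0" using positive_sq[OF sf] by blast
  note gs = ess_bounded_mult[OF g(1)]
  have "P (P (l2_class M w)) = P (l2_class M w)"
    using P(1) w(1) compose_eq[of "l2_class M w" "L2 M" P P] by (simp add: projection_op_def)
  then have "l2_class M (\<lambda>x. g x * (g x * w x)) = l2_class M (\<lambda>x. g x * w x)"
    unfolding g(2) by (simp add: mult_op_form(3)[OF g(1)] w(1) gs)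
  then have "AE x in M. g x * (g x * w x) = g x * w x"
    using w(1) gs by (subst (asm) l2_class_eq_iff) auto
  then have g01: "AE x in M. g x = indicator {x \<in> space M. g x = 1} x"
    using AE_space
  proof eventually_elim
    case (elim x)
    then have "(g x * (g x - 1)) * w x = 0" by (simp add: algebra_simps)
    then have "g x = 0 \<or> g x = 1" using w(2)[of x] by simp
    then show ?case using elim by auto
  qed
  show thesis
  proof (rule that)
    show "{x \<in> space M. g x = 1} \<in> sets M" by measurable
    fix u assume u: "u \<in> sq M"
    have "AE x in M. g x * u x = restr {x \<in> space M. g x = 1} u x"
      using g01
    proof eventually_elim
      case (elim x)
      show ?case unfolding restr_def by (rule arg_cong[OF elim, of "\<lambda>z. z * u x"])
    qed
    from l2_class_cong[OF this] show "P (l2_class M u) = l2_class M (restr {x \<in> space M. g x = 1} u)"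
      by (simp add: g(2) mult_op_form(3)[OF g(1) u])
  qed
qed

text \<open>Inclusion of ranges, tested on a nowhere vanishing function, becomes inclusion of sets
  up to null sets, so the nest is a chain in the sense of \<open>chain_levels\<close>.\<close>

lemma nest_levels:
  assumes sf: "sigma_finite_measure M" and N: "nest M \<N>" "\<N> \<subseteq> masa M"
  obtains f where "f \<in> borel_measurable M"
    "\<And>P. P \<in> \<N> \<Longrightarrow> \<exists>s. \<forall>u\<in>sq M. P (l2_class M u) = l2_class M (restr (sublevel M f s) u)"
proof -
  have "\<exists>S. S \<in> sets M \<and> (\<forall>u\<in>sq M. P (l2_class M u) = l2_class M (restr S u))" if P: "P \<in> \<N>" for P
  proof -
    have "projection_op M P" "P \<in> masa M" using N P by (auto simp: nest_def)
    then show ?thesis by (rule masa_projection_restr[OF sf]) blast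
  qed
  then obtain S where S: "\<And>P. P \<in> \<N> \<Longrightarrow> S P \<in> sets M"
    "\<And>P u. P \<in> \<N> \<Longrightarrow> u \<in> sq M \<Longrightarrow> P (l2_class M u) = l2_class M (restr (S P) u)" by metis
  obtain w where w: "w \<in> sq M" "\<And>x. w x \<noteq> 0" using positive_sq[OF sf] by blast
  obtain \<nu> where \<nu>: "finite_measure \<nu>" "sets \<nu> = sets M" "space \<nu> = space M"
    "\<And>P. (AE x in \<nu>. P x) \<longleftrightarrow> (AE x in M. P x)" using equivalent_finite_measure[OF sf] by blast
  have sub: "AE x in M. x \<in> S P \<longrightarrow> x \<in> S Q" if P: "P \<in> \<N>" and Q: "Q \<in> \<N>" and r: "op_range M P \<subseteq> op_range M Q" for P Q
  proof -
    have "P (l2_class M w) \<in> op_range M Q" using r w by (auto simp: op_range_def)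
    then obtain v where v: "v \<in> L2 M" "P (l2_class M w) = Q v" by (auto simp: op_range_def)
    have "l2_class M (restr (S P) w) = l2_class M (restr (S Q) (l2_rep v))"
      using S(2)[OF P w(1)] S(2)[OF Q, of "l2_rep v"] v by (simp add: l2_class_rep l2_rep_in)
    then have "AE x in M. restr (S P) w x = restr (S Q) (l2_rep v) x"
      using S(1)[OF P] S(1)[OF Q] w(1) l2_rep_in(2)[OF v(1)] by (simp add: l2_class_eq_iff)
    then show ?thesis by eventually_elim (use w(2) in \<open>auto simp: restr_def split: split_indicator_asm\<close>)
  qed
  interpret finite_measure \<nu> by fact
  obtain f :: "'a \<Rightarrow> real" where f: "f \<in> borel_measurable \<nu>"
    "\<And>A. A \<in> S ` \<N> \<Longrightarrow> \<exists>s. AE x in \<nu>. x \<in> A \<longleftrightarrow> f x \<le> s"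
  proof (rule chain_levels[of "S ` \<N>"])
    show "S ` \<N> \<subseteq> sets \<nu>" using S \<nu> by auto
    fix A B assume "A \<in> S ` \<N>" "B \<in> S ` \<N>"
    then obtain P Q where "P \<in> \<N>" "Q \<in> \<N>" "A = S P" "B = S Q" by blast
    moreover from this have "op_range M P \<subseteq> op_range M Q \<or> op_range M Q \<subseteq> op_range M P"
      using N(1) by (simp add: nest_def)
    ultimately show "(AE x in \<nu>. x \<in> A \<longrightarrow> x \<in> B) \<or> (AE x in \<nu>. x \<in> B \<longrightarrow> x \<in> A)"
      using sub[of P Q] sub[of Q P] by (simp only: \<nu>(4)) blast
  qed blast
  show thesis
  proof (rule that)
    show "f \<in> borel_measurable M" using f(1) \<nu>(2) by (simp cong: measurable_cong_sets)
    fix P assume P: "P \<in> \<N>"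
    then obtain s where s: "AE x in M. x \<in> S P \<longleftrightarrow> f x \<le> s" using f(2) \<nu>(4) by blast
    have "l2_class M (restr (S P) u) = l2_class M (restr (sublevel M f s) u)" for u
    proof (rule l2_class_cong)
      show "AE x in M. restr (S P) u x = restr (sublevel M f s) u x"
        using s AE_space by eventually_elim (auto simp: restr_def split: split_indicator)
    qed
    then show "\<exists>s. \<forall>u\<in>sq M. P (l2_class M u) = l2_class M (restr (sublevel M f s) u)" using S(2)[OF P] by auto
  qed
qed

lemma masa_subset_nest_algebra:
  assumes N: "\<N> \<subseteq> masa M" and b: "b \<in> ess_bounded M" shows "mult_op M b \<in> nest_algebra M \<N>"
  unfolding nest_algebra_def
proof (intro CollectI conjI ballI subsetI)
  show "mult_op M b \<in> bounded_ops M M" using mult_op_form(1)[OF b] .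
  fix P u assume P: "P \<in> \<N>" and "u \<in> mult_op M b ` op_range M P"
  then obtain v where v: "v \<in> L2 M" "u = mult_op M b (P v)" by (auto simp: op_range_def)
  obtain g where g: "g \<in> ess_bounded M" "P = mult_op M g" using N P by (auto simp: masa_def)
  let ?v = "l2_rep v"
  have r: "?v \<in> sq M" "v = l2_class M ?v" using v by (simp_all add: l2_class_rep l2_rep_in)
  have "P (l2_class M (\<lambda>x. b x * ?v x)) = l2_class M (\<lambda>x. g x * (b x * ?v x))"
    unfolding g(2) by (rule mult_op_form(3)[OF g(1) ess_bounded_mult[OF b r(1)]])
  also have "\<dots> = l2_class M (\<lambda>x. b x * (g x * ?v x))" by (simp add: mult.left_commute)
  also have "\<dots> = mult_op M b (l2_class M (\<lambda>x. g x * ?v x))"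
    by (rule mult_op_form(3)[OF b ess_bounded_mult[OF g(1) r(1)], symmetric])
  also have "l2_class M (\<lambda>x. g x * ?v x) = P v" using mult_op_form(3)[OF g(1) r(1)] r(2) g(2) by simp
  finally show "u \<in> op_range M P"
    unfolding op_range_def v(2) using ess_bounded_mult[OF b r(1)] by (metis image_eqI l2_class_in)
qed

text \<open>Consider the member {f \<le> s} of the nest. If t \<le> s, the range lies in it;
  otherwise {f \<ge> t} is disjoint from {f \<le> s} and the operator vanishes on that
  member.\<close>

lemma rank_one_nest_algebra:
  assumes f: "f \<in> borel_measurable M"
    and N: "\<And>P. P \<in> \<N> \<Longrightarrow> \<exists>s. \<forall>u\<in>sq M. P (l2_class M u) = l2_class M (restr (sublevel M f s) u)"
    and a: "a \<in> sq M" and b: "b \<in> sq M"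
  obtains R where "R \<in> nest_algebra M \<N>" "R \<in> bounded_ops M M"
    "\<And>u. u \<in> sq M \<Longrightarrow> R (l2_class M u) = l2_class M (\<lambda>x. ip M u (restr (suplevel M f t) b) * restr (sublevel M f t) a x)"
proof -
  let ?a = "restr (sublevel M f t) a" and ?b = "restr (suplevel M f t) b"
  have s: "?a \<in> sq M" "?b \<in> sq M" using a b sublevel_sets[OF f] suplevel_sets[OF f] by auto
  note B = bform_rank_one[OF s]
  obtain R where R: "R \<in> bounded_ops M M" "\<And>v w. v \<in> sq M \<Longrightarrow> w \<in> sq M \<Longrightarrow> form M M R v w = ip M v ?b * ip M ?a w"
    using op_of_form[OF B] by blast
  have Rc: "R (l2_class M u) = l2_class M (\<lambda>x. ip M u ?b * ?a x)" if u: "u \<in> sq M" for u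
    unfolding app_class[OF R(1) u]
  proof (intro l2_class_cong AE_eq_if_ip_eq app_sq R(1) u sq_scale s)
    fix h assume "h \<in> sq M"
    then show "ip M (app M R u) h = ip M (\<lambda>x. ip M u ?b * ?a x) h"
      using R(2)[OF u] by (simp add: form_def ip_scale_left)
  qed
  have "R \<in> nest_algebra M \<N>"
    unfolding nest_algebra_def
  proof (intro CollectI conjI ballI subsetI)
    fix P u assume P: "P \<in> \<N>" and "u \<in> R ` op_range M P"
    then obtain v where v: "v \<in> L2 M" "u = R (P v)" by (auto simp: op_range_def)
    let ?v = "l2_rep v"
    have r: "?v \<in> sq M" "v = l2_class M ?v" using v by (simp_all add: l2_class_rep l2_rep_in)
    obtain s' where P': "\<And>u. u \<in> sq M \<Longrightarrow> P (l2_class M u) = l2_class M (restr (sublevel M f s') u)" using N[OF P] by blast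
    have cv: "restr (sublevel M f s') ?v \<in> sq M" using r sublevel_sets[OF f] by auto
    define c where "c = ip M (restr (sublevel M f s') ?v) ?b"
    have u: "u = l2_class M (\<lambda>x. c * ?a x)" using v(2) P'[OF r(1)] r(2) Rc[OF cv] by (simp add: c_def)
    show "u \<in> op_range M P"
    proof (cases "t \<le> s'")
      case True
      have "restr (sublevel M f s') (\<lambda>x. c * ?a x) = (\<lambda>x. c * ?a x)"
        using True by (auto simp: restr_def fun_eq_iff split: split_indicator)
      then have "u = P (l2_class M (\<lambda>x. c * ?a x))" using P'[of "\<lambda>x. c * ?a x"] s u by simp
      moreover have "l2_class M (\<lambda>x. c * ?a x) \<in> L2 M" using s by (intro l2_class_in sq_scale)
      ultimately show ?thesis unfolding op_range_def by (rule image_eqI)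
    next
      case False
      have "c = ip M ?v (restr (sublevel M f s') ?b)" unfolding c_def ip_restr ..
      also have "restr (sublevel M f s') ?b = (\<lambda>x. 0)"
        using False by (auto simp: restr_def fun_eq_iff split: split_indicator)
      finally have "u = l2_class M (\<lambda>x. 0)" using u by simp
      moreover have "P (l2_class M (\<lambda>x. 0)) = l2_class M (\<lambda>x. 0)" using P'[of "\<lambda>x. 0"] by (simp add: restr_def[abs_def])
      ultimately show ?thesis unfolding op_range_def by (metis image_eqI l2_class_in sq_zero)
    qed
  qed (rule R)
  with R Rc show thesis by (intro that)
qed

text \<open>All that is used of a nest algebra bimodule. The last clause expresses invariance under the rank one
  operators \<open>u \<mapsto> \<langle>u, b\<rangle> a\<close> of the nest algebra, where \<open>a\<close> lives on \<open>{f \<le> t}\<close> and \<open>b\<close> on \<open>{f \<ge> t}\<close>. That the two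
  sets overlap in \<open>{f = t}\<close> takes care of the atoms of the nest.\<close>

definition level_bimodule :: "'a measure \<Rightarrow> 'b measure \<Rightarrow> ('a \<Rightarrow> real) \<Rightarrow> ('a, 'b) oper set \<Rightarrow> bool" where
  "level_bimodule M N f W \<longleftrightarrow> f \<in> borel_measurable M \<and> op_subspace M N W \<and> wcl M N W \<subseteq> W \<and>
    (\<forall>T\<in>W. \<forall>S\<in>sets M. \<forall>R\<in>sets N. block M N S R T \<in> W) \<and>
    (\<forall>T\<in>W. \<forall>a\<in>sq M. \<forall>b\<in>sq M. \<forall>t. \<exists>T'\<in>W. \<forall>u\<in>sq M. \<forall>g\<in>sq N.
      form M N T' u g = ip M u (restr (suplevel M f t) b) * form M N T (restr (sublevel M f t) a) g)"

lemma nest_algebra_bimodule_level: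
  assumes sf: "sigma_finite_measure M" and W: "nest_algebra_bimodule M N W"
  obtains f where "level_bimodule M N f W"
proof -
  obtain \<N>1 \<N>2 where N1: "nest M \<N>1" "\<N>1 \<subseteq> masa M" and N2: "nest N \<N>2" "\<N>2 \<subseteq> masa N"
    and bm: "\<And>A B T. A \<in> nest_algebra M \<N>1 \<Longrightarrow> B \<in> nest_algebra N \<N>2 \<Longrightarrow> T \<in> W \<Longrightarrow>
      compose (L2 M) B (compose (L2 M) T A) \<in> W"
    using W unfolding nest_algebra_bimodule_def by blast
  have sub: "op_subspace M N W" and cl: "closedin (weak_star_topology M N) W"
    using W by (auto simp: nest_algebra_bimodule_def)
  obtain f where f: "f \<in> borel_measurable M"
    "\<And>P. P \<in> \<N>1 \<Longrightarrow> \<exists>s. \<forall>u\<in>sq M. P (l2_class M u) = l2_class M (restr (sublevel M f s) u)"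
    using nest_levels[OF sf N1] by blast
  have "level_bimodule M N f W"
    unfolding level_bimodule_def
  proof (intro conjI ballI allI)
    show "wcl M N W \<subseteq> W" using cl by (simp add: closure_of_closedin)
    fix T assume T: "T \<in> W"
    have Tb: "T \<in> bounded_ops M N" using T op_subspaceD(1)[OF sub] by blast
    show "block M N S R T \<in> W" if "S \<in> sets M" "R \<in> sets N" for S R
      unfolding block_def using that
      by (intro bm T masa_subset_nest_algebra N1 N2 indicator_ess_bounded)
    fix a b t assume a: "a \<in> sq M" and b: "b \<in> sq M"
    obtain R where R: "R \<in> nest_algebra M \<N>1" "R \<in> bounded_ops M M"
      "\<And>u. u \<in> sq M \<Longrightarrow> R (l2_class M u) = l2_class M (\<lambda>x. ip M u (restr (suplevel M f t) b) * restr (sublevel M f t) a x)"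
      using rank_one_nest_algebra[OF f a b, where t = t] by blast
    \<comment> \<open>The identity of the second space, as an element of the masa, fills the left
      slot of the bimodule condition.\<close>
    let ?I = "mult_op N (indicator (space N))"
    let ?T = "compose (L2 M) ?I (compose (L2 M) T R)"
    note mI = mult_op_form[OF indicator_ess_bounded[OF sets.top[of N]]]
    note c1 = compose_form[OF R(2) Tb]
    note c2 = compose_form[OF c1(1) mI(1)]
    have "?T \<in> W" by (intro bm T R masa_subset_nest_algebra N2 indicator_ess_bounded sets.top)
    moreover have "form M N ?T u g = ip M u (restr (suplevel M f t) b) * form M N T (restr (sublevel M f t) a) g"
      if u: "u \<in> sq M" and g: "g \<in> sq N" for u g
    proof -
      obtain C where C: "bform M N C (form M N T)" using form_bform[OF Tb] .
      let ?h = "app M (compose (L2 M) T R) u"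
      have h: "?h \<in> sq N" using c1(1) u by simp
      have ca: "restr (sublevel M f t) a \<in> sq M" using a sublevel_sets[OF f(1)] by auto
      have "form M N ?T u g = ip N (app N ?I ?h) g" unfolding c2(2)[OF u g] by (simp add: form_def)
      also have "\<dots> = ip N ?h g"
        using mI(2)[OF h] AE_space mI(1) h g by (intro ip_cong_AE) (auto elim: AE_mp)
      also have "\<dots> = form M N T (app M R u) g" using c1(2)[OF u g] by (simp add: form_def)
      also have "\<dots> = form M N T (\<lambda>x. ip M u (restr (suplevel M f t) b) * restr (sublevel M f t) a x) g"
      proof (rule bform_cong_AE[OF C])
        have "l2_class M (app M R u) = l2_class M (\<lambda>x. ip M u (restr (suplevel M f t) b) * restr (sublevel M f t) a x)"
          using R(3)[OF u] app_class[OF R(2) u] by simp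
        then show "AE x in M. app M R u x = ip M u (restr (suplevel M f t) b) * restr (sublevel M f t) a x"
          using R(2) u ca by (subst (asm) l2_class_eq_iff) auto
      qed (use u g R(2) ca in auto)
      also have "\<dots> = ip M u (restr (suplevel M f t) b) * form M N T (restr (sublevel M f t) a) g"
        by (rule bformD(3)[OF C ca g])
      finally show ?thesis .
    qed
    ultimately show "\<exists>T'\<in>W. \<forall>u\<in>sq M. \<forall>g\<in>sq N.
      form M N T' u g = ip M u (restr (suplevel M f t) b) * form M N T (restr (sublevel M f t) a) g" by blast
  qed (use f sub in auto)
  then show thesis by (rule that)
qed

section \<open>Synthesis for nest algebra bimodules\<close>

text \<open>The sequence space as an instance of the theory above, which gives it the projection
  theorem and Cauchy-Schwarz.\<close>

abbreviation l2N :: "nat measure" where "l2N \<equiv> count_space UNIV"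

lemma sq_l2N: "c \<in> sq l2N \<longleftrightarrow> summable (\<lambda>i. (cmod (c i))\<^sup>2)"
  unfolding square_integrable_def by (simp add: integrable_count_space_nat_iff)

lemma ip_l2N: "c \<in> sq l2N \<Longrightarrow> d \<in> sq l2N \<Longrightarrow> (\<lambda>i. c i * cnj (d i)) sums ip l2N c d"
  unfolding ip_def by (rule sums_integral_count_space_nat) (rule integrable_ip)

lemma nrm_l2N: "c \<in> sq l2N \<Longrightarrow> (\<lambda>i. (cmod (c i))\<^sup>2) sums (nrm l2N c)\<^sup>2"
  unfolding nrm_sq by (rule sums_integral_count_space_nat) (rule sq_integrable)

definition unit_vec :: "nat \<Rightarrow> nat \<Rightarrow> complex" where
  "unit_vec j i = (if i = j then 1 else 0)"

lemma unit_vec_sq [simp, intro]: "unit_vec j \<in> sq l2N"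
  unfolding sq_l2N by (rule summable_finite[of "{j}"]) (auto simp: unit_vec_def)

lemma ip_unit_vec: "c \<in> sq l2N \<Longrightarrow> ip l2N c (unit_vec j) = c j"
proof -
  assume c: "c \<in> sq l2N"
  have "(\<lambda>i. c i * cnj (unit_vec j i)) sums (\<Sum>i\<in>{j}. c i * cnj (unit_vec j i))"
    by (rule sums_finite) (auto simp: unit_vec_def)
  then show ?thesis using ip_l2N[OF c unit_vec_sq, of j] by (simp add: sums_unique2 unit_vec_def)
qed

lemma l2N_tail:
  assumes c: "c \<in> sq l2N" and e: "e > 0"
  obtains m where "(\<lambda>i. if i < m then 0 else c i) \<in> sq l2N" "nrm l2N (\<lambda>i. if i < m then 0 else c i) < e"
proof -
  have s: "summable (\<lambda>i. (cmod (c i))\<^sup>2)" using c by (simp add: sq_l2N)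
  obtain m where m: "norm (\<Sum>i. (cmod (c (i + m)))\<^sup>2) < e\<^sup>2"
    using suminf_exist_split[OF _ s, of "e\<^sup>2"] e by auto
  let ?d = "\<lambda>i. if i < m then 0 else c i"
  have d: "?d \<in> sq l2N" unfolding sq_l2N by (rule summable_comparison_test'[OF s, of 0]) auto
  have "(nrm l2N ?d)\<^sup>2 = (\<Sum>i. (cmod (?d i))\<^sup>2)" using nrm_l2N[OF d] by (simp add: sums_iff)
  also have "\<dots> = (\<Sum>i. (cmod (?d (i + m)))\<^sup>2)"
    using suminf_split_initial_segment[of "\<lambda>i. (cmod (?d i))\<^sup>2" m] d by (simp add: sq_l2N)
  also have "\<dots> = (\<Sum>i. (cmod (c (i + m)))\<^sup>2)" by simp
  also have "\<dots> < e\<^sup>2" using m by simp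
  finally have "nrm l2N ?d < e" using e by (simp add: power2_less_imp_less[of _ e])
  with d show thesis by (rule that)
qed

text \<open>\<open>Q\<close> consists of the rational numbers and the jumps of \<open>t \<mapsto> \<parallel>Pr t e\<^sub>j\<parallel>\<^sup>2\<close>, which is monotone.\<close>

lemma chain_projection_pairing:
  fixes Pr :: "real \<Rightarrow> (nat \<Rightarrow> complex) \<Rightarrow> nat \<Rightarrow> complex"
  assumes sq: "\<And>t c. c \<in> sq l2N \<Longrightarrow> Pr t c \<in> sq l2N"
    and adj: "\<And>t c d. c \<in> sq l2N \<Longrightarrow> d \<in> sq l2N \<Longrightarrow> ip l2N (Pr t c) d = ip l2N c (Pr t d)"
    and nest: "\<And>s t c d. s \<le> t \<Longrightarrow> c \<in> sq l2N \<Longrightarrow> d \<in> sq l2N \<Longrightarrow> ip l2N (Pr s c) (Pr t d) = ip l2N (Pr s c) d"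
  obtains Q where "countable Q"
    "\<And>r c d. c \<in> sq l2N \<Longrightarrow> d \<in> sq l2N \<Longrightarrow>
      (\<And>t j. t \<in> Q \<Longrightarrow> t \<le> r \<Longrightarrow> ip l2N c (Pr t (unit_vec j)) = 0) \<Longrightarrow>
      (\<And>t j. t \<in> Q \<Longrightarrow> r \<le> t \<Longrightarrow> ip l2N d (\<lambda>i. unit_vec j i - Pr t (unit_vec j) i) = 0) \<Longrightarrow>
      ip l2N c d = 0"
proof -
  define p where "p j t = (nrm l2N (Pr t (unit_vec j)))\<^sup>2" for j t
  \<comment> \<open>Pythagoras for nested projections: it makes \<open>p j\<close> monotone and
    controls differences of projections by increments of \<open>p j\<close>.\<close>
  have pd: "(nrm l2N (\<lambda>i. Pr t (unit_vec j) i - Pr s (unit_vec j) i))\<^sup>2 = p j t - p j s" if "s \<le> t" for j s t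
  proof -
    let ?a = "Pr t (unit_vec j)" and ?b = "Pr s (unit_vec j)"
    have ab: "?a \<in> sq l2N" "?b \<in> sq l2N" using sq by auto
    have 1: "ip l2N ?b ?a = ip l2N ?b ?b" using nest[OF that, of "unit_vec j" "unit_vec j"] nest[of s s "unit_vec j" "unit_vec j"] by simp
    then have 2: "ip l2N ?a ?b = ip l2N ?b ?b" by (metis cnj_ip)
    have "complex_of_real ((nrm l2N (\<lambda>i. ?a i - ?b i))\<^sup>2) = complex_of_real (p j t - p j s)"
      unfolding ip_self[symmetric] using ab
      by (simp add: ip_diff_left ip_diff_right 1 2) (simp add: ip_self p_def)
    then show ?thesis by (simp only: of_real_eq_iff)
  qed
  have mono: "mono (p j)" for j
  proof (rule monoI)
    fix s t :: real assume "s \<le> t"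
    then show "p j s \<le> p j t" using pd[of s t j] zero_le_power2[of "nrm l2N (\<lambda>i. Pr t (unit_vec j) i - Pr s (unit_vec j) i)"] by simp
  qed
  define Q where "Q = \<rat> \<union> (\<Union>j. {t. \<not> isCont (p j) t})"
  have "countable Q" unfolding Q_def using mono by (auto intro!: countable_UN mono_ctble_discont countable_rat)
  moreover have "ip l2N c d = 0" if c: "c \<in> sq l2N" and d: "d \<in> sq l2N"
    and C: "\<And>t j. t \<in> Q \<Longrightarrow> t \<le> r \<Longrightarrow> ip l2N c (Pr t (unit_vec j)) = 0"
    and D: "\<And>t j. t \<in> Q \<Longrightarrow> r \<le> t \<Longrightarrow> ip l2N d (\<lambda>i. unit_vec j i - Pr t (unit_vec j) i) = 0" for r c d
  proof -
    have c0: "Pr t c = (\<lambda>_. 0)" if t: "t \<in> Q" "t \<le> r" for t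
    proof
      fix j
      have "Pr t c j = ip l2N (Pr t c) (unit_vec j)" using sq[OF c] by (simp add: ip_unit_vec)
      also have "\<dots> = 0" using C[OF t] adj[OF c unit_vec_sq] by simp
      finally show "Pr t c j = 0" .
    qed
    have d0: "Pr t d = d" if t: "t \<in> Q" "r \<le> t" for t
    proof
      fix j
      have "Pr t d j = ip l2N d (Pr t (unit_vec j))" using sq[OF d] adj[OF d unit_vec_sq] by (simp add: ip_unit_vec[symmetric])
      also have "\<dots> = ip l2N d (unit_vec j)" using D[OF t, of j] d sq by (simp add: ip_diff_right)
      finally show "Pr t d j = d j" using d by (simp add: ip_unit_vec)
    qed
    show ?thesis
    proof (cases "r \<in> Q")
      case True
      \<comment> \<open>At a level in \<open>Q\<close> a single projection fixes \<open>d\<close>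
        and kills \<open>c\<close>.\<close>
      have "ip l2N c d = ip l2N c (Pr r d)" using d0[OF True] by simp
      also have "\<dots> = ip l2N (Pr r c) d" using adj[OF c d] by simp
      also have "\<dots> = 0" using c0[OF True] by simp
      finally show ?thesis .
    next
      case False
      \<comment> \<open>At any other level all \<open>p j\<close> are continuous. For rational
        \<open>a < r < b\<close> the pairing equals that of \<open>c\<close> with
        \<open>Pr b d - Pr a d\<close>, whose coordinates are small when \<open>a\<close> and
        \<open>b\<close> are close to \<open>r\<close>; up to a tail of \<open>c\<close> only
        finitely many coordinates count.\<close>
      have cont: "isCont (p j) r" for j using False by (auto simp: Q_def)
      have small: "cmod (ip l2N c d) \<le> e" if e: "e > 0" for e
      proof -
        \<comment> \<open>Bounds the norm of \<open>g\<close>, so that the tail of \<open>c\<close>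
          contributes at most half of \<open>e\<close>; the 1 makes it positive.\<close>
        define B where "B = nrm l2N d + nrm l2N d + 1"
        have B: "B > 0" unfolding B_def using nrm_nonneg[of l2N d] by linarith
        obtain m where m: "(\<lambda>i. if i < m then 0 else c i) \<in> sq l2N" "nrm l2N (\<lambda>i. if i < m then 0 else c i) < e / (2 * B)"
          using l2N_tail[OF c, of "e / (2 * B)"] e B by auto
        let ?c = "\<lambda>i. if i < m then 0 else c i"
        define K where "K = (\<Sum>i<m. cmod (c i)) * nrm l2N d + 1"
        have K: "K > 0" unfolding K_def by (intro add_nonneg_pos mult_nonneg_nonneg sum_nonneg) auto
        \<comment> \<open>Twice this value bounds the increment of \<open>p i\<close> from
          \<open>a\<close> to \<open>b\<close>; the difference of the projections at
          \<open>unit_vec i\<close> then has norm at most \<open>e / (2 * K)\<close>.\<close>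
        define \<eta> where "\<eta> = (e / (2 * K))\<^sup>2 / 2"
        have \<eta>: "\<eta> > 0" using e K by (simp add: \<eta>_def)
        have ev: "\<forall>\<^sub>F t in at r. \<forall>i<m. \<bar>p i t - p i r\<bar> < \<eta>"
        proof -
          have "\<forall>\<^sub>F t in at r. \<forall>i\<in>{..<m}. \<bar>p i t - p i r\<bar> < \<eta>"
          proof (rule eventually_ball_finite, simp, rule ballI)
            fix i
            have "(p i \<longlongrightarrow> p i r) (at r)" using cont[of i] by (simp add: isCont_def)
            from tendstoD[OF this \<eta>] show "\<forall>\<^sub>F t in at r. \<bar>p i t - p i r\<bar> < \<eta>" by (simp add: dist_real_def)
          qed
          then show ?thesis by eventually_elim simp
        qed
        then obtain h where h: "h > 0" "\<And>t. t \<noteq> r \<Longrightarrow> dist t r < h \<Longrightarrow> \<forall>i<m. \<bar>p i t - p i r\<bar> < \<eta>"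
          unfolding eventually_at by auto
        obtain a where a: "a \<in> \<rat>" "r - h < a" "a < r" using Rats_dense_in_real[of "r - h" r] h by auto
        obtain b where b: "b \<in> \<rat>" "r < b" "b < r + h" using Rats_dense_in_real[of r "r + h"] h by auto
        have abQ: "a \<in> Q" "b \<in> Q" using a b by (auto simp: Q_def)
        define g where "g i = d i - Pr a d i" for i
        have g: "g \<in> sq l2N" unfolding g_def using d sq[OF d] by simp
        have cd: "ip l2N c d = ip l2N c g"
        proof -
          have "ip l2N c (Pr a d) = ip l2N (Pr a c) d" using adj[OF c d] by simp
          also have "\<dots> = 0" using c0[OF abQ(1)] a by simp
          finally show ?thesis unfolding g_def[abs_def] using c d sq[OF d] by (simp add: ip_diff_right)
        qed
        have ng: "nrm l2N g \<le> B"
        proof -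
          have z: "(\<lambda>_. 0) \<in> sq l2N" by simp
          have "nrm l2N g \<le> nrm l2N (\<lambda>i. d i - 0) + nrm l2N (\<lambda>i. 0 - Pr a d i)"
            unfolding g_def[abs_def] by (rule nrm_triangle_diff[OF d z sq[OF d]])
          also have "nrm l2N (\<lambda>i. 0 - Pr a d i) = nrm l2N (Pr a d)" using nrm_scale[of l2N "-1" "Pr a d"] by simp
          also have "nrm l2N (Pr a d) \<le> nrm l2N d"
          proof (cases "nrm l2N (Pr a d) = 0")
            case False
            have "complex_of_real ((nrm l2N (Pr a d))\<^sup>2) = ip l2N (Pr a d) d"
              using nest[of a a d d] d by (simp only: ip_self order_refl)
            then have "(nrm l2N (Pr a d))\<^sup>2 = cmod (ip l2N (Pr a d) d)"
              by (metis abs_of_nonneg norm_of_real zero_le_power2)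
            also have "\<dots> \<le> nrm l2N (Pr a d) * nrm l2N d" by (rule ip_bound[OF sq[OF d] d])
            finally show ?thesis using False by (simp add: power2_eq_square mult_le_cancel_left less_le)
          qed simp
          finally show ?thesis by (simp add: B_def)
        qed
        have gi: "cmod (g i) \<le> e / (2 * K) * nrm l2N d" if i: "i < m" for i
        proof -
          have gd: "g = (\<lambda>i. Pr b d i - Pr a d i)" using d0[OF abQ(2)] b by (simp add: g_def[abs_def])
          let ?u = "\<lambda>k. Pr b (unit_vec i) k - Pr a (unit_vec i) k"
          have "g i = ip l2N g (unit_vec i)" using g by (simp add: ip_unit_vec)
          also have "\<dots> = ip l2N d ?u"
            unfolding gd using sq[OF d] sq[OF unit_vec_sq] d
            by (simp add: ip_diff_left ip_diff_right adj)
          finally have "cmod (g i) \<le> nrm l2N d * nrm l2N ?u" using ip_bound[of d l2N ?u] d sq[OF unit_vec_sq] by simp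
          also have "\<dots> \<le> nrm l2N d * (e / (2 * K))"
          proof (intro mult_left_mono power2_le_imp_le[of "nrm l2N ?u"])
            have "(nrm l2N ?u)\<^sup>2 = p i b - p i a" using a b by (intro pd) simp
            also have "\<dots> \<le> \<eta> + \<eta>" using h(2)[of a] h(2)[of b] a b i by (fastforce simp: dist_real_def)
            also have "\<dots> = (e / (2 * K))\<^sup>2" by (simp add: \<eta>_def)
            finally show "(nrm l2N ?u)\<^sup>2 \<le> (e / (2 * K))\<^sup>2" .
          qed (use e K in simp_all)
          finally show ?thesis by (simp only: mult.commute)
        qed
        have fs: "(\<lambda>i. \<Sum>k<m. c k * unit_vec k i) \<in> sq l2N" by (intro sq_sum sq_scale unit_vec_sq)
        have "c = (\<lambda>i. ?c i + (\<Sum>k<m. c k * unit_vec k i))"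
          by (auto simp: fun_eq_iff unit_vec_def if_distrib[of "\<lambda>z. c _ * z"] sum.delta cong: if_cong)
        then have "ip l2N c g = ip l2N ?c g + (\<Sum>k<m. c k * ip l2N (unit_vec k) g)"
          using ip_add_left[OF m(1) fs g] g by (simp add: ip_sum_left ip_scale_left)
        moreover have "ip l2N (unit_vec k) g = cnj (g k)" for k using ip_unit_vec[OF g] by (metis cnj_ip)
        ultimately have "cmod (ip l2N c g) \<le> cmod (ip l2N ?c g) + (\<Sum>k<m. cmod (c k) * cmod (g k))"
          using norm_triangle_ineq[of "ip l2N ?c g" "\<Sum>k<m. c k * cnj (g k)"] norm_sum[of "\<lambda>k. c k * cnj (g k)" "{..<m}"]
          by (simp add: norm_mult)
        also have "cmod (ip l2N ?c g) \<le> e / (2 * B) * B"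
          using ip_bound[OF m(1) g] m(2) ng by (smt (verit) mult_mono nrm_nonneg)
        also have "e / (2 * B) * B = e / 2" using B by simp
        also have "(\<Sum>k<m. cmod (c k) * cmod (g k)) \<le> (\<Sum>k<m. cmod (c k) * (e / (2 * K) * nrm l2N d))"
          using gi by (intro sum_mono mult_left_mono) auto
        also have "\<dots> = (\<Sum>k<m. cmod (c k)) * (e / (2 * K) * nrm l2N d)" by (rule sum_distrib_right[symmetric])
        also have "\<dots> = (e / (2 * K)) * ((\<Sum>k<m. cmod (c k)) * nrm l2N d)" by (simp only: mult_ac)
        also have "\<dots> \<le> (e / (2 * K)) * K" using e K by (intro mult_left_mono) (auto simp: K_def)
        also have "(e / (2 * K)) * K = e / 2" using K by simp
        finally show ?thesis using cd by simp
      qed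
      have "cmod (ip l2N c d) \<le> 0"
      proof (rule field_le_epsilon)
        fix e :: real assume "0 < e"
        from small[OF this] show "cmod (ip l2N c d) \<le> 0 + e" by simp
      qed
      then show ?thesis by simp
    qed
  qed
  ultimately show thesis by (rule that)
qed

section \<open>Square integrable functions with values in the sequence space\<close>

lemma integral_mult_le:
  assumes f: "f \<in> sq M" and h: "h \<in> sq M"
  shows "(\<integral>t. cmod (f t) * cmod (h t) \<partial>M) \<le> nrm M f * nrm M h"
proof -
  let ?f = "\<lambda>t. complex_of_real (cmod (f t))" and ?h = "\<lambda>t. complex_of_real (cmod (h t))"
  have s: "?f \<in> sq M" "?h \<in> sq M" using f h by (auto simp: square_integrable_def)
  have "ip M ?f ?h = complex_of_real (\<integral>t. cmod (f t) * cmod (h t) \<partial>M)"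
    unfolding ip_def by (simp flip: integral_complex_of_real)
  then have "(\<integral>t. cmod (f t) * cmod (h t) \<partial>M) \<le> cmod (ip M ?f ?h)" by simp
  also have "\<dots> \<le> nrm M ?f * nrm M ?h" by (rule ip_bound[OF s])
  also have "\<dots> = nrm M f * nrm M h" by (simp add: nrm_def)
  finally show ?thesis .
qed

text \<open>The passage from a sequence of functions \<open>x i\<close> to a vector x(t) of the
  sequence space at almost every point.\<close>

lemma sq_seq_AE_l2N:
  assumes x: "sq_seq M x" shows "AE t in M. (\<lambda>i. x i t) \<in> sq l2N"
  unfolding sq_l2N
proof (rule AE_summable)
  show "integrable M (\<lambda>t. (cmod (x i t))\<^sup>2)" for i using sq_seqD(1)[OF x] by (rule sq_integrable)
  show "summable (\<lambda>i. \<integral>t. (cmod (x i t))\<^sup>2 \<partial>M)" using sq_seqD(2)[OF x] by (simp add: nrm_sq)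
qed simp

lemma sq_seq_suminf_integrable:
  assumes x: "sq_seq M x" shows "integrable M (\<lambda>t. \<Sum>i. (cmod (x i t))\<^sup>2)"
proof (rule integrable_suminf)
  show i: "integrable M (\<lambda>t. (cmod (x i t))\<^sup>2)" for i using sq_seqD(1)[OF x] by (rule sq_integrable)
  show "AE t in M. summable (\<lambda>i. norm ((cmod (x i t))\<^sup>2))"
    using sq_seq_AE_l2N[OF x] by (simp add: sq_l2N)
  show "summable (\<lambda>i. \<integral>t. norm ((cmod (x i t))\<^sup>2) \<partial>M)" using sq_seqD(2)[OF x] by (simp add: nrm_sq)
qed

text \<open>\<open>F\<close> is the pointwise inner product of x(t) with the fixed vector
  \<open>k\<close>, square integrable by Cauchy-Schwarz in the sequence space. Termwise integration
  rests on the summability of \<open>nrm M (x i)\<close> against the moduli of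
  \<open>k\<close>.\<close>

lemma series_combination:
  assumes x: "sq_seq M x" and k: "k \<in> sq l2N"
  defines "F \<equiv> (\<lambda>t. \<Sum>i. x i t * cnj (k i))"
  shows "F \<in> sq M" "h \<in> sq M \<Longrightarrow> (\<lambda>i. ip M (x i) h * cnj (k i)) sums ip M F h"
proof -
  note xs = sq_seqD(1)[OF x]
  have [measurable]: "x i \<in> borel_measurable M" for i using xs by (rule sq_measurable)
  have Fm: "F \<in> borel_measurable M" unfolding F_def by (rule borel_measurable_suminf) measurable
  have "integrable M (\<lambda>t. (nrm l2N k)\<^sup>2 * (\<Sum>i. (cmod (x i t))\<^sup>2))"
    using sq_seq_suminf_integrable[OF x] by simp
  then have "integrable M (\<lambda>t. (cmod (F t))\<^sup>2)"
  proof (rule Bochner_Integration.integrable_bound)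
    show "(\<lambda>t. (cmod (F t))\<^sup>2) \<in> borel_measurable M" using Fm by measurable
    show "AE t in M. norm ((cmod (F t))\<^sup>2) \<le> norm ((nrm l2N k)\<^sup>2 * (\<Sum>i. (cmod (x i t))\<^sup>2))"
      using sq_seq_AE_l2N[OF x]
    proof eventually_elim
      case (elim t)
      have "F t = ip l2N (\<lambda>i. x i t) k" unfolding F_def using ip_l2N[OF elim k] by (simp add: sums_iff)
      then have "(cmod (F t))\<^sup>2 \<le> (nrm l2N (\<lambda>i. x i t) * nrm l2N k)\<^sup>2" using ip_bound[OF elim k] by (simp add: power_mono)
      also have "\<dots> = (nrm l2N k)\<^sup>2 * (\<Sum>i. (cmod (x i t))\<^sup>2)"
        using nrm_l2N[OF elim] by (simp add: power_mult_distrib sums_iff)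
      finally show ?case by simp
    qed
  qed
  then show "F \<in> sq M" using Fm by (simp add: square_integrable_def)
  assume h: "h \<in> sq M"
  have [measurable]: "h \<in> borel_measurable M" using h by (rule sq_measurable)
  let ?g = "\<lambda>i t. (x i t * cnj (k i)) * cnj (h t)"
  have gi: "?g i = (\<lambda>t. (cnj (k i) * x i t) * cnj (h t))" for i by (simp add: mult_ac)
  have 1: "integrable M (?g i)" for i unfolding gi by (intro integrable_ip sq_scale xs h)
  have 2: "AE t in M. summable (\<lambda>i. norm (?g i t))"
    using sq_seq_AE_l2N[OF x]
  proof eventually_elim
    case (elim t)
    have "integrable l2N (\<lambda>i. cmod (x i t) * cmod (k i))" by (rule integrable_sq_mult[OF elim k])
    then have "summable (\<lambda>i. cmod (x i t) * cmod (k i))" by (simp add: integrable_count_space_nat_iff abs_mult)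
    then show ?case by (simp add: norm_mult summable_mult2)
  qed
  have 3: "summable (\<lambda>i. \<integral>t. norm (?g i t) \<partial>M)"
  proof (rule summable_comparison_test')
    \<comment> \<open>The moduli of \<open>k\<close> appear as norms of multiples of one unit
      vector, which brings the pairing within reach of \<open>sq_seq_mult_summable\<close>.\<close>
    have n1: "nrm l2N (\<lambda>j. cmod (k i) * unit_vec 0 j) = cmod (k i)" for i
    proof -
      have "complex_of_real ((nrm l2N (unit_vec 0))\<^sup>2) = 1"
        unfolding ip_self[symmetric] ip_unit_vec[OF unit_vec_sq] by (simp add: unit_vec_def)
      then have "(nrm l2N (unit_vec 0))\<^sup>2 = 1" by (simp only: of_real_eq_1_iff)
      then have "nrm l2N (unit_vec 0) = 1" using nrm_nonneg[of l2N "unit_vec 0"] by (metis power2_eq_1_iff one_neq_neg_one abs_of_nonneg abs_minus abs_1)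
      then show ?thesis by (simp add: nrm_scale)
    qed
    have "sq_seq l2N (\<lambda>i j. cmod (k i) * unit_vec 0 j)"
      unfolding sq_seq_def n1 using k by (intro conjI allI sq_scale unit_vec_sq) (simp add: sq_l2N)
    from summable_mult[OF sq_seq_mult_summable[OF x this], of "nrm M h"]
    show "summable (\<lambda>i. nrm M h * (nrm M (x i) * nrm l2N (\<lambda>j. cmod (k i) * unit_vec 0 j)))" .
    fix i
    have "norm (?g i t) = cmod (k i) * (cmod (x i t) * cmod (h t))" for t by (simp add: norm_mult)
    then have gint: "(\<integral>t. norm (?g i t) \<partial>M) = cmod (k i) * (\<integral>t. cmod (x i t) * cmod (h t) \<partial>M)"
      by (simp only: integral_mult_right_zero)
    have hint: "(\<integral>t. cmod (x i t) * cmod (h t) \<partial>M) \<le> nrm M (x i) * nrm M h" by (rule integral_mult_le[OF xs h])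
    have "(\<integral>t. norm (?g i t) \<partial>M) \<le> cmod (k i) * (nrm M (x i) * nrm M h)"
      unfolding gint by (intro mult_left_mono hint) simp
    then have "(\<integral>t. norm (?g i t) \<partial>M) \<le> nrm M h * (nrm M (x i) * cmod (k i))" by (simp only: mult_ac)
    then show "norm (\<integral>t. norm (?g i t) \<partial>M) \<le> nrm M h * (nrm M (x i) * nrm l2N (\<lambda>j. cmod (k i) * unit_vec 0 j))"
      unfolding n1 by (simp add: integral_nonneg_AE)
  qed
  have "(\<lambda>i. integral\<^sup>L M (?g i)) sums (\<integral>t. (\<Sum>i. ?g i t) \<partial>M)" by (rule sums_integral[OF 1 2 3])
  moreover have "integral\<^sup>L M (?g i) = ip M (x i) h * cnj (k i)" for i
    unfolding ip_def by (simp add: mult.commute mult.left_commute flip: integral_mult_right_zero)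
  moreover have "(\<integral>t. (\<Sum>i. ?g i t) \<partial>M) = ip M F h"
    unfolding ip_def
  proof (rule integral_cong_AE)
    show "(\<lambda>t. \<Sum>i. ?g i t) \<in> borel_measurable M" by (rule borel_measurable_suminf) measurable
    show "(\<lambda>t. F t * cnj (h t)) \<in> borel_measurable M" using Fm by measurable
    show "AE t in M. (\<Sum>i. ?g i t) = F t * cnj (h t)"
      using sq_seq_AE_l2N[OF x]
    proof eventually_elim
      case (elim t)
      show ?case unfolding F_def using ip_l2N[OF elim k] by (intro suminf_mult2[symmetric]) (simp add: sums_iff)
    qed
  qed
  ultimately show "(\<lambda>i. ip M (x i) h * cnj (k i)) sums ip M F h" by simp
qed

lemma AE_zero_on:
  assumes S: "S \<in> sets M" and F: "F \<in> sq M" and z: "\<And>b. b \<in> sq M \<Longrightarrow> ip M F (restr S b) = 0"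
  shows "AE t in M. t \<in> S \<longrightarrow> F t = 0"
proof -
  have "ip M (restr S F) (restr S F) = ip M F (restr S F)" unfolding ip_restr restr_restr by simp
  then have "nrm M (restr S F) = 0" using z[OF F] by (simp add: ip_self)
  then have "AE t in M. restr S F t = 0" using S F by (simp add: nrm_eq_0_iff)
  then show ?thesis by eventually_elim (auto simp: restr_def)
qed

lemma level_bimoduleD:
  assumes "level_bimodule M N f W"
  shows "f \<in> borel_measurable M" "op_subspace M N W" "wcl M N W \<subseteq> W"
    "T \<in> W \<Longrightarrow> S \<in> sets M \<Longrightarrow> R \<in> sets N \<Longrightarrow> block M N S R T \<in> W"
    "T \<in> W \<Longrightarrow> a \<in> sq M \<Longrightarrow> b \<in> sq M \<Longrightarrow> \<exists>T'\<in>W. \<forall>u\<in>sq M. \<forall>g\<in>sq N.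
      form M N T' u g = ip M u (restr (suplevel M f t) b) * form M N T (restr (sublevel M f t) a) g"
    "W \<subseteq> bounded_ops M N"
  using assms by (auto simp: level_bimodule_def op_subspace_def)

text \<open>A double orthogonal complement is the closed span of \<open>G\<close>; being closed, it
  contains the projection itself and not only approximations.\<close>

lemma double_annihilator_projection:
  assumes G: "G \<subseteq> sq M"
  defines "K \<equiv> {k \<in> sq M. \<forall>q\<in>sq M. (\<forall>m\<in>G. ip M m q = 0) \<longrightarrow> ip M k q = 0}"
  shows "c \<in> sq M \<Longrightarrow> \<exists>p\<in>K. \<forall>k\<in>K. ip M k (\<lambda>x. c x - p x) = 0"
proof -
  assume c: "c \<in> sq M"
  have K: "subsp M K" unfolding subsp_def K_def by (auto simp: ip_add_left ip_scale_left)
  obtain p where p: "p \<in> sq M" "\<And>k. k \<in> K \<Longrightarrow> ip M (\<lambda>x. c x - p x) k = 0"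
    "\<And>e. e > 0 \<Longrightarrow> \<exists>k\<in>K. nrm M (\<lambda>x. p x - k x) < e" using projection[OF K c] by blast
  have "ip M p q = 0" if q: "q \<in> sq M" "\<forall>m\<in>G. ip M m q = 0" for q
  proof (rule limit_zero_ip[OF p(1) q(1)])
    fix e :: real assume "e > 0"
    then obtain k where "k \<in> K" "nrm M (\<lambda>x. p x - k x) < e" using p(3) by blast
    then show "\<exists>k\<in>sq M. ip M k q = 0 \<and> nrm M (\<lambda>x. p x - k x) < e" using q by (auto simp: K_def)
  qed
  then have "p \<in> K" using p(1) by (simp add: K_def)
  moreover have "ip M k (\<lambda>x. c x - p x) = 0" if "k \<in> K" for k using p(2)[OF that] by (metis cnj_ip complex_cnj_zero)
  ultimately show ?thesis by blast
qed

text \<open>In terms of vectors, \<open>hyp\<close> says that \<open>T\<close> maps functions living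
  on {f \<le> t} into the closed span of the images of such functions under
  \<open>W\<close>.\<close>

theorem level_bimodule_synthesis:
  assumes W: "level_bimodule M N f W" and T: "T \<in> bounded_ops M N"
    and hyp: "\<And>t u g. u \<in> sq M \<Longrightarrow> g \<in> sq N \<Longrightarrow>
      (\<And>S a. S \<in> W \<Longrightarrow> a \<in> sq M \<Longrightarrow> form M N S (restr (sublevel M f t) a) g = 0) \<Longrightarrow>
      form M N T (restr (sublevel M f t) u) g = 0"
  shows "T \<in> W"
proof (rule ccontr)
  assume "T \<notin> W"
  note f = level_bimoduleD(1)[OF W] and sub = level_bimoduleD(2)[OF W] and Wb = level_bimoduleD(6)[OF W]
  have "T \<notin> wcl M N W" using level_bimoduleD(3)[OF W] \<open>T \<notin> W\<close> by blast
  then obtain x y where x: "sq_seq M x" and y: "sq_seq N y" and kill: "\<And>S. S \<in> W \<Longrightarrow> vfun M N x y S = 0"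
    and nz: "vfun M N x y T \<noteq> 0" using wcl_separation[OF sub T] by metis
  note xs = sq_seqD(1)[OF x] and ys = sq_seqD(1)[OF y]
  let ?L = "sublevel M f" and ?U = "suplevel M f"
  have Ls: "?L t \<in> sets M" and Us: "?U t \<in> sets M" for t using sublevel_sets[OF f] suplevel_sets[OF f] by auto
  obtain C where C: "bform M N C (form M N T)" using form_bform[OF T] .
  \<comment> \<open>\<open>v i\<close> is the adjoint of \<open>T\<close> at
    \<open>y i\<close>.\<close>
  have "\<exists>v\<in>sq M. \<forall>u\<in>sq M. form M N T u (y i) = ip M u v" for i
    using bformD[OF C] ys[of i] by (intro riesz_ex[where C = "C * nrm N (y i)"]) (auto simp: mult_ac)
  then obtain v where v: "\<And>i. v i \<in> sq M" "\<And>i u. u \<in> sq M \<Longrightarrow> form M N T u (y i) = ip M u (v i)" by metis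
  have nv: "nrm M (v i) \<le> C * nrm N (y i)" for i
  proof (cases "nrm M (v i) = 0")
    case False
    have "complex_of_real (nrm M (v i) * nrm M (v i)) = form M N T (v i) (y i)"
      by (simp add: v ip_self power2_eq_square)
    then have "nrm M (v i) * nrm M (v i) = cmod (form M N T (v i) (y i))"
      by (metis abs_of_nonneg mult_nonneg_nonneg norm_of_real nrm_nonneg)
    also have "\<dots> \<le> C * nrm M (v i) * nrm N (y i)" by (rule bformD(6)[OF C v(1) ys])
    finally have "nrm M (v i) * nrm M (v i) \<le> nrm M (v i) * (C * nrm N (y i))" by (simp only: mult_ac)
    then show ?thesis using False by (simp add: mult_le_cancel_left less_le)
  qed (use bformD(1)[OF C] in simp)
  have vseq: "sq_seq M v"
    unfolding sq_seq_def
  proof (intro conjI allI v(1))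
    show "summable (\<lambda>i. (nrm M (v i))\<^sup>2)"
    proof (rule summable_comparison_test')
      show "summable (\<lambda>i. C\<^sup>2 * (nrm N (y i))\<^sup>2)" by (rule summable_mult[OF sq_seqD(2)[OF y]])
      show "norm ((nrm M (v i))\<^sup>2) \<le> C\<^sup>2 * (nrm N (y i))\<^sup>2" for i
        using power_mono[OF nv[of i], of 2] by (simp add: power_mult_distrib)
    qed
  qed
  \<comment> \<open>The conjugate is there because \<open>ip l2N\<close> conjugates its second
    argument.\<close>
  define G where "G t = {(\<lambda>i. cnj (form M N S (restr (?L t) a) (y i))) | S a. S \<in> W \<and> a \<in> sq M}" for t
  have Gsq: "G t \<subseteq> sq l2N" for t
  proof
    fix m assume "m \<in> G t"
    then obtain S a where m: "m = (\<lambda>i. cnj (form M N S (restr (?L t) a) (y i)))" and S: "S \<in> W" and a: "a \<in> sq M"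
      by (auto simp: G_def)
    obtain D where D: "bform M N D (form M N S)" using form_bform S Wb by blast
    have ca: "restr (?L t) a \<in> sq M" using Ls a by simp
    show "m \<in> sq l2N"
      unfolding sq_l2N
    proof (rule summable_comparison_test')
      show "summable (\<lambda>i. (D * nrm M (restr (?L t) a))\<^sup>2 * (nrm N (y i))\<^sup>2)" by (rule summable_mult[OF sq_seqD(2)[OF y]])
      show "norm ((cmod (m i))\<^sup>2) \<le> (D * nrm M (restr (?L t) a))\<^sup>2 * (nrm N (y i))\<^sup>2" for i
        using power_mono[OF bformD(6)[OF D ca ys[of i]], of 2] by (simp add: m power_mult_distrib)
    qed
  qed
  have Gmono: "G s \<subseteq> G t" if st: "s \<le> t" for s t
  proof
    fix m assume "m \<in> G s"
    then obtain S a where m: "m = (\<lambda>i. cnj (form M N S (restr (?L s) a) (y i)))" "S \<in> W" "a \<in> sq M"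
      by (auto simp: G_def)
    have "restr (?L s) a = restr (?L t) (restr (?L s) a)"
      using st by (auto simp: restr_def fun_eq_iff split: split_indicator)
    then have "m = (\<lambda>i. cnj (form M N S (restr (?L t) (restr (?L s) a)) (y i)))" using m(1) by simp
    moreover have "restr (?L s) a \<in> sq M" using m(3) Ls by simp
    ultimately show "m \<in> G t" unfolding G_def using m(2) by blast
  qed
  \<comment> \<open>The closed span of \<open>G t\<close>; \<open>x(s)\<close> is orthogonal to it for \<open>t \<le> f s\<close> and \<open>v(s)\<close> belongs to it for \<open>f s \<le> t\<close>.\<close>
  define K where "K t = {k \<in> sq l2N. \<forall>q\<in>sq l2N. (\<forall>m\<in>G t. ip l2N m q = 0) \<longrightarrow> ip l2N k q = 0}" for t
  have Kmono: "K s \<subseteq> K t" if "s \<le> t" for s t using Gmono[OF that] unfolding K_def by blast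
  have Pr_ex: "\<exists>p. p \<in> K t \<and> (\<forall>k\<in>K t. ip l2N k (\<lambda>x. c x - p x) = 0)" if "c \<in> sq l2N" for c t
    using double_annihilator_projection[OF Gsq that, of t] unfolding K_def by blast
  define Pr where "Pr t c = (SOME p. p \<in> K t \<and> (\<forall>k\<in>K t. ip l2N k (\<lambda>x. c x - p x) = 0))" for t c
  have Pr: "Pr t c \<in> K t" "k \<in> K t \<Longrightarrow> ip l2N k (\<lambda>x. c x - Pr t c x) = 0" if "c \<in> sq l2N" for t c k
    using someI_ex[OF Pr_ex[OF that, of t]] unfolding Pr_def by blast+
  have Ksq: "k \<in> sq l2N" if "k \<in> K t" for k t using that by (simp add: K_def)
  have Prs: "Pr t c \<in> sq l2N" if "c \<in> sq l2N" for t c using Ksq[OF Pr(1)[OF that]] .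
  have nst: "ip l2N (Pr s c) (Pr t d) = ip l2N (Pr s c) d" if "s \<le> t" "c \<in> sq l2N" "d \<in> sq l2N" for s t c d
  proof -
    have "Pr s c \<in> K t" using Pr(1)[OF that(2), of s] Kmono[OF that(1)] by blast
    from Pr(2)[OF that(3) this] show ?thesis using that Prs by (simp add: ip_diff_right)
  qed
  have adj: "ip l2N (Pr t c) d = ip l2N c (Pr t d)" if "c \<in> sq l2N" "d \<in> sq l2N" for t c d
  proof -
    have "ip l2N (Pr t c) d = ip l2N (Pr t c) (Pr t d)" using nst[of t t c d] that by simp
    also have "\<dots> = cnj (ip l2N (Pr t d) (Pr t c))" by (simp add: cnj_ip)
    also have "\<dots> = cnj (ip l2N (Pr t d) c)" using nst[of t t d c] that by simp
    finally show ?thesis by (simp add: cnj_ip)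
  qed
  obtain Q where Q: "countable Q" and pairing: "\<And>r c d. c \<in> sq l2N \<Longrightarrow> d \<in> sq l2N \<Longrightarrow>
      (\<And>t j. t \<in> Q \<Longrightarrow> t \<le> r \<Longrightarrow> ip l2N c (Pr t (unit_vec j)) = 0) \<Longrightarrow>
      (\<And>t j. t \<in> Q \<Longrightarrow> r \<le> t \<Longrightarrow> ip l2N d (\<lambda>i. unit_vec j i - Pr t (unit_vec j) i) = 0) \<Longrightarrow> ip l2N c d = 0"
    using chain_projection_pairing[of Pr, OF Prs adj nst] by blast
  \<comment> \<open>The functional is applied to an element of \<open>W\<close> composed with a rank
    one operator. Its value factors into \<open>ip l2N z m\<close> with \<open>m\<close> in
    \<open>G t\<close>, and it is zero because the composition is in \<open>W\<close>;
    \<open>K t\<close> inherits the orthogonality by definition.\<close>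
  have left: "AE s in M. s \<in> ?U t \<longrightarrow> (\<Sum>i. x i s * cnj (k i)) = 0" if k: "k \<in> K t" for k t
  proof (rule AE_zero_on[OF Us])
    note F = series_combination[OF x Ksq[OF k]]
    show "(\<lambda>s. \<Sum>i. x i s * cnj (k i)) \<in> sq M" by (rule F(1))
    fix b assume b: "b \<in> sq M"
    have cb: "restr (?U t) b \<in> sq M" using b Us by simp
    define z where "z i = ip M (x i) (restr (?U t) b)" for i
    have z: "z \<in> sq l2N"
      unfolding sq_l2N
    proof (rule summable_comparison_test')
      show "summable (\<lambda>i. (nrm M (x i))\<^sup>2 * (nrm M (restr (?U t) b))\<^sup>2)" by (rule summable_mult2[OF sq_seqD(2)[OF x]])
      show "norm ((cmod (z i))\<^sup>2) \<le> (nrm M (x i))\<^sup>2 * (nrm M (restr (?U t) b))\<^sup>2" for i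
        using power_mono[OF ip_bound[OF xs[of i] cb], of 2] by (simp add: z_def power_mult_distrib)
    qed
    have "ip l2N m z = 0" if mG: "m \<in> G t" for m
    proof -
      obtain S a where m: "m = (\<lambda>i. cnj (form M N S (restr (?L t) a) (y i)))" and S: "S \<in> W" and a: "a \<in> sq M"
        using mG by (auto simp: G_def)
      obtain R where R: "R \<in> W" "\<And>u g. u \<in> sq M \<Longrightarrow> g \<in> sq N \<Longrightarrow>
          form M N R u g = ip M u (restr (?U t) b) * form M N S (restr (?L t) a) g"
        using level_bimoduleD(5)[OF W S a b, of t] by blast
      have Rb: "R \<in> bounded_ops M N" using R(1) Wb by blast
      have msq: "m \<in> sq l2N" using mG Gsq by blast
      have "(\<lambda>i. z i * cnj (m i)) sums vfun M N x y R"
        using vfun_sums[OF Rb x y] by (simp add: R(2)[OF xs ys] z_def m)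
      then have "ip l2N z m = 0" using ip_l2N[OF z msq] kill[OF R(1)] sums_unique2 by metis
      then show ?thesis by (metis cnj_ip complex_cnj_zero)
    qed
    then have "ip l2N k z = 0" using k z by (simp add: K_def)
    then have "ip l2N z k = 0" by (metis cnj_ip complex_cnj_zero)
    then show "ip M (\<lambda>s. \<Sum>i. x i s * cnj (k i)) (restr (?U t) b) = 0"
      using sums_unique2[OF F(2)[OF cb] ip_l2N[OF z Ksq[OF k], unfolded z_def]] unfolding z_def by simp
  qed
  \<comment> \<open>If \<open>q\<close> is orthogonal to \<open>G t\<close>, the combination
    \<open>Y\<close> of the \<open>y i\<close> is annihilated by \<open>W\<close> on {f \<le> t},
    and \<open>hyp\<close> transfers this to \<open>T\<close>.\<close>
  have right: "AE s in M. s \<in> ?L t \<longrightarrow> (\<Sum>i. v i s * cnj (q i)) = 0"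
    if q: "q \<in> sq l2N" and qG: "\<And>m. m \<in> G t \<Longrightarrow> ip l2N m q = 0" for q t
  proof (rule AE_zero_on[OF Ls])
    note F = series_combination[OF vseq q]
    show "(\<lambda>s. \<Sum>i. v i s * cnj (q i)) \<in> sq M" by (rule F(1))
    define Y where "Y s = (\<Sum>i. y i s * cnj (q i))" for s
    note Y = series_combination[OF y q, folded Y_def[abs_def]]
    have formY: "(\<lambda>i. form M N S u (y i) * q i) sums form M N S u Y" if S: "S \<in> bounded_ops M N" and u: "u \<in> sq M" for S u
    proof -
      have su: "app M S u \<in> sq N" using S u by simp
      have "(\<lambda>i. cnj (ip N (y i) (app M S u) * cnj (q i))) sums cnj (ip N Y (app M S u))"
        using Y(2)[OF su] by (simp only: sums_cnj)
      then show ?thesis by (simp add: form_def cnj_ip)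
    qed
    fix b assume b: "b \<in> sq M"
    have cb: "restr (?L t) b \<in> sq M" using b Ls by simp
    have "form M N T (restr (?L t) b) Y = 0"
    proof (rule hyp[OF b Y(1)])
      fix S a assume S: "S \<in> W" and a: "a \<in> sq M"
      define m where "m = (\<lambda>i. cnj (form M N S (restr (?L t) a) (y i)))"
      have mG: "m \<in> G t" unfolding G_def m_def using S a by blast
      then have m: "m \<in> sq l2N" using Gsq by blast
      have ca: "restr (?L t) a \<in> sq M" using a Ls by simp
      have Sb: "S \<in> bounded_ops M N" using S Wb by blast
      have "ip l2N q m = 0" using qG[OF mG] by (metis cnj_ip complex_cnj_zero)
      then have "(\<lambda>i. form M N S (restr (?L t) a) (y i) * q i) sums 0"
        using ip_l2N[OF q m] by (simp add: m_def mult.commute)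
      then show "form M N S (restr (?L t) a) Y = 0" using formY[OF Sb ca] sums_unique2 by blast
    qed
    then have "(\<lambda>i. ip M (restr (?L t) b) (v i) * q i) sums 0"
      using formY[OF T cb] by (simp add: v(2)[OF cb])
    then have "(\<lambda>i. cnj (ip M (restr (?L t) b) (v i) * q i)) sums cnj 0" by (simp only: sums_cnj)
    then have "(\<lambda>i. ip M (v i) (restr (?L t) b) * cnj (q i)) sums 0" by (simp add: cnj_ip)
    then show "ip M (\<lambda>s. \<Sum>i. v i s * cnj (q i)) (restr (?L t) b) = 0" using F(2)[OF cb] sums_unique2 by blast
  qed
  \<comment> \<open>Countability of \<open>Q\<close> merges the exceptional sets of all levels and
    unit vectors into one null set.\<close>
  have A1: "AE s in M. \<forall>t\<in>Q. \<forall>j. t \<le> f s \<longrightarrow> (\<Sum>i. x i s * cnj (Pr t (unit_vec j) i)) = 0"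
  proof (intro AE_ball_countable'[OF _ Q] AE_all_countable[THEN iffD2] allI)
    fix t j
    show "AE s in M. t \<le> f s \<longrightarrow> (\<Sum>i. x i s * cnj (Pr t (unit_vec j) i)) = 0"
      using left[OF Pr(1)[OF unit_vec_sq, of t j]] AE_space by eventually_elim simp
  qed
  have A2: "AE s in M. \<forall>t\<in>Q. \<forall>j. f s \<le> t \<longrightarrow> (\<Sum>i. v i s * cnj (unit_vec j i - Pr t (unit_vec j) i)) = 0"
  proof (intro AE_ball_countable'[OF _ Q] AE_all_countable[THEN iffD2] allI)
    fix t j
    let ?q = "\<lambda>i. unit_vec j i - Pr t (unit_vec j) i"
    have "?q \<in> sq l2N" using Prs by simp
    moreover have "ip l2N m ?q = 0" if "m \<in> G t" for m
    proof -
      have "m \<in> K t" using that Gsq unfolding K_def by blast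
      then show ?thesis by (rule Pr(2)[OF unit_vec_sq])
    qed
    ultimately have "AE s in M. s \<in> ?L t \<longrightarrow> (\<Sum>i. v i s * cnj (?q i)) = 0" by (rule right)
    then show "AE s in M. f s \<le> t \<longrightarrow> (\<Sum>i. v i s * cnj (?q i)) = 0"
      using AE_space by eventually_elim simp
  qed
  have zero: "AE s in M. (\<Sum>i. x i s * cnj (v i s)) = 0"
    using A1 A2 sq_seq_AE_l2N[OF x] sq_seq_AE_l2N[OF vseq]
  proof eventually_elim
    case (elim s)
    let ?c = "\<lambda>i. x i s" and ?d = "\<lambda>i. v i s"
    have sm: "(\<Sum>i. c i * cnj (d i)) = ip l2N c d" if "c \<in> sq l2N" "d \<in> sq l2N" for c d
      using ip_l2N[OF that] by (simp add: sums_iff)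
    have "ip l2N ?c ?d = 0"
    proof (rule pairing[where r = "f s", OF elim(3,4)])
      fix t j assume "t \<in> Q" "t \<le> f s"
      then show "ip l2N ?c (Pr t (unit_vec j)) = 0" using elim(1) sm[OF elim(3) Prs[OF unit_vec_sq]] by metis
    next
      fix t j assume t: "t \<in> Q" "f s \<le> t"
      have "(\<lambda>i. unit_vec j i - Pr t (unit_vec j) i) \<in> sq l2N" using Prs by simp
      from sm[OF elim(4) this] show "ip l2N ?d (\<lambda>i. unit_vec j i - Pr t (unit_vec j) i) = 0" using elim(2) t by metis
    qed
    then show ?case using sm[OF elim(3,4)] by simp
  qed
  have "vfun M N x y T = (\<Sum>i. ip M (x i) (v i))" unfolding vfun_def by (simp add: v(2)[OF xs])
  also have "\<dots> = (\<integral>s. (\<Sum>i. x i s * cnj (v i s)) \<partial>M)"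
    unfolding ip_def
  proof (rule integral_suminf[symmetric])
    show "integrable M (\<lambda>s. x i s * cnj (v i s))" for i by (rule integrable_ip[OF xs v(1)])
    show "AE s in M. summable (\<lambda>i. norm (x i s * cnj (v i s)))"
      using sq_seq_AE_l2N[OF x] sq_seq_AE_l2N[OF vseq]
    proof eventually_elim
      case (elim s)
      then show ?case using integrable_sq_mult[OF elim] by (simp add: integrable_count_space_nat_iff norm_mult abs_mult)
    qed
    show "summable (\<lambda>i. \<integral>s. norm (x i s * cnj (v i s)) \<partial>M)"
    proof (rule summable_comparison_test')
      show "summable (\<lambda>i. nrm M (x i) * nrm M (v i))" by (rule sq_seq_mult_summable[OF x vseq])
      show "norm (\<integral>s. norm (x i s * cnj (v i s)) \<partial>M) \<le> nrm M (x i) * nrm M (v i)" for i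
        using integral_mult_le[OF xs v(1), of i i] by (simp add: norm_mult integral_nonneg_AE)
    qed
  qed
  also have "\<dots> = (\<integral>s. 0 \<partial>M)"
  proof (rule integral_cong_AE)
    have [measurable]: "x i \<in> borel_measurable M" "v i \<in> borel_measurable M" for i
      using xs v(1) sq_measurable by auto
    show "(\<lambda>s. \<Sum>i. x i s * cnj (v i s)) \<in> borel_measurable M" by (rule borel_measurable_suminf) measurable
  qed (use zero in auto)
  finally show False using nz by simp
qed

section \<open>Sums with bimodules of finite width\<close>

lemma AE_mult_cnj_zero:
  assumes sf: "sigma_finite_measure N" and p: "p \<in> sq N" and n: "n \<in> sq N"
    and z: "\<And>R. R \<in> sets N \<Longrightarrow> ip N (restr R p) n = 0"
  shows "AE s in N. p s = 0 \<or> n s = 0"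
proof -
  interpret sigma_finite_measure N by fact
  have "AE s in N. p s * cnj (n s) = 0"
  proof (rule density_zero[OF integrable_ip[OF p n]])
    fix R assume "R \<in> sets N"
    moreover have "(\<lambda>s. indicat_real R s *\<^sub>R (p s * cnj (n s))) = (\<lambda>s. restr R p s * cnj (n s))"
      by (auto simp: fun_eq_iff restr_def split: split_indicator)
    ultimately show "set_lebesgue_integral N R (\<lambda>s. p s * cnj (n s)) = 0"
      using z by (simp add: ip_def set_lebesgue_integral_def)
  qed
  then show ?thesis by simp
qed

text \<open>The annihilator is closed and stable under restriction to sets, so the projection onto
  it is multiplication by an indicator; \<open>R\<close> is the complement of the corresponding
  set.\<close>

lemma annihilator_support:
  assumes sf: "sigma_finite_measure N" and W: "W \<subseteq> bounded_ops M N" and a: "A \<subseteq> sq M"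
    and inv: "\<And>S h R. S \<in> W \<Longrightarrow> h \<in> A \<Longrightarrow> R \<in> sets N \<Longrightarrow>
      \<exists>S'\<in>W. \<forall>g\<in>sq N. form M N S' h g = form M N S h (restr R g)"
  obtains R where "R \<in> sets N"
    "\<And>g. g \<in> sq N \<Longrightarrow> (\<forall>S\<in>W. \<forall>h\<in>A. form M N S h g = 0) \<longleftrightarrow> (AE s in N. s \<in> R \<longrightarrow> g s = 0)"
proof -
  define K where "K = {g \<in> sq N. \<forall>S\<in>W. \<forall>h\<in>A. form M N S h g = 0}"
  have Ka: "K = {g \<in> sq N. \<forall>S\<in>W. \<forall>h\<in>A. ip N (app M S h) g = 0}" by (simp add: K_def form_def)
  have as: "app M S h \<in> sq N" if "S \<in> W" "h \<in> A" for S h using that W a by (intro app_sq) auto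
  have K: "subsp N K" unfolding subsp_def Ka using as by (auto simp: ip_add_right ip_scale_right)
  have Kcut: "restr R g \<in> K" if R: "R \<in> sets N" and g: "g \<in> K" for R g
  proof -
    have gs: "g \<in> sq N" using g by (simp add: K_def)
    have "form M N S h (restr R g) = 0" if S: "S \<in> W" and h: "h \<in> A" for S h
    proof -
      obtain S' where S': "S' \<in> W" "\<And>g. g \<in> sq N \<Longrightarrow> form M N S' h g = form M N S h (restr R g)" using inv[OF S h R] by blast
      have "form M N S h (restr R g) = form M N S' h g" using S'(2)[OF gs] by simp
      also have "\<dots> = 0" using g S'(1) h by (simp add: K_def)
      finally show ?thesis .
    qed
    then show ?thesis using R gs by (simp add: K_def)
  qed
  have Kcong: "g \<in> K" if "g \<in> sq N" "h \<in> K" "AE s in N. g s = h s" for g h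
  proof -
    have "ip N (app M S u) g = 0" if "S \<in> W" "u \<in> A" for S u
    proof -
      have hs: "h \<in> sq N" using \<open>h \<in> K\<close> by (simp add: K_def)
      have "ip N (app M S u) g = ip N (app M S u) h"
        by (rule ip_cong_AE) (use as[OF that] \<open>g \<in> sq N\<close> hs \<open>AE s in N. g s = h s\<close> in auto)
      then show ?thesis using \<open>h \<in> K\<close> that by (simp add: Ka)
    qed
    then show ?thesis using \<open>g \<in> sq N\<close> by (simp add: Ka)
  qed
  have decomp: "\<exists>p\<in>K. \<forall>k\<in>K. ip N k (\<lambda>s. g s - p s) = 0" if g: "g \<in> sq N" for g
  proof -
    obtain p where p: "p \<in> sq N" "\<And>k. k \<in> K \<Longrightarrow> ip N (\<lambda>x. g x - p x) k = 0"
      "\<And>e. e > 0 \<Longrightarrow> \<exists>k\<in>K. nrm N (\<lambda>x. p x - k x) < e" using projection[OF K g] by blast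
    have "ip N p (app M S h) = 0" if S: "S \<in> W" and h: "h \<in> A" for S h
    proof (rule limit_zero_ip[OF p(1) as[OF S h]])
      fix e :: real assume "e > 0"
      then obtain k where k: "k \<in> K" "nrm N (\<lambda>x. p x - k x) < e" using p(3) by blast
      then have "ip N (app M S h) k = 0" using S h by (simp add: Ka)
      then have "ip N k (app M S h) = 0" by (metis cnj_ip complex_cnj_zero)
      then show "\<exists>k\<in>sq N. ip N k (app M S h) = 0 \<and> nrm N (\<lambda>x. p x - k x) < e"
        using k subspD(1)[OF K] by blast
    qed
    then have "ip N (app M S h) p = 0" if "S \<in> W" "h \<in> A" for S h
      using that by (metis cnj_ip complex_cnj_zero)
    then have "p \<in> K" unfolding Ka using p(1) by blast
    moreover have "ip N k (\<lambda>s. g s - p s) = 0" if "k \<in> K" for k using p(2)[OF that] by (metis cnj_ip complex_cnj_zero)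
    ultimately show ?thesis by blast
  qed
  \<comment> \<open>\<open>K\<close> is invariant under restriction, so the components of \<open>w\<close> in \<open>K\<close> and orthogonal to \<open>K\<close> have disjoint supports.\<close>
  obtain w where w: "w \<in> sq N" "\<And>s. w s \<noteq> 0" using positive_sq[OF sf] by blast
  obtain p where p: "p \<in> K" "\<And>k. k \<in> K \<Longrightarrow> ip N k (\<lambda>s. w s - p s) = 0" using decomp[OF w(1)] by blast
  have ps: "p \<in> sq N" using subspD(1)[OF K p(1)] .
  define n where "n s = w s - p s" for s
  have ns: "n \<in> sq N" unfolding n_def using w ps by simp
  have nK: "ip N k n = 0" if "k \<in> K" for k using p(2)[OF that] unfolding n_def .
  define R where "R = {s \<in> space N. n s \<noteq> 0}"
  have Rs: "R \<in> sets N" unfolding R_def using sq_measurable[OF ns] by measurable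
  have "AE s in N. p s = 0 \<or> n s = 0"
    using Kcut[OF _ p(1)] nK by (intro AE_mult_cnj_zero[OF sf ps ns]) blast
  then have poff: "AE s in N. s \<in> R \<or> p s \<noteq> 0"
    using AE_space
  proof eventually_elim
    case (elim s)
    then show ?case using w(2)[of s] by (auto simp: n_def R_def)
  qed
  have on: "AE s in N. s \<in> R \<longrightarrow> g s = 0" if g: "g \<in> K" for g
  proof -
    have "AE s in N. g s = 0 \<or> n s = 0"
      using Kcut[OF _ g] nK by (intro AE_mult_cnj_zero[OF sf subspD(1)[OF K g] ns]) blast
    then show ?thesis by eventually_elim (auto simp: R_def)
  qed
  \<comment> \<open>Split \<open>g\<close> into \<open>p'\<close> in \<open>K\<close> and an
    orthogonal rest. On \<open>R\<close> both \<open>g\<close> and \<open>p'\<close> vanish; off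
    \<open>R\<close> the function \<open>p\<close> does not, and this makes the rest vanish
    there.\<close>
  have conv: "g \<in> K" if g: "g \<in> sq N" and z: "AE s in N. s \<in> R \<longrightarrow> g s = 0" for g
  proof -
    obtain p' where p': "p' \<in> K" "\<And>k. k \<in> K \<Longrightarrow> ip N k (\<lambda>s. g s - p' s) = 0" using decomp[OF g] by blast
    have ps': "p' \<in> sq N" using subspD(1)[OF K p'(1)] .
    have "AE s in N. p s = 0 \<or> g s - p' s = 0"
      using Kcut[OF _ p(1)] p'(2) g ps' by (intro AE_mult_cnj_zero[OF sf ps]) auto
    then have "AE s in N. g s = p' s"
      using poff on[OF p'(1)] z by eventually_elim auto
    then show ?thesis by (rule Kcong[OF g p'(1)])
  qed
  show thesis
  proof (rule that[OF Rs])
    fix g assume g: "g \<in> sq N"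
    have "(\<forall>S\<in>W. \<forall>h\<in>A. form M N S h g = 0) \<longleftrightarrow> g \<in> K" using g by (simp add: K_def)
    also have "\<dots> \<longleftrightarrow> (AE s in N. s \<in> R \<longrightarrow> g s = 0)" using on conv g by blast
    finally show "(\<forall>S\<in>W. \<forall>h\<in>A. form M N S h g = 0) \<longleftrightarrow> (AE s in N. s \<in> R \<longrightarrow> g s = 0)" .
  qed
qed

text \<open>If \<open>P\<close> is the projection given by {f \<le> t}, then \<open>R\<close> is the
  set whose indicator is \<phi>(P).\<close>

lemma level_bimodule_support:
  assumes sf: "sigma_finite_measure N" and W: "level_bimodule M N f W"
  obtains R where "R \<in> sets N"
    "\<And>g. g \<in> sq N \<Longrightarrow> (\<forall>S\<in>W. \<forall>a\<in>sq M. form M N S (restr (sublevel M f t) a) g = 0) \<longleftrightarrow> (AE s in N. s \<in> R \<longrightarrow> g s = 0)"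
proof -
  let ?L = "sublevel M f t"
  have Ls: "?L \<in> sets M" using sublevel_sets[OF level_bimoduleD(1)[OF W]] .
  have "\<exists>S'\<in>W. \<forall>g\<in>sq N. form M N S' h g = form M N S h (restr R g)"
    if S: "S \<in> W" and h: "h \<in> restr ?L ` sq M" and R: "R \<in> sets N" for S h R
  proof (intro bexI[of _ "block M N ?L R S"] ballI)
    show "block M N ?L R S \<in> W" by (rule level_bimoduleD(4)[OF W S Ls R])
    fix g assume g: "g \<in> sq N"
    have hs: "h \<in> sq M" "restr ?L h = h" using h Ls by (auto simp: restr_restr)
    have "S \<in> bounded_ops M N" using S level_bimoduleD(6)[OF W] by blast
    from block_form(2)[OF this Ls R hs(1) g] show "form M N (block M N ?L R S) h g = form M N S h (restr R g)"
      by (simp add: hs)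
  qed
  note inv = this
  have sub: "restr ?L ` sq M \<subseteq> sq M" using Ls by auto
  show thesis
  proof (rule annihilator_support[OF sf level_bimoduleD(6)[OF W] sub inv])
    fix R
    assume R: "R \<in> sets N" and iff: "\<And>g. g \<in> sq N \<Longrightarrow>
      (\<forall>S\<in>W. \<forall>h\<in>restr ?L ` sq M. form M N S h g = 0) \<longleftrightarrow> (AE s in N. s \<in> R \<longrightarrow> g s = 0)"
    show thesis
    proof (rule that[OF R])
      fix g assume "g \<in> sq N"
      from iff[OF this] show "(\<forall>S\<in>W. \<forall>a\<in>sq M. form M N S (restr ?L a) g = 0) \<longleftrightarrow> (AE s in N. s \<in> R \<longrightarrow> g s = 0)"
        by simp
    qed
  qed
qed

text \<open>Passing to the diagonal of a 2 by 2 block matrix keeps the constant \<open>C\<close>,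
  because both vectors split orthogonally. Any number of cuts therefore leaves the bound
  unchanged.\<close>

lemma bform_diag:
  assumes B: "bform M N C B" and S: "S \<in> sets M" and R: "R \<in> sets N"
  shows "bform M N C (\<lambda>f g. B (restr S f) (restr R g) + B (restr (space M - S) f) (restr (space N - R) g))"
proof -
  let ?S = "space M - S" and ?R = "space N - R"
  have s: "?S \<in> sets M" "?R \<in> sets N" using S R by auto
  note b = bform_add[OF bform_restr[OF B S R] bform_restr[OF B s]]
  have "cmod (B (restr S f) (restr R g) + B (restr ?S f) (restr ?R g)) \<le> C * nrm M f * nrm N g"
    if f: "f \<in> sq M" and g: "g \<in> sq N" for f g
  proof -
    let ?a = "nrm M (restr S f)" and ?b = "nrm M (restr ?S f)" and ?c = "nrm N (restr R g)" and ?d = "nrm N (restr ?R g)"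
    have "?a * ?c + ?b * ?d \<le> nrm M f * nrm N g"
    proof (rule power2_le_imp_le)
      have "(?a * ?c + ?b * ?d)\<^sup>2 + (?a * ?d - ?b * ?c)\<^sup>2 = (?a\<^sup>2 + ?b\<^sup>2) * (?c\<^sup>2 + ?d\<^sup>2)"
        by (simp add: power2_eq_square algebra_simps)
      also have "\<dots> = (nrm M f * nrm N g)\<^sup>2"
        using nrm_restr_split[OF S f] nrm_restr_split[OF R g] by (simp add: power_mult_distrib)
      finally show "(?a * ?c + ?b * ?d)\<^sup>2 \<le> (nrm M f * nrm N g)\<^sup>2"
        using zero_le_power2[of "?a * ?d - ?b * ?c"] by linarith
    qed simp
    then have "C * (?a * ?c + ?b * ?d) \<le> C * (nrm M f * nrm N g)" using bformD(1)[OF B] by (rule mult_left_mono)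
    moreover have "cmod (B (restr S f) (restr R g)) \<le> C * ?a * ?c" "cmod (B (restr ?S f) (restr ?R g)) \<le> C * ?b * ?d"
      using f g S R s by (auto intro!: bformD(6)[OF B])
    ultimately show ?thesis
      using norm_triangle_ineq[of "B (restr S f) (restr R g)" "B (restr ?S f) (restr ?R g)"] by (simp add: algebra_simps)
  qed
  then show ?thesis using b bformD(1)[OF B] unfolding bform_def by blast
qed

text \<open>Tychonoff's theorem, with the convergent subnet expressed as a filter \<open>H\<close>
  finer than \<open>F\<close>.\<close>

lemma bounded_cluster_filter:
  fixes G :: "'i \<Rightarrow> 'p \<Rightarrow> complex"
  assumes "F \<noteq> bot" and bd: "\<And>i p. cmod (G i p) \<le> r p"
  shows "\<exists>H x. H \<noteq> bot \<and> H \<le> F \<and> (\<forall>p. ((\<lambda>i. G i p) \<longlongrightarrow> x p) H)"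
proof -
  define K where "K = PiE UNIV (\<lambda>p. cball (0::complex) (r p))"
  have "compactin (product_topology (\<lambda>p. euclidean) UNIV) K"
    unfolding K_def by (subst compactin_PiE) simp
  then have K: "compact K" unfolding euclidean_product_topology compactin_euclidean_iff .
  have "eventually (\<lambda>y. y \<in> K) (filtermap G F)"
    unfolding eventually_filtermap using bd by (simp add: K_def PiE_def Pi_def)
  moreover have "filtermap G F \<noteq> bot" using assms(1) by (simp add: filtermap_bot_iff)
  ultimately obtain x where x: "inf (nhds x) (filtermap G F) \<noteq> bot"
    using K unfolding compact_filter by blast
  \<comment> \<open>Generated by \<open>F\<close> and the preimages of the neighbourhoods of the
    cluster point \<open>x\<close>.\<close>
  define H where "H = inf (filtercomap G (nhds x)) F"
  have "H \<noteq> bot"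
  proof
    assume "H = bot"
    then have "eventually (\<lambda>_. False) H" by simp
    then obtain P Q where P: "eventually P (filtercomap G (nhds x))" and Q: "eventually Q F"
      and PQ: "\<And>i. P i \<and> Q i \<Longrightarrow> False" unfolding H_def eventually_inf by blast
    obtain P' where P': "eventually P' (nhds x)" "\<And>i. P' (G i) \<Longrightarrow> P i"
      using P unfolding eventually_filtercomap by blast
    have "eventually (\<lambda>y. \<not> P' y) (filtermap G F)"
      unfolding eventually_filtermap using Q by (rule eventually_mono) (use P' PQ in blast)
    with P'(1) have "eventually (\<lambda>_. False) (inf (nhds x) (filtermap G F))"
      unfolding eventually_inf by blast
    then show False using x by (simp add: eventually_False)
  qed
  moreover have "H \<le> F" by (simp add: H_def)
  moreover have "((\<lambda>i. G i p) \<longlongrightarrow> x p) H" for p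
  proof -
    have "filterlim G (nhds x) H"
      unfolding H_def by (rule filterlim_mono[OF filterlim_filtercomap order_refl]) simp
    then show ?thesis
      using continuous_on_tendsto_compose[OF continuous_on_product_coordinates[of p], of G x H] by simp
  qed
  ultimately show ?thesis by (intro exI[of _ H] exI[of _ x] conjI allI)
qed

lemma bform_limit:
  assumes H: "H \<noteq> bot" and B: "\<And>i. bform M N C (B i)"
    and lim: "\<And>f g. f \<in> sq M \<Longrightarrow> g \<in> sq N \<Longrightarrow> ((\<lambda>i. B i f g) \<longlongrightarrow> b f g) H"
  shows "bform M N C b"
proof -
  have u: "b f g = c" if "f \<in> sq M" "g \<in> sq N" "((\<lambda>i. B i f g) \<longlongrightarrow> c) H" for f g c
    using tendsto_unique[OF H lim that(3)] that by blast
  have "cmod (b f g) \<le> C * nrm M f * nrm N g" if "f \<in> sq M" "g \<in> sq N" for f g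
    using bformD(6)[OF B that] by (intro tendsto_upperbound[OF tendsto_norm[OF lim[OF that]] _ H]) simp
  moreover obtain i :: 'a where True by blast
  ultimately show ?thesis
    unfolding bform_def
  proof (intro conjI ballI allI)
    fix f f' g assume *: "f \<in> sq M" "f' \<in> sq M" "g \<in> sq N"
    show "b (\<lambda>x. f x + f' x) g = b f g + b f' g"
      by (rule u) (use * in \<open>auto simp: bformD(2)[OF B] intro!: tendsto_add lim\<close>)
  next
    fix f g g' assume *: "f \<in> sq M" "g \<in> sq N" "g' \<in> sq N"
    show "b f (\<lambda>x. g x + g' x) = b f g + b f g'"
      by (rule u) (use * in \<open>auto simp: bformD(4)[OF B] intro!: tendsto_add lim\<close>)
  next
    fix c f g assume *: "f \<in> sq M" "g \<in> sq N"
    show "b (\<lambda>x. c * f x) g = c * b f g"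
      by (rule u) (use * in \<open>auto simp: bformD(3)[OF B] intro!: tendsto_mult_left lim\<close>)
    show "b f (\<lambda>x. c * g x) = cnj c * b f g"
      by (rule u) (use * in \<open>auto simp: bformD(5)[OF B] intro!: tendsto_mult_left lim\<close>)
  qed (use bformD(1)[OF B] in blast)+
qed

section \<open>Decomposition along a single nest algebra bimodule\<close>

definition block_closed :: "'a measure \<Rightarrow> 'b measure \<Rightarrow> ('a, 'b) oper set \<Rightarrow> bool" where
  "block_closed M N Z \<longleftrightarrow> (\<forall>T\<in>Z. \<forall>S\<in>sets M. \<forall>R\<in>sets N. block M N S R T \<in> Z)"

lemma block_closedD: "block_closed M N Z \<Longrightarrow> T \<in> Z \<Longrightarrow> S \<in> sets M \<Longrightarrow> R \<in> sets N \<Longrightarrow> block M N S R T \<in> Z"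
  by (simp add: block_closed_def)

text \<open>\<open>Z\<close> plays the role of Z'. What is retained of the reflexivity of \<U> is
  \<open>lower\<close>: a corner of an element of \<open>Z\<close> belongs to \<open>U\<close> if
  \<open>W\<close> vanishes in that corner.\<close>

locale level_step =
  fixes M :: "'a measure" and N :: "'b measure" and f W U Z
  assumes sfN: "sigma_finite_measure N"
    and W: "level_bimodule M N f W"
    and U: "op_subspace M N U"
    and Z: "op_subspace M N Z" "block_closed M N Z" "wcl M N Z \<subseteq> Z"
    and lower: "\<And>S R T. S \<in> sets M \<Longrightarrow> R \<in> sets N \<Longrightarrow> T \<in> Z \<Longrightarrow>
      (\<And>w a g. w \<in> W \<Longrightarrow> a \<in> sq M \<Longrightarrow> g \<in> sq N \<Longrightarrow> form M N w (restr S a) (restr R g) = 0) \<Longrightarrow> block M N S R T \<in> U"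
begin

abbreviation "L \<equiv> sublevel M f"

definition R where "R t = (SOME R. R \<in> sets N \<and> (\<forall>g\<in>sq N.
  (\<forall>S\<in>W. \<forall>a\<in>sq M. form M N S (restr (L t) a) g = 0) \<longleftrightarrow> (AE s in N. s \<in> R \<longrightarrow> g s = 0)))"

lemma R: "R t \<in> sets N"
  "g \<in> sq N \<Longrightarrow> (\<forall>S\<in>W. \<forall>a\<in>sq M. form M N S (restr (L t) a) g = 0) \<longleftrightarrow> (AE s in N. s \<in> R t \<longrightarrow> g s = 0)"
proof -
  have "\<exists>R. R \<in> sets N \<and> (\<forall>g\<in>sq N.
    (\<forall>S\<in>W. \<forall>a\<in>sq M. form M N S (restr (L t) a) g = 0) \<longleftrightarrow> (AE s in N. s \<in> R \<longrightarrow> g s = 0))"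
    by (rule level_bimodule_support[OF sfN W, of t]) blast
  from someI_ex[OF this] show "R t \<in> sets N"
    "g \<in> sq N \<Longrightarrow> (\<forall>S\<in>W. \<forall>a\<in>sq M. form M N S (restr (L t) a) g = 0) \<longleftrightarrow> (AE s in N. s \<in> R t \<longrightarrow> g s = 0)"
    unfolding R_def by blast+
qed

abbreviation "R' t \<equiv> space N - R t"

lemma level_sets: "L t \<in> sets M" "space M - L t \<in> sets M" "R' t \<in> sets N"
  using sublevel_sets[OF level_bimoduleD(1)[OF W]] R(1) by auto

lemma Zb: "T \<in> Z \<Longrightarrow> T \<in> bounded_ops M N"
  using op_subspaceD(1)[OF Z(1)] by blast

text \<open>A \<open>g\<close> annihilated by \<open>W\<close> on \<open>L t\<close> vanishes on
  \<open>R t\<close>, so it agrees with its restriction to \<open>R' t\<close>; vanishing corners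
  thus give the hypothesis of the synthesis theorem.\<close>

lemma mem_W_if_corners_vanish: 
  assumes T: "T \<in> bounded_ops M N"
    and z: "\<And>t u g. u \<in> sq M \<Longrightarrow> g \<in> sq N \<Longrightarrow> form M N T (restr (L t) u) (restr (R' t) g) = 0"
  shows "T \<in> W"
proof (rule level_bimodule_synthesis[OF W T])
  fix t u g assume u: "u \<in> sq M" and g: "g \<in> sq N"
    and "\<And>S a. S \<in> W \<Longrightarrow> a \<in> sq M \<Longrightarrow> form M N S (restr (L t) a) g = 0"
  then have ae: "AE s in N. s \<in> R t \<longrightarrow> g s = 0" using R(2)[OF g] by blast
  obtain C where C: "bform M N C (form M N T)" using form_bform[OF T] .
  have "AE s in N. g s = restr (R' t) g s"
    using ae AE_space by eventually_elim (auto simp: restr_def)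
  then have "form M N T (restr (L t) u) g = form M N T (restr (L t) u) (restr (R' t) g)"
    using u g level_sets by (intro bform_cong_AE[OF C]) auto
  then show "form M N T (restr (L t) u) g = 0" using z[OF u g] by simp
qed

text \<open>Checked at each level \<open>s\<close>. For \<open>s \<le> t\<close> the columns outside
  \<open>L t\<close> miss \<open>L s\<close>; for larger \<open>s\<close> a \<open>g\<close>
  annihilated at level \<open>s\<close> is annihilated at level \<open>t\<close> as well, hence
  vanishes on the rows \<open>R t\<close>.\<close>

lemma upper_in_W:
  assumes T: "T \<in> Z" shows "block M N (space M - L t) (R t) T \<in> W"
proof (rule level_bimodule_synthesis[OF W])
  show "block M N (space M - L t) (R t) T \<in> bounded_ops M N"
    by (rule block_form(1)[OF Zb[OF T] level_sets(2) R(1)])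
  obtain C where C: "bform M N C (form M N T)" using form_bform[OF Zb[OF T]] .
  fix s u g assume u: "u \<in> sq M" and g: "g \<in> sq N"
    and z: "\<And>S a. S \<in> W \<Longrightarrow> a \<in> sq M \<Longrightarrow> form M N S (restr (L s) a) g = 0"
  have us: "restr (space M - L t) (restr (L s) u) \<in> sq M" "restr (R t) g \<in> sq N" using u g level_sets R(1) by auto
  have "form M N T (restr (space M - L t) (restr (L s) u)) (restr (R t) g) = 0"
  proof (cases "s \<le> t")
    case True
    then have "restr (space M - L t) (restr (L s) u) = (\<lambda>x. 0 * u x)"
      by (auto simp: restr_def fun_eq_iff split: split_indicator)
    then show ?thesis using bformD(3)[OF C u us(2), of 0] by simp
  next
    case False
    have "form M N S (restr (L t) a) g = 0" if "S \<in> W" "a \<in> sq M" for S a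
    proof -
      have "restr (L t) a = restr (L s) (restr (L t) a)"
        using False by (auto simp: restr_def fun_eq_iff split: split_indicator)
      then show ?thesis using z[OF that(1), of "restr (L t) a"] that(2) level_sets(1) by simp
    qed
    then have "AE r in N. r \<in> R t \<longrightarrow> g r = 0" using R(2)[OF g, of t] by blast
    then have "AE r in N. restr (R t) g r = 0 * g r" by eventually_elim (auto simp: restr_def split: split_indicator)
    then have "form M N T (restr (space M - L t) (restr (L s) u)) (restr (R t) g)
        = form M N T (restr (space M - L t) (restr (L s) u)) (\<lambda>r. 0 * g r)"
      using us g by (intro bform_cong_AE[OF C]) auto
    then show ?thesis using bformD(5)[OF C us(1) g, of 0] by simp
  qed
  then show "form M N (block M N (space M - L t) (R t) T) (restr (L s) u) g = 0"
    using block_form(2)[OF Zb[OF T] level_sets(2) R(1), of "restr (L s) u" g] u g level_sets by simp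
qed

lemma lower_in_U:
  assumes T: "T \<in> Z" shows "block M N (L t) (R' t) T \<in> U"
proof (rule lower[OF level_sets(1,3) T])
  fix w a g assume w: "w \<in> W" and a: "a \<in> sq M" and g: "g \<in> sq N"
  have "AE s in N. s \<in> R t \<longrightarrow> restr (R' t) g s = 0" by (auto simp: restr_def)
  then show "form M N w (restr (L t) a) (restr (R' t) g) = 0"
    using R(2)[of "restr (R' t) g" t] g level_sets w a by blast
qed

text \<open>\<open>u\<close> collects the blocks of \<open>T\<close> below the diagonal, \<open>z\<close> those above it, and \<open>D\<close> is the diagonal part.\<close>

definition diag_decomp where
  "diag_decomp T F u z D \<longleftrightarrow> u \<in> U \<and> z \<in> Z \<inter> W \<and> D \<in> Z \<and> (\<forall>C. bform M N C (form M N T) \<longrightarrow> bform M N C (form M N D)) \<and>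
    (\<forall>a\<in>sq M. \<forall>g\<in>sq N. form M N T a g = form M N u a g + form M N z a g + form M N D a g) \<and>
    (\<forall>t\<in>F. \<forall>a\<in>sq M. \<forall>g\<in>sq N. form M N D (restr (L t) a) (restr (R' t) g) = 0)"

text \<open>A further level cuts only the current diagonal part. Of its four corners the two off the
  diagonal are added to \<open>u\<close> and \<open>z\<close>; corners that vanished before stay
  zero because restrictions commute.\<close>

lemma decomposition:
  assumes T: "T \<in> Z" and "finite F"
  shows "\<exists>u z D. diag_decomp T F u z D"
  using assms(2)
proof (induction F)
  case empty
  have "diag_decomp T {} (op_zero M N) (op_zero M N) T"
    unfolding diag_decomp_def using T op_subspaceD(2)[OF U] op_subspaceD(2)[OF Z(1)] op_subspaceD(2)[OF level_bimoduleD(2)[OF W]]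
    by (auto simp: op_zero_form)
  then show ?case by blast
next
  case (insert t F)
  then obtain u z D where g: "diag_decomp T F u z D" by blast
  have D: "D \<in> Z" and u: "u \<in> U" and z: "z \<in> Z" "z \<in> W" using g by (auto simp: diag_decomp_def)
  note Db = Zb[OF D]
  have ub: "u \<in> bounded_ops M N" using u op_subspaceD(1)[OF U] by blast
  let ?L' = "space M - L t"
  let ?d1 = "block M N (L t) (R t) D" and ?d2 = "block M N ?L' (R' t) D"
  let ?up = "block M N ?L' (R t) D" and ?lo = "block M N (L t) (R' t) D"
  have blZ: "block M N A B D \<in> Z" if "A \<in> sets M" "B \<in> sets N" for A B using block_closedD[OF Z(2) D that] .
  note bl = blZ[OF level_sets(1) R(1), of t t] blZ[OF level_sets(2,3), of t t] blZ[OF level_sets(2) R(1), of t t] blZ[OF level_sets(1,3), of t t]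
  note fb = block_form(2)[OF Db level_sets(1) R(1), of _ _ t t] block_form(2)[OF Db level_sets(2,3), of _ _ t t]
    block_form(2)[OF Db level_sets(2) R(1), of _ _ t t] block_form(2)[OF Db level_sets(1,3), of _ _ t t]
  let ?D = "op_add M N ?d1 ?d2"
  have Dform: "form M N ?D a b = form M N D (restr (L t) a) (restr (R t) b) + form M N D (restr ?L' a) (restr (R' t) b)"
    if "a \<in> sq M" "b \<in> sq N" for a b
    using op_add_form(2)[OF Zb[OF bl(1)] Zb[OF bl(2)] that] fb(1,2)[OF that] by simp
  obtain K where K: "bform M N K (form M N D)" using form_bform[OF Db] .
  have "diag_decomp T (insert t F) (op_add M N u ?lo) (op_add M N z ?up) ?D"
    unfolding diag_decomp_def
  proof (intro conjI allI impI ballI)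
    show "op_add M N u ?lo \<in> U" by (rule op_subspaceD(3)[OF U u lower_in_U[OF D]])
    show "op_add M N z ?up \<in> Z \<inter> W"
      using op_subspaceD(3)[OF Z(1) z(1) bl(3)] op_subspaceD(3)[OF level_bimoduleD(2)[OF W] z(2) upper_in_W[OF D]] by simp
    show "?D \<in> Z" by (rule op_subspaceD(3)[OF Z(1) bl(1,2)])
  next
    fix C assume "bform M N C (form M N T)"
    then have "bform M N C (form M N D)" using g by (simp add: diag_decomp_def)
    from bform_diag[OF this level_sets(1) R(1), of t t] show "bform M N C (form M N ?D)"
      unfolding bform_def by (auto simp: Dform)
  next
    fix a b assume ab: "a \<in> sq M" "b \<in> sq N"
    have ca: "restr (L t) a \<in> sq M" "restr ?L' a \<in> sq M" "restr (R t) b \<in> sq N" "restr (R' t) b \<in> sq N"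
      using ab level_sets R(1) by auto
    have "form M N D a b = form M N D (\<lambda>x. restr (L t) a x + restr ?L' a x) (\<lambda>y. restr (R t) b y + restr (R' t) b y)"
    proof (rule bform_cong_AE[OF K])
      show "AE x in M. a x = restr (L t) a x + restr ?L' a x"
        using AE_space by eventually_elim (auto simp: restr_def split: split_indicator)
      show "AE y in N. b y = restr (R t) b y + restr (R' t) b y"
        using AE_space by eventually_elim (auto simp: restr_def split: split_indicator)
    qed (use ab ca in auto)
    also have "\<dots> = form M N ?lo a b + form M N ?up a b + form M N ?D a b"
      unfolding Dform[OF ab] fb(3,4)[OF ab]
      using ca sq_add[OF ca(3,4)] by (simp only: bformD(2)[OF K] bformD(4)[OF K]) (simp add: algebra_simps)
    finally have "form M N D a b = form M N ?lo a b + form M N ?up a b + form M N ?D a b" .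
    moreover have "form M N T a b = form M N u a b + form M N z a b + form M N D a b"
      using g ab by (simp add: diag_decomp_def)
    ultimately show "form M N T a b = form M N (op_add M N u ?lo) a b + form M N (op_add M N z ?up) a b + form M N ?D a b"
      using op_add_form(2)[OF ub Zb[OF bl(4)] ab] op_add_form(2)[OF Zb[OF z(1)] Zb[OF bl(3)] ab]
      by (simp add: algebra_simps)
  next
    fix s a b assume s: "s \<in> insert t F" and ab: "a \<in> sq M" "b \<in> sq N"
    have ca: "restr (L s) a \<in> sq M" "restr (R' s) b \<in> sq N" using ab level_sets by auto
    have D0: "form M N D (\<lambda>x. 0) k = 0" "form M N D h (\<lambda>x. 0) = 0" if "k \<in> sq N" "h \<in> sq M" for h k
      using bformD(3)[OF K that(2,1), of 0] bformD(5)[OF K that(2,1), of 0] by simp_all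
    show "form M N ?D (restr (L s) a) (restr (R' s) b) = 0"
    proof (cases "s = t")
      case True
      have "restr (R t) (restr (R' t) b) = (\<lambda>x. 0)" "restr ?L' (restr (L t) a) = (\<lambda>x. 0)"
        by (auto simp: restr_def fun_eq_iff split: split_indicator)
      then show ?thesis unfolding Dform[OF ca] using D0 ab level_sets True by simp
    next
      case False
      then have "s \<in> F" using s by simp
      then have zero: "form M N D (restr (L s) a') (restr (R' s) b') = 0" if "a' \<in> sq M" "b' \<in> sq N" for a' b'
        using g that by (auto simp: diag_decomp_def)
      have sw: "restr A (restr B h) = restr B (restr A h)" for A B and h :: "'c \<Rightarrow> complex"
        by (simp add: restr_restr Int_commute)
      show ?thesis
        unfolding Dform[OF ca] sw[of _ "L s"] sw[of _ "R' s"] using zero ab level_sets R(1) by simp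
    qed
  qed
  then show ?case by blast
qed

theorem mem_wcl_sum:
  assumes T: "T \<in> Z" shows "T \<in> wcl M N (op_sum M N U (Z \<inter> W))"
proof -
  note Tb = Zb[OF T]
  obtain C where C: "bform M N C (form M N T)" using form_bform[OF Tb] .
  \<comment> \<open>The filter of finite subsets lives on all sets of reals, so infinite sets are
    given a decomposition for the empty set.\<close>
  have "\<exists>q. diag_decomp T (if finite F then F else {}) (fst q) (fst (snd q)) (snd (snd q))" for F
  proof -
    have "finite (if finite F then F else {})" by simp
    from decomposition[OF T this] obtain u z D where "diag_decomp T (if finite F then F else {}) u z D" by blast
    then have "diag_decomp T (if finite F then F else {}) (fst (u, z, D)) (fst (snd (u, z, D))) (snd (snd (u, z, D)))"
      by (simp only: fst_conv snd_conv)
    then show ?thesis by (rule exI)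
  qed
  then have "\<forall>F. \<exists>q. diag_decomp T (if finite F then F else {}) (fst q) (fst (snd q)) (snd (snd q))" by blast
  from choice[OF this] obtain q
    where q: "\<And>F. diag_decomp T (if finite F then F else {}) (fst (q F)) (fst (snd (q F))) (snd (snd (q F)))" by blast
  define u where "u F = fst (q F)" for F
  define z where "z F = fst (snd (q F))" for F
  define D where "D F = snd (snd (q F))" for F
  have g: "diag_decomp T (if finite F then F else {}) (u F) (z F) (D F)" for F
    using q unfolding u_def z_def D_def .
  have u: "u F \<in> U" and z: "z F \<in> Z" "z F \<in> W" and D: "D F \<in> Z" and DC: "bform M N C (form M N (D F))"
    and sum: "\<And>a b. a \<in> sq M \<Longrightarrow> b \<in> sq N \<Longrightarrow> form M N T a b = form M N (u F) a b + form M N (z F) a b + form M N (D F) a b" for F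
    using g[of F] C by (auto simp: diag_decomp_def)
  \<comment> \<open>Extended by 0 to arguments that are not square integrable, so that the bound
    holds at every index of the product.\<close>
  define G where "G F p = (if fst p \<in> sq M \<and> snd p \<in> sq N then form M N (D F) (fst p) (snd p) else 0)"
    for F :: "real set" and p
  have G: "cmod (G F p) \<le> C * nrm M (fst p) * nrm N (snd p)" for F p
    using bformD(6)[OF DC] bformD(1)[OF C] by (auto simp: G_def)
  have "\<exists>H x. H \<noteq> bot \<and> H \<le> finite_subsets_at_top UNIV \<and> (\<forall>p. ((\<lambda>F. G F p) \<longlongrightarrow> x p) H)"
    by (rule bounded_cluster_filter[OF finite_subsets_at_top_neq_bot G])
  then obtain H x where H: "H \<noteq> bot" "H \<le> finite_subsets_at_top UNIV" "\<And>p. ((\<lambda>F. G F p) \<longlongrightarrow> x p) H"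
    by (elim exE conjE) (rule that, assumption, assumption, erule spec)
  have lim: "((\<lambda>F. form M N (D F) a b) \<longlongrightarrow> x (a, b)) H" if "a \<in> sq M" "b \<in> sq N" for a b
    using H(3)[of "(a, b)"] that by (simp add: G_def)
  have bx: "bform M N C (\<lambda>a b. x (a, b))" by (rule bform_limit[OF H(1) DC lim])
  obtain E where E: "E \<in> bounded_ops M N" "\<And>a b. a \<in> sq M \<Longrightarrow> b \<in> sq N \<Longrightarrow> form M N E a b = x (a, b)"
    using op_of_form[OF bx] by blast
  have limE: "((\<lambda>F. form M N (D F) a b) \<longlongrightarrow> form M N E a b) H" if "a \<in> sq M" "b \<in> sq N" for a b
    using lim[OF that] E(2)[OF that] by simp
  have EZ: "E \<in> Z"
    using wcl_limit[OF op_subspaceD(1)[OF Z(1)] E(1) H(1) D DC limE] Z(3) by blast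
  have EW: "E \<in> W"
  proof (rule mem_W_if_corners_vanish[OF E(1)])
    fix t :: real and a b assume ab: "a \<in> sq M" "b \<in> sq N"
    \<comment> \<open>Every level eventually belongs to \<open>F\<close>, so each lower corner of
      \<open>D F\<close> is eventually zero.\<close>
    have "\<forall>\<^sub>F F in finite_subsets_at_top UNIV. finite F \<and> t \<in> F"
      unfolding eventually_finite_subsets_at_top by (intro exI[of _ "{t}"]) auto
    then have "\<forall>\<^sub>F F in H. finite F \<and> t \<in> F" using H(2) by (auto simp: le_filter_def)
    then have "\<forall>\<^sub>F F in H. form M N (D F) (restr (L t) a) (restr (R' t) b) = 0"
    proof eventually_elim
      case (elim F)
      then show ?case using g[of F] ab by (simp add: diag_decomp_def)
    qed
    then have "((\<lambda>F. form M N (D F) (restr (L t) a) (restr (R' t) b)) \<longlongrightarrow> 0) H" by (rule tendsto_eventually)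
    moreover have "((\<lambda>F. form M N (D F) (restr (L t) a) (restr (R' t) b)) \<longlongrightarrow> form M N E (restr (L t) a) (restr (R' t) b)) H"
      using ab level_sets by (intro limE) auto
    ultimately show "form M N E (restr (L t) a) (restr (R' t) b) = 0" using tendsto_unique[OF H(1)] by blast
  qed
  have ub: "u F \<in> bounded_ops M N" for F using u op_subspaceD(1)[OF U] by blast
  \<comment> \<open>This is \<open>T - D F + E\<close>, bounded uniformly in \<open>F\<close> even
    where \<open>u F\<close> and \<open>z F\<close> are not.\<close>
  define V where "V F = op_add M N (u F) (op_add M N (z F) E)" for F
  have zE: "op_add M N (z F) E \<in> Z \<inter> W" for F
    using op_subspaceD(3)[OF Z(1) z(1) EZ] op_subspaceD(3)[OF level_bimoduleD(2)[OF W] z(2) EW] by simp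
  have Vs: "V F \<in> op_sum M N U (Z \<inter> W)" for F unfolding V_def op_sum_def using u zE by blast
  have Vform: "form M N (V F) a b = form M N T a b + (-1) * form M N (D F) a b + form M N E a b"
    if "a \<in> sq M" "b \<in> sq N" for F a b
  proof -
    have "form M N (V F) a b = form M N (u F) a b + (form M N (z F) a b + form M N E a b)"
      unfolding V_def using op_add_form(2)[OF ub Zb that, of "op_add M N (z F) E" F]
        op_add_form(2)[OF Zb[OF z(1)] E(1) that, of F] zE[of F] by simp
    then show ?thesis using sum[OF that, of F] by simp
  qed
  have X: "op_sum M N U (Z \<inter> W) \<subseteq> bounded_ops M N"
    unfolding op_sum_def using op_subspaceD(1)[OF U] Zb op_add_form(1) by blast
  obtain K where K: "bform M N K (form M N E)" using form_bform[OF E(1)] .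
  note bV = bform_add[OF bform_add[OF C bform_scale[OF DC, of "-1"]] K]
  show ?thesis
  proof (rule wcl_limit[OF X Tb H(1) Vs])
    show "bform M N (C + cmod (- 1) * C + K) (form M N (V F))" for F
      using bV[of F] unfolding bform_def by (auto simp: Vform)
    fix a b assume ab: "a \<in> sq M" "b \<in> sq N"
    have "((\<lambda>F. form M N T a b + (-1) * form M N (D F) a b + form M N E a b) \<longlongrightarrow>
        form M N T a b + (-1) * form M N E a b + form M N E a b) H"
      by (intro tendsto_intros limE ab)
    then show "((\<lambda>F. form M N (V F) a b) \<longlongrightarrow> form M N T a b) H" by (simp add: Vform[OF ab])
  qed
qed

end

section \<open>Intersections of finitely many nest algebra bimodules\<close>

lemma op_sum_subspace_bounded:
  assumes "U \<subseteq> bounded_ops M N" "V \<subseteq> bounded_ops M N" shows "op_sum M N U V \<subseteq> bounded_ops M N"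
  unfolding op_sum_def using assms op_add_form(1) by blast

theorem finite_width_sum_reflexive:
  fixes M :: "'a measure" and N :: "'b measure"
  assumes sfM: "sigma_finite_measure M" and sfN: "sigma_finite_measure N"
    and U: "masa_bimodule M N \<U>" "reflexive M N \<U>"
    and \<F>: "finite \<F>" "\<F> \<noteq> {}" "\<And>W. W \<in> \<F> \<Longrightarrow> nest_algebra_bimodule M N W"
  shows "reflexive M N (wcl M N (op_sum M N \<U> (\<Inter>\<F>)))"
proof -
  let ?V = "\<Inter>\<F>" and ?X = "op_sum M N \<U> (\<Inter>\<F>)"
  have "\<exists>f. level_bimodule M N f W" if "W \<in> \<F>" for W
    using nest_algebra_bimodule_level[OF sfM \<F>(3)[OF that]] by blast
  then obtain fW where fW: "\<And>W. W \<in> \<F> \<Longrightarrow> level_bimodule M N (fW W) W" by metis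
  have Us: "op_subspace M N \<U>" using U(1) by (simp add: masa_bimodule_def)
  have Ublock: "block_closed M N \<U>"
    unfolding block_closed_def
  proof (intro ballI)
    fix T S R assume T: "T \<in> \<U>" and S: "S \<in> sets M" and R: "R \<in> sets N"
    have "mult_op M (indicator S) \<in> masa M" "mult_op N (indicator R) \<in> masa N"
      unfolding masa_def using indicator_ess_bounded S R by blast+
    then show "block M N S R T \<in> \<U>" using U(1) T by (simp add: masa_bimodule_def block_def)
  qed
  have Vs: "op_subspace M N ?V"
    using \<F>(2) level_bimoduleD(2)[OF fW] unfolding op_subspace_def by blast
  have Vblock: "block_closed M N ?V"
    using level_bimoduleD(4)[OF fW] unfolding block_closed_def by blast
  note Ub = op_subspaceD(1)[OF Us] and Vb = op_subspaceD(1)[OF Vs]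
  have Xb: "?X \<subseteq> bounded_ops M N" by (rule op_sum_subspace_bounded[OF Ub Vb])
  \<comment> \<open>The reflexive hull of the sum, described by rank one functionals; in this form
    stability under corners and weak* closedness are easy to check.\<close>
  define Z where "Z = {T \<in> bounded_ops M N. \<forall>f\<in>sq M. \<forall>g\<in>sq N.
    (\<forall>u\<in>\<U>. form M N u f g = 0) \<and> (\<forall>v\<in>?V. form M N v f g = 0) \<longrightarrow> form M N T f g = 0}"
  have Zb: "T \<in> bounded_ops M N" if "T \<in> Z" for T using that by (simp add: Z_def)
  have Zs: "op_subspace M N Z"
    unfolding op_subspace_def Z_def by (auto simp: op_zero_form op_add_form op_scale_form)
  have restr_zero: "form M N v (restr S f) (restr R g) = 0"
    if "Y \<subseteq> bounded_ops M N" "block_closed M N Y" "S \<in> sets M" "R \<in> sets N" "f \<in> sq M" "g \<in> sq N"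
      "\<forall>v\<in>Y. form M N v f g = 0" "v \<in> Y" for Y v S R f g
  proof -
    have "v \<in> bounded_ops M N" using that(1,8) by blast
    from block_form(2)[OF this that(3-6)] show ?thesis
      using block_closedD[OF that(2,8,3,4)] that(7) by simp
  qed
  have Zblock: "block_closed M N Z"
    unfolding block_closed_def
  proof (intro ballI)
    fix T S R assume T: "T \<in> Z" and S: "S \<in> sets M" and R: "R \<in> sets N"
    note b = block_form[OF Zb[OF T] S R]
    have "form M N (block M N S R T) f g = 0" if f: "f \<in> sq M" and g: "g \<in> sq N"
      and a: "\<forall>u\<in>\<U>. form M N u f g = 0" "\<forall>v\<in>?V. form M N v f g = 0" for f g
    proof -
      have "restr S f \<in> sq M" "restr R g \<in> sq N" using f g S R by auto
      then have "form M N T (restr S f) (restr R g) = 0"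
        using T restr_zero[OF Ub Ublock S R f g a(1)] restr_zero[OF Vb Vblock S R f g a(2)] unfolding Z_def by blast
      then show ?thesis using b(2)[OF f g] by simp
    qed
    then show "block M N S R T \<in> Z" using b(1) by (simp add: Z_def)
  qed
  have Zbs: "Z \<subseteq> bounded_ops M N" using Zb by blast
  have Zcl: "wcl M N Z \<subseteq> Z"
  proof
    fix T assume T: "T \<in> wcl M N Z"
    then have Tb: "T \<in> bounded_ops M N" using wcl_bounded by blast
    have "form M N T f g = 0" if "f \<in> sq M" "g \<in> sq N"
      and "\<forall>u\<in>\<U>. form M N u f g = 0" "\<forall>v\<in>?V. form M N v f g = 0" for f g
    proof (rule wcl_annihilator[OF Zbs T that(1,2)])
      fix S assume "S \<in> Z"
      then show "form M N S f g = 0" using that by (simp add: Z_def)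
    qed
    then show "T \<in> Z" using Tb by (simp add: Z_def)
  qed
  \<comment> \<open>A pair annihilated by \<U> stays so when restricted to the corner, where
    \<open>W\<close> and with it the intersection vanish too. By definition of \<open>Z\<close> the
    restricted pair annihilates \<open>T\<close>, and reflexivity puts the corner into \<U>.\<close>
  have lower: "block M N S R T \<in> \<U>" if W: "W \<in> \<F>" and S: "S \<in> sets M" and R: "R \<in> sets N" and T: "T \<in> Z"
    and z: "\<And>w a g. w \<in> W \<Longrightarrow> a \<in> sq M \<Longrightarrow> g \<in> sq N \<Longrightarrow> form M N w (restr S a) (restr R g) = 0" for W S R T
  proof -
    note b = block_form[OF Zb[OF T] S R]
    have "block M N S R T \<in> reflexive_hull M N \<U>"
    proof (rule reflexive_hullI[OF Us b(1)])
      fix f g assume f: "f \<in> sq M" and g: "g \<in> sq N" and a: "\<And>u. u \<in> \<U> \<Longrightarrow> form M N u f g = 0"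
      have "restr S f \<in> sq M" "restr R g \<in> sq N" using f g S R by auto
      moreover have "form M N v (restr S f) (restr R g) = 0" if "v \<in> ?V" for v
        using z[OF _ f g] that W by blast
      ultimately have "form M N T (restr S f) (restr R g) = 0"
        using T restr_zero[OF Ub Ublock S R f g] a unfolding Z_def by blast
      then show "form M N (block M N S R T) f g = 0" using b(2)[OF f g] by simp
    qed
    then show ?thesis using U(2) by (simp add: reflexive_def)
  qed
  have step: "Z \<subseteq> wcl M N (op_sum M N \<U> (Z \<inter> \<Inter>\<G>))" if "finite \<G>" "\<G> \<subseteq> \<F>" for \<G>
    using that
  proof (induction \<G>)
    case empty
    have "T \<in> op_sum M N \<U> Z" if T: "T \<in> Z" for T
    proof -
      have "op_add M N (op_zero M N) T = T"
        using op_add_form[OF op_zero_form(1) Zb[OF T]] Zb[OF T] by (intro op_eqI) (auto simp: op_zero_form)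
      then show ?thesis unfolding op_sum_def using op_subspaceD(2)[OF Us] T by force
    qed
    then show ?case using wcl_subset[OF op_sum_subspace_bounded[OF Ub Zbs]] by auto
  next
    case (insert W \<G>)
    then have W: "W \<in> \<F>" and \<G>: "\<G> \<subseteq> \<F>" by auto
    let ?Z = "Z \<inter> \<Inter>\<G>" and ?Z' = "Z \<inter> \<Inter>(insert W \<G>)"
    note l\<G> = fW[OF subsetD[OF \<G>]]
    interpret level_step M N "fW W" W \<U> ?Z
    proof (rule level_step.intro[OF sfN fW[OF W] Us])
      show "op_subspace M N ?Z"
        using Zs level_bimoduleD(2)[OF l\<G>] unfolding op_subspace_def by blast
      show "block_closed M N ?Z"
        using Zblock level_bimoduleD(4)[OF l\<G>] unfolding block_closed_def by blast
      show "wcl M N ?Z \<subseteq> ?Z"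
      proof
        fix T assume T: "T \<in> wcl M N ?Z"
        have "T \<in> Z" using T Zcl closure_of_mono[of ?Z Z "weak_star_topology M N"] by blast
        moreover have "T \<in> W'" if W': "W' \<in> \<G>" for W'
        proof -
          have "T \<in> wcl M N W'" using T W' closure_of_mono[of ?Z W' "weak_star_topology M N"] by blast
          then show ?thesis using level_bimoduleD(3)[OF l\<G>[OF W']] by blast
        qed
        ultimately show "T \<in> ?Z" by blast
      qed
    qed (use lower[OF W] in blast)
    have eq: "?Z \<inter> W = ?Z'" by blast
    have Yb: "op_sum M N \<U> ?Z' \<subseteq> bounded_ops M N" using op_sum_subspace_bounded[OF Ub] Zbs by blast
    \<comment> \<open>The old second summand lies in the new closure by the step for
      \<open>W\<close>, and translation by \<U> extends this to the whole sum.\<close>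
    have "op_sum M N \<U> ?Z \<subseteq> wcl M N (op_sum M N \<U> ?Z')"
    proof
      fix T assume "T \<in> op_sum M N \<U> ?Z"
      then obtain u z where uz: "T = op_add M N u z" "u \<in> \<U>" "z \<in> ?Z" by (auto simp: op_sum_def)
      show "T \<in> wcl M N (op_sum M N \<U> ?Z')"
        unfolding uz(1)
      proof (rule wcl_translate[OF Yb])
        show "u \<in> bounded_ops M N" using uz Ub by blast
        show "z \<in> wcl M N (op_sum M N \<U> ?Z')" using mem_wcl_sum[OF uz(3)] unfolding eq .
        fix S assume "S \<in> op_sum M N \<U> ?Z'"
        then obtain u' z' where S: "S = op_add M N u' z'" "u' \<in> \<U>" "z' \<in> ?Z'" by (auto simp: op_sum_def)
        have ob: "u \<in> bounded_ops M N" "u' \<in> bounded_ops M N" "z' \<in> bounded_ops M N" using uz S Ub Zbs by blast+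
        have "op_add M N u S = op_add M N (op_add M N u u') z'"
          unfolding S(1) using ob by (intro op_eqI[where M = M and N = N]) (auto simp: op_add_form algebra_simps)
        then show "op_add M N u S \<in> op_sum M N \<U> ?Z'"
          unfolding op_sum_def using op_subspaceD(3)[OF Us uz(2) S(2)] S(3) by blast
      qed
    qed
    then have "wcl M N (op_sum M N \<U> ?Z) \<subseteq> wcl M N (op_sum M N \<U> ?Z')"
      by (intro closure_of_minimal) auto
    then show ?case using insert.IH[OF \<G>] by blast
  qed
  have "Z \<subseteq> wcl M N (op_sum M N \<U> (Z \<inter> ?V))" using step[OF \<F>(1)] by blast
  also have "\<dots> \<subseteq> wcl M N ?X" by (intro closure_of_mono) (auto simp: op_sum_def)
  finally have ZX: "Z \<subseteq> wcl M N ?X" .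
  have "reflexive_hull M N (wcl M N ?X) \<subseteq> Z"
  proof
    fix T assume T: "T \<in> reflexive_hull M N (wcl M N ?X)"
    have Tb: "T \<in> bounded_ops M N" using T by (simp add: reflexive_hull_def)
    have "form M N T f g = 0" if fg: "f \<in> sq M" "g \<in> sq N"
      and a: "\<forall>u\<in>\<U>. form M N u f g = 0" "\<forall>v\<in>?V. form M N v f g = 0" for f g
    proof (rule reflexive_hull_annihilator[OF wcl_bounded T fg], rule wcl_annihilator[OF Xb _ fg], assumption)
      fix S assume "S \<in> ?X"
      then obtain u v where S: "S = op_add M N u v" "u \<in> \<U>" "v \<in> ?V" unfolding op_sum_def by blast
      have "u \<in> bounded_ops M N" "v \<in> bounded_ops M N" using S(2) Ub S(3) Vb by blast+
      then show "form M N S f g = 0" unfolding S(1) using fg a S(2,3) by (simp add: op_add_form)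
    qed
    then show "T \<in> Z" using Tb by (simp add: Z_def)
  qed
  moreover have "wcl M N ?X \<subseteq> reflexive_hull M N (wcl M N ?X)"
  proof
    fix T assume T: "T \<in> wcl M N ?X"
    then have Tb: "T \<in> bounded_ops M N" using wcl_bounded by blast
    interpret Metric_space "L2 N" "l2_dist N" by (rule Metric_space_L2)
    have "T u \<in> l2_topology N closure_of ((\<lambda>S. S u) ` wcl M N ?X)" if u: "u \<in> L2 M" for u
    proof -
      have "(\<lambda>S. S u) ` wcl M N ?X \<subseteq> topspace (l2_topology N)"
        unfolding l2_topology_def using bounded_opsD(1)[OF subsetD[OF wcl_bounded] u] by auto
      from closure_of_subset[OF this] T show ?thesis by blast
    qed
    then show "T \<in> reflexive_hull M N (wcl M N ?X)" using Tb by (simp add: reflexive_hull_def)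
  qed
  ultimately show ?thesis unfolding reflexive_def using ZX by blast
qed

theorem corollary3p7:
  fixes M :: "'a measure" and N :: "'b measure" and \<U> :: "('a, 'b) oper set"
  assumes "standard_measure M" and "standard_measure N"
    and "masa_bimodule M N \<U>" and "reflexive M N \<U>"
  shows "(\<forall>\<V>. masa_bimodule M N \<V> \<and> finite_width M N \<V> \<longrightarrow>
             reflexive M N (weak_star_topology M N closure_of op_sum M N \<U> \<V>)) \<and>
         (\<forall>\<W>. nest_algebra_bimodule M N \<W> \<longrightarrow>
             reflexive M N (weak_star_topology M N closure_of op_sum M N \<U> \<W>))"
proof -
  have sf: "sigma_finite_measure M" "sigma_finite_measure N"
    using assms(1,2) by (auto simp: standard_measure_def)
  note main = finite_width_sum_reflexive[OF sf assms(3,4)]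
  show ?thesis
  proof (intro conjI allI impI)
    fix \<V> assume "masa_bimodule M N \<V> \<and> finite_width M N \<V>"
    then obtain \<F> where "finite \<F>" "\<F> \<noteq> {}" "\<forall>\<W>\<in>\<F>. nest_algebra_bimodule M N \<W>" "\<V> = \<Inter>\<F>"
      by (auto simp: finite_width_def)
    then show "reflexive M N (weak_star_topology M N closure_of op_sum M N \<U> \<V>)" using main[of \<F>] by simp
  next
    fix \<W> assume "nest_algebra_bimodule M N \<W>"
    then show "reflexive M N (weak_star_topology M N closure_of op_sum M N \<U> \<W>)" using main[of "{\<W>}"] by simp
  qed
qed


end
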